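(* Let $(M,\omega)$ be a symplectic manifold, $S^1\times M\ni(z,x)\mapsto\varphi^z(x)\in M$ a Hamiltonian action of the circle $S^1\subseteq\mathbb{C}$, $X_0\subseteq M$ a compact subset, $X:=\bigcup_{z\in S^1}\varphi^z(X_0)$, and $z_0\in S^1$ with complex conjugate $\overline{z_0}$. Let $[0,1]\times M\ni(t,x)\mapsto\psi^t(x)\in M$ be a smooth map satisfying $\psi^0=\mathrm{id}$. Assume that there exists a function $f\in C^\infty(M,\mathbb{R})$ such that the pair $(X_0,df)$ is rigidifying, $$f(X_0)\subseteq[0,\infty),\qquad f\circ\varphi^{z_0}(X_0)\subseteq(-\infty,0],$$ and $$\left.\frac{d}{dt}\right|_{t=0}\big(f\circ\psi^t(x)\big)>0,\qquad \left.\frac{d}{dt}\right|_{t=0}\big(f\circ\varphi^{z_0}\circ\psi^t(x)\big)\le0,\qquad\forall x\in X_0.$$ Then $$\big\Vert\varphi^{\overline{z_0}}|_X\big\Vert_X^{M,\omega}\ \ge\ \limsup_{t\searrow0}\,e\big(\psi^t(X_0),M,\omega\big).$$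
   Context: All manifolds are smooth with empty boundary. For $X_0\subseteq M$ and a one-form $\alpha\in\Omega^1(M)$, the pair $(X_0,\alpha)$ is called rigidifying iff for every symplectomorphism $\phi:M\to M$ with $\phi|_{X_0}=\mathrm{id}_{X_0}$ we have $\alpha(d\phi(x)v)=\alpha(v)$ for every $x\in X_0$ and $v\in T_xM$. For a time-dependent vector field $V:[0,1]\times M\to TM$ let $\mathcal{D}_V^t$ be the set of $x_0\in M$ for which $\dot x(s)=V(s,x(s))$, $x(0)=x_0$ has a solution $x\in C^\infty([0,t],M)$, and put $\varphi_V^t(x_0):=x(t)$ on $\mathcal{D}_V^t$. For $H\in C^\infty([0,1]\times M,\mathbb{R})$, $H^t:=H(t,\cdot)$, the Hamiltonian vector field is given by $\omega(X_{H^t},\cdot)=dH^t$, and $\varphi_H^t:=\varphi_{X_H}^t$. For a closed subset $X\subseteq M$, $V$ is called $X$-compatible iff $X\subseteq\mathcal{D}_V^1$ and $\varphi_V^t(X)=X$ for every $t\in[0,1]$. Define $\mathcal{H}(M,\omega,X):=\{H\in C^\infty([0,1]\times M,\mathbb{R})\mid X_H \text{ is } X\text{-compatible}\}$, $\mathcal{H}(M,\omega):=\mathcal{H}(M,\omega,M)$, $\operatorname{Ham}(X,\omega):=\{\varphi_H^1|_X\mid H\in\mathcal{H}(M,\omega,X)\}$. Put $\Vert H\Vert_X:=\int_0^1\big(\sup_X H^t-\inf_X H^t\big)dt$ and $\Vert H\Vert:=\Vert H\Vert_M$. For $\Phi\in\operatorname{Ham}(M,\omega)$ put $\Vert\Phi\Vert^{M,\omega}:=\inf\{\Vert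 H\Vert\mid H\in\mathcal{H}(M,\omega),\ \varphi_H^1=\Phi\}$, and for $\phi\in\operatorname{Ham}(X,\omega)$ put $\Vert\phi\Vert_X^{M,\omega}:=\inf\{\Vert\Phi\Vert^{M,\omega}\mid\Phi\in\operatorname{Ham}(M,\omega),\ \Phi|_X=\phi\}$ (with $\inf\emptyset=\infty$). In the claim, $X$ is compact and $\varphi^{\overline{z_0}}|_X\in\operatorname{Ham}(X,\omega)$. The displacement energy of a subset $A\subseteq M$ is $e(A,M,\omega):=\inf\{\Vert H\Vert\mid H\in\mathcal{H}(M,\omega),\ \varphi_H^1(A)\cap A=\emptyset\}$ (with $\inf\emptyset=\infty$). *)

theory Defs
  imports "HOL-Analysis.Analysis"
begin

section \<open>Smooth maps on subsets of normed spaces\<close>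

(* Meant for open S: the iterated directional derivatives of order less than n are Frechet
   differentiable and those of order n are continuous, i.e. f is of class C^n on S. *)
primrec times_differentiable_on ::
  "nat \<Rightarrow> 'a::real_normed_vector set \<Rightarrow> ('a \<Rightarrow> 'b::real_normed_vector) \<Rightarrow> bool" where
  "times_differentiable_on 0 S f \<longleftrightarrow> continuous_on S f"
| "times_differentiable_on (Suc n) S f \<longleftrightarrow>
     (\<forall>x\<in>S. f differentiable (at x)) \<and>
     (\<forall>v. times_differentiable_on n S (\<lambda>x. frechet_derivative f (at x) v))"

(* Local smooth extendability. This is the usual notion on open sets, on the product of [0,1]
   with an open set (smoothness up to the boundary) and on the product of the circle in the
   complex plane with an open set (smoothness on a submanifold). *)
definition smooth_on ::
  "'a::real_normed_vector set \<Rightarrow> ('a \<Rightarrow> 'b::real_normed_vector) \<Rightarrow> bool" where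
  "smooth_on S f \<longleftrightarrow>
     (\<forall>x\<in>S. \<exists>U g. open U \<and> x \<in> U \<and> (\<forall>n. times_differentiable_on n U g) \<and>
                 (\<forall>y\<in>S \<inter> U. g y = f y))"


section \<open>Smooth manifolds\<close>

(* The manifold M is the whole type 'm, a Hausdorff second countable space; its smooth structure
   is given by an atlas of charts (domain, coordinate map) into the model space 'e. Only the
   values of a coordinate map on its domain matter. *)
type_synonym ('m, 'e) chart = "'m set \<times> ('m \<Rightarrow> 'e)"

definition chart_inv :: "('m, 'e) chart \<Rightarrow> 'e \<Rightarrow> 'm" where
  "chart_inv c = inv_into (fst c) (snd c)"

definition smooth_atlas ::
  "('m::{t2_space, second_countable_topology}, 'e::euclidean_space) chart set \<Rightarrow> bool" where
  "smooth_atlas \<A> \<longleftrightarrow>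
     (\<Union>c\<in>\<A>. fst c) = UNIV \<and>
     (\<forall>c\<in>\<A>. open (fst c) \<and> open (snd c ` fst c) \<and>
            homeomorphism (fst c) (snd c ` fst c) (snd c) (chart_inv c)) \<and>
     (\<forall>c\<in>\<A>. \<forall>d\<in>\<A>. smooth_on (snd c ` (fst c \<inter> fst d)) (snd d \<circ> chart_inv c))"

definition smooth_fun ::
  "('m::topological_space, 'e::euclidean_space) chart set \<Rightarrow> ('m \<Rightarrow> real) \<Rightarrow> bool" where
  "smooth_fun \<A> f \<longleftrightarrow> (\<forall>c\<in>\<A>. smooth_on (snd c ` fst c) (f \<circ> chart_inv c))"

definition smooth_fun_family ::
  "('m::topological_space, 'e::euclidean_space) chart set \<Rightarrow> 'p::real_normed_vector set \<Rightarrow>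
   ('p \<Rightarrow> 'm \<Rightarrow> real) \<Rightarrow> bool" where
  "smooth_fun_family \<A> P H \<longleftrightarrow>
     (\<forall>c\<in>\<A>. smooth_on (P \<times> snd c ` fst c) (\<lambda>(p, u). H p (chart_inv c u)))"

definition smooth_map ::
  "('m::topological_space, 'e::euclidean_space) chart set \<Rightarrow> ('m \<Rightarrow> 'm) \<Rightarrow> bool" where
  "smooth_map \<A> F \<longleftrightarrow>
     continuous_on UNIV F \<and>
     (\<forall>c\<in>\<A>. \<forall>d\<in>\<A>. smooth_on (snd c ` (fst c \<inter> F -` fst d)) (snd d \<circ> F \<circ> chart_inv c))"

definition smooth_map_family ::
  "('m::topological_space, 'e::euclidean_space) chart set \<Rightarrow> 'p::real_normed_vector set \<Rightarrow>
   ('p \<Rightarrow> 'm \<Rightarrow> 'm) \<Rightarrow> bool" where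
  "smooth_map_family \<A> P F \<longleftrightarrow>
     continuous_on (P \<times> UNIV) (\<lambda>(p, x). F p x) \<and>
     (\<forall>c\<in>\<A>. \<forall>d\<in>\<A>.
        smooth_on {(p, snd c x) | p x. p \<in> P \<and> x \<in> fst c \<and> F p x \<in> fst d}
          (\<lambda>(p, u). snd d (F p (chart_inv c u))))"

definition smooth_curve ::
  "('m::topological_space, 'e::euclidean_space) chart set \<Rightarrow> real set \<Rightarrow> (real \<Rightarrow> 'm) \<Rightarrow> bool" where
  "smooth_curve \<A> I \<gamma> \<longleftrightarrow>
     continuous_on I \<gamma> \<and> (\<forall>c\<in>\<A>. smooth_on {s \<in> I. \<gamma> s \<in> fst c} (snd c \<circ> \<gamma>))"


section \<open>Tangent vectors and differentials\<close>

(* A tangent vector at x assigns to each chart around x a coordinate vector, subject to the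
   usual transformation law under change of charts (and is 0 on everything else, so that
   equality of tangent vectors is equality of functions). *)
type_synonym ('m, 'e) tvec = "('m, 'e) chart \<Rightarrow> 'e"

definition tangent_space ::
  "('m::topological_space, 'e::euclidean_space) chart set \<Rightarrow> 'm \<Rightarrow> ('m, 'e) tvec set" where
  "tangent_space \<A> x =
     {v. (\<forall>c. \<not> (c \<in> \<A> \<and> x \<in> fst c) \<longrightarrow> v c = 0) \<and>
         (\<forall>c\<in>\<A>. \<forall>d\<in>\<A>. x \<in> fst c \<inter> fst d \<longrightarrow>
            v d = frechet_derivative (snd d \<circ> chart_inv c) (at (snd c x)) (v c))}"

definition tangent_of_coords ::
  "('m::topological_space, 'e::euclidean_space) chart set \<Rightarrow> ('m, 'e) chart \<Rightarrow> 'm \<Rightarrow> 'e \<Rightarrow>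
   ('m, 'e) tvec" where
  "tangent_of_coords \<A> c x u =
     (\<lambda>d. if d \<in> \<A> \<and> x \<in> fst d
          then frechet_derivative (snd d \<circ> chart_inv c) (at (snd c x)) u else 0)"

(* An arbitrary chart around x; the differentials below do not depend on this choice. *)
definition chart_at ::
  "('m::topological_space, 'e::euclidean_space) chart set \<Rightarrow> 'm \<Rightarrow> ('m, 'e) chart" where
  "chart_at \<A> x = (SOME c. c \<in> \<A> \<and> x \<in> fst c)"

definition differential_fun ::
  "('m::topological_space, 'e::euclidean_space) chart set \<Rightarrow> ('m \<Rightarrow> real) \<Rightarrow>
   'm \<Rightarrow> ('m, 'e) tvec \<Rightarrow> real" where
  "differential_fun \<A> f x v =
     (let c = chart_at \<A> x in frechet_derivative (f \<circ> chart_inv c) (at (snd c x)) (v c))"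

definition differential_map ::
  "('m::topological_space, 'e::euclidean_space) chart set \<Rightarrow> ('m \<Rightarrow> 'm) \<Rightarrow>
   'm \<Rightarrow> ('m, 'e) tvec \<Rightarrow> ('m, 'e) tvec" where
  "differential_map \<A> F x v =
     (let c = chart_at \<A> x in
      (\<lambda>d. if d \<in> \<A> \<and> F x \<in> fst d
           then frechet_derivative (snd d \<circ> F \<circ> chart_inv c) (at (snd c x)) (v c) else 0))"

definition has_velocity ::
  "('m::topological_space, 'e::euclidean_space) chart set \<Rightarrow> (real \<Rightarrow> 'm) \<Rightarrow> ('m, 'e) tvec \<Rightarrow>
   real \<Rightarrow> real set \<Rightarrow> bool" where
  "has_velocity \<A> \<gamma> v s I \<longleftrightarrow>
     (\<forall>c\<in>\<A>. \<gamma> s \<in> fst c \<longrightarrow> ((snd c \<circ> \<gamma>) has_vector_derivative v c) (at s within I))"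


section \<open>Symplectic forms\<close>

definition form_coords ::
  "('m::topological_space, 'e::euclidean_space) chart set \<Rightarrow>
   ('m \<Rightarrow> ('m, 'e) tvec \<Rightarrow> ('m, 'e) tvec \<Rightarrow> real) \<Rightarrow> ('m, 'e) chart \<Rightarrow> 'e \<Rightarrow> 'e \<Rightarrow> 'e \<Rightarrow> real" where
  "form_coords \<A> \<omega> c p u w =
     (let x = chart_inv c p in
      \<omega> x (tangent_of_coords \<A> c x u) (tangent_of_coords \<A> c x w))"

definition two_form ::
  "('m::topological_space, 'e::euclidean_space) chart set \<Rightarrow>
   ('m \<Rightarrow> ('m, 'e) tvec \<Rightarrow> ('m, 'e) tvec \<Rightarrow> real) \<Rightarrow> bool" where
  "two_form \<A> \<omega> \<longleftrightarrow>
     (\<forall>c\<in>\<A>. (\<forall>p\<in>snd c ` fst c. bilinear (form_coords \<A> \<omega> c p) \<and>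
                               (\<forall>u. form_coords \<A> \<omega> c p u u = 0)) \<and>
            (\<forall>u w. smooth_on (snd c ` fst c) (\<lambda>p. form_coords \<A> \<omega> c p u w)))"

(* The exterior derivative in coordinates, evaluated on constant vector fields u, v, w. *)
definition closed_two_form ::
  "('m::topological_space, 'e::euclidean_space) chart set \<Rightarrow>
   ('m \<Rightarrow> ('m, 'e) tvec \<Rightarrow> ('m, 'e) tvec \<Rightarrow> real) \<Rightarrow> bool" where
  "closed_two_form \<A> \<omega> \<longleftrightarrow>
     (\<forall>c\<in>\<A>. \<forall>p\<in>snd c ` fst c. \<forall>u v w.
        frechet_derivative (\<lambda>q. form_coords \<A> \<omega> c q v w) (at p) u
        - frechet_derivative (\<lambda>q. form_coords \<A> \<omega> c q u w) (at p) v
        + frechet_derivative (\<lambda>q. form_coords \<A> \<omega> c q u v) (at p) w = 0)"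

definition nondegenerate_two_form ::
  "('m::topological_space, 'e::euclidean_space) chart set \<Rightarrow>
   ('m \<Rightarrow> ('m, 'e) tvec \<Rightarrow> ('m, 'e) tvec \<Rightarrow> real) \<Rightarrow> bool" where
  "nondegenerate_two_form \<A> \<omega> \<longleftrightarrow>
     (\<forall>x. \<forall>v\<in>tangent_space \<A> x. (\<forall>w\<in>tangent_space \<A> x. \<omega> x v w = 0) \<longrightarrow> v = (\<lambda>_. 0))"

definition symplectic_manifold ::
  "('m::{t2_space, second_countable_topology}, 'e::euclidean_space) chart set \<Rightarrow>
   ('m \<Rightarrow> ('m, 'e) tvec \<Rightarrow> ('m, 'e) tvec \<Rightarrow> real) \<Rightarrow> bool" where
  "symplectic_manifold \<A> \<omega> \<longleftrightarrow>
     smooth_atlas \<A> \<and> two_form \<A> \<omega> \<and> closed_two_form \<A> \<omega> \<and> nondegenerate_two_form \<A> \<omega>"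

definition symplectomorphism ::
  "('m::topological_space, 'e::euclidean_space) chart set \<Rightarrow>
   ('m \<Rightarrow> ('m, 'e) tvec \<Rightarrow> ('m, 'e) tvec \<Rightarrow> real) \<Rightarrow> ('m \<Rightarrow> 'm) \<Rightarrow> bool" where
  "symplectomorphism \<A> \<omega> \<phi> \<longleftrightarrow>
     bij \<phi> \<and> smooth_map \<A> \<phi> \<and> smooth_map \<A> (inv \<phi>) \<and>
     (\<forall>x. \<forall>v\<in>tangent_space \<A> x. \<forall>w\<in>tangent_space \<A> x.
        \<omega> (\<phi> x) (differential_map \<A> \<phi> x v) (differential_map \<A> \<phi> x w) = \<omega> x v w)"

definition rigidifying ::
  "('m::topological_space, 'e::euclidean_space) chart set \<Rightarrow>
   ('m \<Rightarrow> ('m, 'e) tvec \<Rightarrow> ('m, 'e) tvec \<Rightarrow> real) \<Rightarrow> 'm set \<Rightarrow>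
   ('m \<Rightarrow> ('m, 'e) tvec \<Rightarrow> real) \<Rightarrow> bool" where
  "rigidifying \<A> \<omega> X\<^sub>0 \<alpha> \<longleftrightarrow>
     (\<forall>\<phi>. symplectomorphism \<A> \<omega> \<phi> \<and> (\<forall>x\<in>X\<^sub>0. \<phi> x = x) \<longrightarrow>
        (\<forall>x\<in>X\<^sub>0. \<forall>v\<in>tangent_space \<A> x. \<alpha> (\<phi> x) (differential_map \<A> \<phi> x v) = \<alpha> x v))"


section \<open>Flows\<close>

definition solves_ode ::
  "('m::topological_space, 'e::euclidean_space) chart set \<Rightarrow> (real \<Rightarrow> 'm \<Rightarrow> ('m, 'e) tvec) \<Rightarrow>
   real \<Rightarrow> 'm \<Rightarrow> (real \<Rightarrow> 'm) \<Rightarrow> bool" where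
  "solves_ode \<A> V t x\<^sub>0 x \<longleftrightarrow>
     smooth_curve \<A> {0..t} x \<and> x 0 = x\<^sub>0 \<and>
     (\<forall>s\<in>{0..t}. has_velocity \<A> x (V s (x s)) s {0..t})"

definition flow_domain ::
  "('m::topological_space, 'e::euclidean_space) chart set \<Rightarrow> (real \<Rightarrow> 'm \<Rightarrow> ('m, 'e) tvec) \<Rightarrow>
   real \<Rightarrow> 'm set" where
  "flow_domain \<A> V t = {x\<^sub>0. \<exists>x. solves_ode \<A> V t x\<^sub>0 x}"

definition flow ::
  "('m::topological_space, 'e::euclidean_space) chart set \<Rightarrow> (real \<Rightarrow> 'm \<Rightarrow> ('m, 'e) tvec) \<Rightarrow>
   real \<Rightarrow> 'm \<Rightarrow> 'm" where
  "flow \<A> V t x\<^sub>0 = (THE y. \<exists>x. solves_ode \<A> V t x\<^sub>0 x \<and> y = x t)"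

definition compatible ::
  "('m::topological_space, 'e::euclidean_space) chart set \<Rightarrow> 'm set \<Rightarrow>
   (real \<Rightarrow> 'm \<Rightarrow> ('m, 'e) tvec) \<Rightarrow> bool" where
  "compatible \<A> X V \<longleftrightarrow>
     X \<subseteq> flow_domain \<A> V 1 \<and> (\<forall>t\<in>{0..1}. flow \<A> V t ` X = X)"


section \<open>Hamiltonian diffeomorphisms and Hofer norms\<close>

definition ham_vector_field ::
  "('m::topological_space, 'e::euclidean_space) chart set \<Rightarrow>
   ('m \<Rightarrow> ('m, 'e) tvec \<Rightarrow> ('m, 'e) tvec \<Rightarrow> real) \<Rightarrow> ('m \<Rightarrow> real) \<Rightarrow> 'm \<Rightarrow> ('m, 'e) tvec" where
  "ham_vector_field \<A> \<omega> h x =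
     (THE v. v \<in> tangent_space \<A> x \<and>
             (\<forall>w\<in>tangent_space \<A> x. \<omega> x v w = differential_fun \<A> h x w))"

definition ham_flow ::
  "('m::topological_space, 'e::euclidean_space) chart set \<Rightarrow>
   ('m \<Rightarrow> ('m, 'e) tvec \<Rightarrow> ('m, 'e) tvec \<Rightarrow> real) \<Rightarrow> (real \<Rightarrow> 'm \<Rightarrow> real) \<Rightarrow> real \<Rightarrow> 'm \<Rightarrow> 'm" where
  "ham_flow \<A> \<omega> H = flow \<A> (\<lambda>t. ham_vector_field \<A> \<omega> (H t))"

(* Only the values H t for t in [0,1] matter. *)
definition ham_functions ::
  "('m::topological_space, 'e::euclidean_space) chart set \<Rightarrow>
   ('m \<Rightarrow> ('m, 'e) tvec \<Rightarrow> ('m, 'e) tvec \<Rightarrow> real) \<Rightarrow> 'm set \<Rightarrow> (real \<Rightarrow> 'm \<Rightarrow> real) set" where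
  "ham_functions \<A> \<omega> X =
     {H. smooth_fun_family \<A> {0..1} H \<and>
         compatible \<A> X (\<lambda>t. ham_vector_field \<A> \<omega> (H t))}"

definition Ham ::
  "('m::topological_space, 'e::euclidean_space) chart set \<Rightarrow>
   ('m \<Rightarrow> ('m, 'e) tvec \<Rightarrow> ('m, 'e) tvec \<Rightarrow> real) \<Rightarrow> 'm set \<Rightarrow> ('m \<Rightarrow> 'm) set" where
  "Ham \<A> \<omega> X = {restrict (ham_flow \<A> \<omega> H 1) X | H. H \<in> ham_functions \<A> \<omega> X}"

definition osc_norm :: "'m set \<Rightarrow> (real \<Rightarrow> 'm \<Rightarrow> real) \<Rightarrow> ennreal" where
  "osc_norm X H =
     (\<integral>\<^sup>+t\<in>{0..1}. e2ennreal ((SUP x\<in>X. ereal (H t x)) - (INF x\<in>X. ereal (H t x))) \<partial>lborel)"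

definition hofer_norm ::
  "('m::topological_space, 'e::euclidean_space) chart set \<Rightarrow>
   ('m \<Rightarrow> ('m, 'e) tvec \<Rightarrow> ('m, 'e) tvec \<Rightarrow> real) \<Rightarrow> ('m \<Rightarrow> 'm) \<Rightarrow> ennreal" where
  "hofer_norm \<A> \<omega> \<Phi> =
     (INF H\<in>{H \<in> ham_functions \<A> \<omega> UNIV. ham_flow \<A> \<omega> H 1 = \<Phi>}. osc_norm UNIV H)"

(* The argument \<phi> is an element of Ham \<A> \<omega> X, that is, a function restricted to X. *)
definition rel_hofer_norm ::
  "('m::topological_space, 'e::euclidean_space) chart set \<Rightarrow>
   ('m \<Rightarrow> ('m, 'e) tvec \<Rightarrow> ('m, 'e) tvec \<Rightarrow> real) \<Rightarrow> 'm set \<Rightarrow> ('m \<Rightarrow> 'm) \<Rightarrow> ennreal" where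
  "rel_hofer_norm \<A> \<omega> X \<phi> =
     (INF \<Phi>\<in>{\<Phi> \<in> Ham \<A> \<omega> UNIV. restrict \<Phi> X = \<phi>}. hofer_norm \<A> \<omega> \<Phi>)"

definition displacement_energy ::
  "('m::topological_space, 'e::euclidean_space) chart set \<Rightarrow>
   ('m \<Rightarrow> ('m, 'e) tvec \<Rightarrow> ('m, 'e) tvec \<Rightarrow> real) \<Rightarrow> 'm set \<Rightarrow> ennreal" where
  "displacement_energy \<A> \<omega> S =
     (INF H\<in>{H \<in> ham_functions \<A> \<omega> UNIV. ham_flow \<A> \<omega> H 1 ` S \<inter> S = {}}. osc_norm UNIV H)"


section \<open>Hamiltonian circle actions\<close>

(* A smooth symplectic action with a momentum map \<mu>, where the Lie algebra of the circle is
   identified with the reals via s \<mapsto> cis s. Invariance of \<mu> (equivariance, as the group is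
   abelian) is automatic: the derivative of \<mu> along the generator v is \<omega>(v,v) = 0. *)
definition hamiltonian_circle_action ::
  "('m::topological_space, 'e::euclidean_space) chart set \<Rightarrow>
   ('m \<Rightarrow> ('m, 'e) tvec \<Rightarrow> ('m, 'e) tvec \<Rightarrow> real) \<Rightarrow> (complex \<Rightarrow> 'm \<Rightarrow> 'm) \<Rightarrow> bool" where
  "hamiltonian_circle_action \<A> \<omega> \<phi> \<longleftrightarrow>
     smooth_map_family \<A> (sphere 0 1) \<phi> \<and>
     \<phi> 1 = id \<and>
     (\<forall>z\<in>sphere 0 1. \<forall>w\<in>sphere 0 1. \<phi> (z * w) = \<phi> z \<circ> \<phi> w) \<and>
     (\<forall>z\<in>sphere 0 1. symplectomorphism \<A> \<omega> (\<phi> z)) \<and>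
     (\<exists>\<mu>. smooth_fun \<A> \<mu> \<and>
          (\<forall>x. has_velocity \<A> (\<lambda>s. \<phi> (cis s) x) (ham_vector_field \<A> \<omega> \<mu> x) 0 UNIV))"

end

theory Submission
  imports Defs
begin

text \<open>
  If \<open>\<Phi>\<close> is the time-one map of a Hamiltonian flow that agrees with the inverse of \<open>F = \<phi> z\<^sub>0\<close> on \<open>X\<close>,
  then \<open>\<theta> = F \<circ> \<Phi>\<close> is a symplectomorphism fixing \<open>X\<^sub>0\<close> pointwise, so rigidity gives
  \<open>f \<circ> \<theta> \<circ> \<psi>\<^sup>t\<close> the same positive derivative at \<open>t = 0\<close> as \<open>f \<circ> \<psi>\<^sup>t\<close>. By compactness \<open>f\<close> is bounded
  below by a positive multiple of \<open>t\<close> on \<open>\<theta> (\<psi>\<^sup>t X\<^sub>0)\<close> and above by a smaller one on \<open>F (\<psi>\<^sup>t X\<^sub>0)\<close> for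
  small \<open>t > 0\<close>. Hence \<open>\<Phi>\<close> displaces \<open>\<psi>\<^sup>t X\<^sub>0\<close>.

  The substantial point is that \<open>\<Phi>\<close> is a symplectomorphism. Its solution curves exist by
  compatibility, so only uniqueness and smooth dependence on the initial value are at stake. A solution
  of a linear equation \<open>Y' = A Y + b\<close> with parameters has parameter derivatives that solve equations
  with the same \<open>A\<close> and another \<open>b\<close>; this gives smoothness by an induction that never changes the
  ambient space, and the derivative of the flow solves such an equation. The time interval is then
  covered by finitely many short ones, each handled in a single chart.
\<close>

section \<open>Continuous families of maps of class C^n\<close>

text \<open>Rigidity can be tested only against global symplectomorphisms, so the flow and its
  inverse must both be smooth on all of the manifold. The usual proof of smooth dependence applies a
  C^1 theorem repeatedly to the pair (flow, derivative of the flow), which enlarges the space at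
  each step. Here the space is a type, and an induction on n cannot vary a type. Derivatives are
  therefore always taken in a fixed direction \<open>v\<close>, so that they keep their type. The
  price is that a direction depending on the point has to be expanded over \<open>Basis\<close>, a
  device that recurs up to the treatment of the form itself. The admissible t depends on two points
  of \<open>X\<^sub>0\<close>, the one that is moved and the one that it might hit. The final
  compactness argument therefore runs over \<open>X\<^sub>0 \<times> X\<^sub>0\<close>.\<close>

abbreviation fderiv :: "('a::real_normed_vector \<Rightarrow> 'b::real_normed_vector) \<Rightarrow> 'a \<Rightarrow> 'a \<Rightarrow> 'b" where
  "fderiv f x \<equiv> frechet_derivative f (at x)"

abbreviation Ck_on :: "nat \<Rightarrow> 'a::real_normed_vector set \<Rightarrow> ('a \<Rightarrow> 'b::real_normed_vector) \<Rightarrow> bool" where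
  "Ck_on \<equiv> times_differentiable_on"

text \<open>The parameter \<open>t\<close> enters only continuously, so closed time intervals need no one-sided derivatives.\<close>

primrec Ck_family ::
  "nat \<Rightarrow> 't::topological_space set \<Rightarrow> 'a::real_normed_vector set \<Rightarrow> ('t \<Rightarrow> 'a \<Rightarrow> 'b::real_normed_vector) \<Rightarrow> bool"
  where
  "Ck_family 0 T P Y \<longleftrightarrow> continuous_on (T \<times> P) (\<lambda>z. Y (fst z) (snd z))"
| "Ck_family (Suc n) T P Y \<longleftrightarrow>
     continuous_on (T \<times> P) (\<lambda>z. Y (fst z) (snd z)) \<and>
     (\<forall>t\<in>T. \<forall>x\<in>P. Y t differentiable (at x)) \<and>
     (\<forall>v. Ck_family n T P (\<lambda>t x. fderiv (Y t) x v))"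

lemma Ck_family_continuous:
  "Ck_family n T P Y \<Longrightarrow> continuous_on (T \<times> P) (\<lambda>z. Y (fst z) (snd z))"
  by (cases n) auto

lemma Ck_family_SucD: "Ck_family (Suc n) T P Y \<Longrightarrow> Ck_family n T P Y"
proof (induction n arbitrary: Y)
  case (Suc n)
  have "Ck_family n T P (\<lambda>t x. fderiv (Y t) x v)" for v
    by (rule Suc.IH) (use Suc.prems in simp)
  then show ?case using Suc.prems by simp
qed simp

lemma Ck_family_le: "m \<le> n \<Longrightarrow> Ck_family n T P Y \<Longrightarrow> Ck_family m T P Y"
  by (induction rule: inc_induct) (auto dest: Ck_family_SucD simp del: Ck_family.simps)

lemma Ck_family_cong:
  assumes "open P" and "\<And>t x. t \<in> T \<Longrightarrow> x \<in> P \<Longrightarrow> Y t x = Z t x" and "Ck_family n T P Y"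
  shows "Ck_family n T P Z"
  using assms(2,3)
proof (induction n arbitrary: Y Z)
  case 0
  then show ?case by (auto intro: continuous_on_eq)
next
  case (Suc n)
  have "continuous_on (T \<times> P) (\<lambda>z. Z (fst z) (snd z))"
    using Suc.prems by (auto intro: continuous_on_eq)
  moreover have "Z t differentiable (at x)" if "t \<in> T" "x \<in> P" for t x
  proof -
    have "Y t differentiable (at x)" using Suc.prems(2) that by simp
    then obtain D where "(Y t has_derivative D) (at x)" unfolding differentiable_def by blast
    then have "(Z t has_derivative D) (at x)"
      by (rule has_derivative_transform_within_open[of _ _ _ _ P]) (use Suc.prems that assms(1) in auto)
    then show ?thesis by (auto simp: differentiable_def)
  qed
  moreover have "Ck_family n T P (\<lambda>t x. fderiv (Z t) x v)" for v
  proof (rule Suc.IH)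
    show "Ck_family n T P (\<lambda>t x. fderiv (Y t) x v)"
      using Suc.prems by simp
    show "fderiv (Y t) x v = fderiv (Z t) x v"
      if "t \<in> T" "x \<in> P" for t x
      using frechet_derivative_transform_within_open[of "Y t" x P "Z t"] Suc.prems that assms(1)
      by simp
  qed
  ultimately show ?case by simp
qed

text \<open>Lets regularity proofs work with an explicit derivative \<open>D\<close>; openness of
  \<open>P\<close> is what allows \<open>D\<close> to replace \<open>frechet_derivative\<close> in
  the recursion.\<close>

lemma Ck_family_SucI:
  assumes "open P" and "continuous_on (T \<times> P) (\<lambda>z. Y (fst z) (snd z))"
    and "\<And>t x. t \<in> T \<Longrightarrow> x \<in> P \<Longrightarrow> (Y t has_derivative D t x) (at x)"
    and "\<And>v. Ck_family n T P (\<lambda>t x. D t x v)"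
  shows "Ck_family (Suc n) T P Y"
proof -
  have "Ck_family n T P (\<lambda>t x. fderiv (Y t) x v)" for v
    using assms(4)[of v]
    by (rule Ck_family_cong[OF assms(1), rotated]) (simp add: frechet_derivative_at[OF assms(3)])
  then show ?thesis using assms(2,3) by (auto simp: differentiable_def)
qed

lemma Ck_familyD:
  assumes "Ck_family (Suc n) T P Y" "t \<in> T" "x \<in> P"
  shows "(Y t has_derivative fderiv (Y t) x) (at x)"
  using assms by (simp add: frechet_derivative_works[symmetric])

lemma Ck_family_derivative:
  "Ck_family (Suc n) T P Y \<Longrightarrow> Ck_family n T P (\<lambda>t x. fderiv (Y t) x v)"
  by simp

lemma Ck_family_subset:
  "Ck_family n T P Y \<Longrightarrow> T' \<subseteq> T \<Longrightarrow> P' \<subseteq> P \<Longrightarrow> Ck_family n T' P' Y"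
proof (induction n arbitrary: Y)
  case 0
  then show ?case by (auto elim!: continuous_on_subset)
next
  case (Suc n)
  then show ?case by (fastforce elim!: continuous_on_subset)
qed

lemma continuous_on_family:
  assumes "continuous_on (T \<times> U) (\<lambda>z. g (fst z) (snd z))" "continuous_on S a" "continuous_on S b"
    and "\<And>z. z \<in> S \<Longrightarrow> a z \<in> T" "\<And>z. z \<in> S \<Longrightarrow> b z \<in> U"
  shows "continuous_on S (\<lambda>z. g (a z) (b z))"
proof -
  have "continuous_on S (\<lambda>z. (a z, b z))" using assms(2,3) by (rule continuous_on_Pair)
  from continuous_on_compose2[OF assms(1) this] assms(4,5) show ?thesis by auto
qed

section \<open>Locality of the class C^n in time and space\<close>

lemma continuous_on_local:
  assumes "\<And>z. z \<in> S \<Longrightarrow> \<exists>W. open W \<and> z \<in> W \<and> continuous_on (S \<inter> W) f"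
  shows "continuous_on S f"
  unfolding continuous_on_def
proof
  fix z assume "z \<in> S"
  then obtain W where W: "open W" "z \<in> W" "continuous_on (S \<inter> W) f" using assms by blast
  then have "(f \<longlongrightarrow> f z) (at z within S \<inter> W)"
    using \<open>z \<in> S\<close> by (simp add: continuous_on_def)
  moreover have "at z within S \<inter> W = at z within S"
    using W by (intro at_within_nhd[of z W]) auto
  ultimately show "(f \<longlongrightarrow> f z) (at z within S)" by simp
qed

lemma continuous_family_local:
  assumes "\<And>t x. t \<in> T \<Longrightarrow> x \<in> P \<Longrightarrow>
    \<exists>N U. open N \<and> t \<in> N \<and> open U \<and> x \<in> U \<and> Ck_family n (T \<inter> N) (P \<inter> U) Y"
  shows "continuous_on (T \<times> P) (\<lambda>z. Y (fst z) (snd z))"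
proof (rule continuous_on_local)
  fix z assume "z \<in> T \<times> P"
  then obtain N U where "open N" "fst z \<in> N" "open U" "snd z \<in> U" and Y: "Ck_family n (T \<inter> N) (P \<inter> U) Y"
    using assms[of "fst z" "snd z"] by auto
  then show "\<exists>W. open W \<and> z \<in> W \<and> continuous_on ((T \<times> P) \<inter> W) (\<lambda>z. Y (fst z) (snd z))"
    using Ck_family_continuous[OF Y]
    by (intro exI[of _ "N \<times> U"]) (auto simp: open_Times mem_Times_iff Times_Int_Times)
qed

lemma Ck_family_local:
  assumes "\<And>t x. t \<in> T \<Longrightarrow> x \<in> P \<Longrightarrow>
    \<exists>N U. open N \<and> t \<in> N \<and> open U \<and> x \<in> U \<and> Ck_family n (T \<inter> N) (P \<inter> U) Y"
  shows "Ck_family n T P Y"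
  using assms
proof (induction n arbitrary: Y)
  case 0
  then show ?case unfolding Ck_family.simps(1)[of T P] by (rule continuous_family_local)
next
  case (Suc n)
  have "continuous_on (T \<times> P) (\<lambda>z. Y (fst z) (snd z))"
    by (rule continuous_family_local[OF Suc.prems])
  moreover have "Y t differentiable (at x)" if "t \<in> T" "x \<in> P" for t x
    using Suc.prems[OF that] that by auto
  moreover have "Ck_family n T P (\<lambda>t x. fderiv (Y t) x v)" for v
  proof (rule Suc.IH)
    fix t x assume "t \<in> T" "x \<in> P"
    then obtain N U where "open N" "t \<in> N" "open U" "x \<in> U" "Ck_family (Suc n) (T \<inter> N) (P \<inter> U) Y"
      using Suc.prems[of t x] by blast
    then show "\<exists>N U. open N \<and> t \<in> N \<and> open U \<and> x \<in> U \<and>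
        Ck_family n (T \<inter> N) (P \<inter> U) (\<lambda>t x. fderiv (Y t) x v)"
      by (intro exI[of _ N] exI[of _ U]) simp
  qed
  ultimately show ?case by simp
qed

section \<open>Stability under algebraic operations and composition\<close>

lemma Ck_family_const: "open P \<Longrightarrow> Ck_family n T P (\<lambda>t x. c)"
proof (induction n arbitrary: c)
  case (Suc n)
  then show ?case by (intro Ck_family_SucI[where D="\<lambda>t x v. 0"]) auto
qed simp

lemma Ck_family_bounded_linear:
  assumes "bounded_linear L" "open P" "Ck_family n T P Y"
  shows "Ck_family n T P (\<lambda>t x. L (Y t x))"
  using assms(3)
proof (induction n arbitrary: Y)
  case 0
  then show ?case by (auto intro: bounded_linear.continuous_on[OF assms(1)])
next
  case (Suc n)
  show ?case
  proof (rule Ck_family_SucI[OF assms(2)])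
    show "continuous_on (T \<times> P) (\<lambda>z. L (Y (fst z) (snd z)))"
      using Suc.prems by (auto intro: bounded_linear.continuous_on[OF assms(1)])
    show "((\<lambda>x. L (Y t x)) has_derivative (\<lambda>v. L (fderiv (Y t) x v))) (at x)"
      if "t \<in> T" "x \<in> P" for t x
      by (rule bounded_linear.has_derivative[OF assms(1) Ck_familyD[OF Suc.prems that]])
    show "Ck_family n T P (\<lambda>t x. L (fderiv (Y t) x v))" for v
      using Suc.IH[OF Ck_family_derivative[OF Suc.prems]] .
  qed
qed

lemma Ck_family_id:
  assumes "open P" shows "Ck_family n T P (\<lambda>t x. x)"
proof (cases n)
  case 0
  then show ?thesis by (auto intro!: continuous_intros)
next
  case (Suc m)
  show ?thesis unfolding Suc
    by (rule Ck_family_SucI[OF assms, where D="\<lambda>t x v. v"])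
      (auto intro!: continuous_intros Ck_family_const assms)
qed

lemma Ck_family_linear:
  "bounded_linear L \<Longrightarrow> open P \<Longrightarrow> Ck_family n T P (\<lambda>t x. L x)"
  using Ck_family_bounded_linear Ck_family_id by blast

lemma Ck_family_add:
  assumes "open P" "Ck_family n T P Y" "Ck_family n T P Z"
  shows "Ck_family n T P (\<lambda>t x. Y t x + Z t x)"
  using assms(2,3)
proof (induction n arbitrary: Y Z)
  case 0
  then show ?case by (auto intro: continuous_intros)
next
  case (Suc n)
  show ?case
  proof (rule Ck_family_SucI[OF assms(1)])
    show "((\<lambda>x. Y t x + Z t x) has_derivative
        (\<lambda>v. fderiv (Y t) x v + fderiv (Z t) x v)) (at x)"
      if "t \<in> T" "x \<in> P" for t x
      by (intro has_derivative_add Ck_familyD[OF Suc.prems(1) that]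
          Ck_familyD[OF Suc.prems(2) that])
  qed (use Suc in \<open>auto intro: continuous_intros\<close>)
qed

lemma Ck_family_sum:
  assumes "open P" "\<And>i. i \<in> I \<Longrightarrow> Ck_family n T P (Y i)"
  shows "Ck_family n T P (\<lambda>t x. \<Sum>i\<in>I. Y i t x)"
proof (cases "finite I")
  case True
  then show ?thesis using assms(2)
  proof (induction I)
    case empty
    then show ?case using Ck_family_const[OF assms(1), of n T 0] by simp
  next
    case (insert i I)
    then show ?case
      using Ck_family_add[OF assms(1), of n T "Y i" "\<lambda>t x. \<Sum>i\<in>I. Y i t x"] by simp
  qed
next
  case False
  then show ?thesis using Ck_family_const[OF assms(1), of n T 0] by simp
qed

lemma Ck_family_bilinear:
  assumes "bounded_bilinear bl" "open P" "Ck_family n T P Y" "Ck_family n T P Z"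
  shows "Ck_family n T P (\<lambda>t x. bl (Y t x) (Z t x))"
  using assms(3,4)
proof (induction n arbitrary: Y Z)
  case 0
  then show ?case by (auto intro: bounded_bilinear.continuous_on[OF assms(1)])
next
  case (Suc n)
  show ?case
  proof (rule Ck_family_SucI[OF assms(2)])
    show "((\<lambda>x. bl (Y t x) (Z t x)) has_derivative
        (\<lambda>v. bl (Y t x) (fderiv (Z t) x v) + bl (fderiv (Y t) x v) (Z t x))) (at x)"
      if "t \<in> T" "x \<in> P" for t x
      by (intro bounded_bilinear.FDERIV[OF assms(1)] Ck_familyD[OF Suc.prems(1) that]
          Ck_familyD[OF Suc.prems(2) that])
    show "continuous_on (T \<times> P) (\<lambda>z. bl (Y (fst z) (snd z)) (Z (fst z) (snd z)))"
      using Suc.prems by (auto intro: bounded_bilinear.continuous_on[OF assms(1)])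
    show "Ck_family n T P (\<lambda>t x. bl (Y t x) (fderiv (Z t) x v) + bl (fderiv (Y t) x v) (Z t x))" for v
      using Suc.IH Ck_family_derivative[OF Suc.prems(1)] Ck_family_derivative[OF Suc.prems(2)]
        Ck_family_SucD[OF Suc.prems(1)] Ck_family_SucD[OF Suc.prems(2)]
      by (intro Ck_family_add[OF assms(2)]) auto
  qed
qed

lemmas Ck_family_scaleR = Ck_family_bilinear[OF bounded_bilinear_scaleR]

lemma linear_Basis_sum:
  fixes f :: "'a::euclidean_space \<Rightarrow> 'b::real_vector"
  assumes "linear f"
  shows "f x = (\<Sum>i\<in>Basis. (x \<bullet> i) *\<^sub>R f i)"
  using linear_sum[OF assms, of "\<lambda>i. (x \<bullet> i) *\<^sub>R i" Basis] 
  by (simp add: euclidean_representation linear_scale[OF assms])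

text \<open>The chain rule applies \<open>fderiv (g t) (\<Phi> t x)\<close> to a direction that
  moves with \<open>t\<close> and \<open>x\<close>, while \<open>Ck_family\<close> knows only fixed
  directions. Expanded over \<open>Basis\<close>, the derivative becomes a sum of products in which
  the induction hypothesis, general in \<open>g\<close>, covers each factor
  \<open>fderiv (g t) (\<Phi> t x) i\<close>.\<close>

lemma Ck_family_compose:
  fixes \<Phi> :: "'t::topological_space \<Rightarrow> 'a::real_normed_vector \<Rightarrow> 'b::euclidean_space"
  assumes "open P" "open U" "Ck_family n T P \<Phi>" "Ck_family n T U g"
    and "\<And>t x. t \<in> T \<Longrightarrow> x \<in> P \<Longrightarrow> \<Phi> t x \<in> U"
  shows "Ck_family n T P (\<lambda>t x. g t (\<Phi> t x))"
  using assms(3,4)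
proof (induction n arbitrary: g)
  case 0
  then show ?case using assms(5)
    by (auto intro!: continuous_on_family[of T U g] continuous_intros)
next
  case (Suc n)
  note \<Phi>' = Ck_familyD[OF Suc.prems(1)] and g' = Ck_familyD[OF Suc.prems(2)]
  show ?case
  proof (rule Ck_family_SucI[OF assms(1)])
    show "continuous_on (T \<times> P) (\<lambda>z. g (fst z) (\<Phi> (fst z) (snd z)))"
      using Suc.prems assms(5) by (auto intro!: continuous_on_family[of T U g] continuous_intros)
    show "((\<lambda>x. g t (\<Phi> t x)) has_derivative (\<lambda>v. \<Sum>i\<in>Basis. (fderiv (\<Phi> t) x v \<bullet> i) *\<^sub>R
          fderiv (g t) (\<Phi> t x) i)) (at x)" if "t \<in> T" "x \<in> P" for t x
    proof -
      have g'': "(g t has_derivative fderiv (g t) (\<Phi> t x)) (at (\<Phi> t x))"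
        using that assms(5) by (intro g')
      have "((\<lambda>x. g t (\<Phi> t x)) has_derivative
          (\<lambda>v. fderiv (g t) (\<Phi> t x) (fderiv (\<Phi> t) x v))) (at x)"
        using diff_chain_at[OF \<Phi>'[OF that] g''] by (simp add: o_def)
      then show ?thesis
        unfolding linear_Basis_sum[OF has_derivative_linear[OF g''],
            of "fderiv (\<Phi> t) x v" for v] .
    qed
    show "Ck_family n T P (\<lambda>t x. \<Sum>i\<in>Basis. (fderiv (\<Phi> t) x v \<bullet> i) *\<^sub>R
          fderiv (g t) (\<Phi> t x) i)" for v
      by (intro Ck_family_sum Ck_family_scaleR assms(1) Suc.IH[OF Ck_family_SucD[OF Suc.prems(1)]]
          Ck_family_derivative[OF Suc.prems(2)] Ck_family_derivative[OF Suc.prems(1)]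
          Ck_family_bounded_linear[OF bounded_linear_inner_left])
  qed
qed

section \<open>Relation to maps without a time parameter and to jointly smooth maps\<close>

lemma Ck_on_continuous:
  "Ck_on n S f \<Longrightarrow> continuous_on S f"
  by (cases n) (auto simp: continuous_at_imp_continuous_on differentiable_imp_continuous_within)

lemma Ck_family_static:
  "Ck_on n S f \<Longrightarrow> Ck_family n T S (\<lambda>_. f)"
proof (induction n arbitrary: f)
  case 0
  then show ?case
    by (auto intro!: continuous_on_compose2[of S f _ snd] continuous_intros)
next
  case (Suc n)
  have "continuous_on (T \<times> S) (\<lambda>x. f (snd x))"
    using Ck_on_continuous[OF Suc.prems]
    by (auto intro!: continuous_on_compose2[of S f _ snd] continuous_intros)
  then show ?case
    using Suc by auto
qed

lemma Ck_family_imp_Ck_on: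
  assumes "Ck_family n T P Y" "t \<in> T"
  shows "Ck_on n P (Y t)"
  using assms
proof (induction n arbitrary: Y)
  case 0
  then show ?case
    by (auto intro!: continuous_on_family[of T P Y] continuous_intros)
qed auto

text \<open>The derivative in \<open>u\<close> is that of \<open>g\<close> in the direction
  \<open>(0, v)\<close>, again smooth on \<open>W\<close>, so the induction continues with it in
  place of \<open>g\<close>.\<close>

lemma Ck_on_imp_Ck_family:
  assumes "\<And>n. Ck_on n W g" "T \<times> U \<subseteq> W" "open U"
  shows "Ck_family n T U (\<lambda>t u. g (t, u))"
  using assms(1)
proof (induction n arbitrary: g)
  case 0
  then show ?case using assms(2) Ck_on_continuous[of 0 W g]
    by (auto elim: continuous_on_subset)
next
  case (Suc n)
  show ?case
  proof (rule Ck_family_SucI[OF assms(3)])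
    show "continuous_on (T \<times> U) (\<lambda>z. g (fst z, snd z))"
      using Suc.prems[of 0] assms(2) by (auto elim: continuous_on_subset)
    show "((\<lambda>u. g (t, u)) has_derivative (\<lambda>v. fderiv g (t, u) (0, v))) (at u)"
      if "t \<in> T" "u \<in> U" for t u
    proof -
      have "g differentiable (at (t, u))"
        using Suc.prems[of 1] assms(2) that by auto
      then have "(g has_derivative fderiv g (t, u)) (at (t, u))"
        by (simp add: frechet_derivative_works)
      moreover have "((\<lambda>u. (t, u)) has_derivative (\<lambda>v. (0, v))) (at u)"
        by (auto intro!: derivative_eq_intros)
      ultimately show ?thesis using diff_chain_at by (fastforce simp: o_def)
    qed
    show "Ck_family n T U (\<lambda>t u. fderiv g (t, u) (0, v))" for v
      using Suc.prems[of "Suc _"] by (intro Suc.IH[of "\<lambda>w. fderiv g w (0, v)"]) auto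
  qed
qed

section \<open>Ordinary differential equations depending on parameters\<close>

lemma eventually_nhds_image:
  assumes "continuous_on S f" "z \<in> S" "open B" "f z \<in> B"
  shows "\<forall>\<^sub>F w in nhds z. w \<in> S \<longrightarrow> f w \<in> B"
  using assms unfolding continuous_on_topological eventually_nhds by (metis (no_types))

text \<open>The tube lemma for filters: finitely many of the neighbourhoods cover \<open>I\<close>,
  and finitely many conditions that hold eventually hold eventually together. It serves both for
  uniformity in time and, with the filter \<open>at_right 0\<close>, for the final displacement
  argument.\<close>

lemma eventually_uniform_compact:
  assumes "compact I"
    and "\<And>t0. t0 \<in> I \<Longrightarrow> \<forall>\<^sub>F z in nhds t0 \<times>\<^sub>F F. fst z \<in> I \<longrightarrow> R (fst z) (snd z)"
  shows "\<forall>\<^sub>F k in F. \<forall>t\<in>I. R t k"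
proof -
  define G where "G t0 N Q \<longleftrightarrow> open N \<and> t0 \<in> N \<and> eventually Q F \<and>
    (\<forall>t k. t \<in> N \<longrightarrow> Q k \<longrightarrow> t \<in> I \<longrightarrow> R t k)" for t0 N Q
  have "\<exists>N Q. G t0 N Q" if t0: "t0 \<in> I" for t0
  proof -
    obtain Pf Q where "eventually Pf (nhds t0)" and Q: "eventually Q F"
      "\<And>t k. Pf t \<Longrightarrow> Q k \<Longrightarrow> t \<in> I \<longrightarrow> R t k"
      using assms(2)[OF t0] unfolding eventually_prod_filter by auto
    then obtain N where "open N" "t0 \<in> N" "\<And>t. t \<in> N \<Longrightarrow> Pf t"
      unfolding eventually_nhds by auto
    then have "G t0 N Q" unfolding G_def using Q by simp
    then show ?thesis by blast
  qed
  then have "\<forall>t0\<in>I. \<exists>N Q. G t0 N Q" by blast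
  from bchoice[OF this] obtain N where "\<forall>t0\<in>I. \<exists>Q. G t0 (N t0) Q" ..
  from bchoice[OF this] obtain Q where NQ: "\<forall>t0\<in>I. G t0 (N t0) (Q t0)" ..
  obtain C where C: "C \<subseteq> I" "finite C" "I \<subseteq> (\<Union>c\<in>C. N c)"
    using compactE_image[OF assms(1), of I N] NQ unfolding G_def by blast
  have "\<forall>\<^sub>F k in F. \<forall>c\<in>C. Q c k"
    using C NQ by (intro eventually_ball_finite) (auto simp: G_def)
  then show ?thesis
  proof eventually_elim
    case (elim k)
    show ?case
    proof
      fix t assume "t \<in> I"
      then obtain c where "c \<in> C" "t \<in> N c" using C by blast
      then show "R t k" using elim \<open>t \<in> I\<close> C NQ by (auto simp: G_def)
    qed
  qed
qed

lemma continuous_family_uniform: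
  fixes Y :: "'t::topological_space \<Rightarrow> 'a::topological_space \<Rightarrow> 'b::metric_space"
  assumes "compact I" "open P" "x0 \<in> P" "e > 0"
    and "continuous_on (I \<times> P) (\<lambda>z. Y (fst z) (snd z))"
  shows "\<forall>\<^sub>F x in nhds x0. x \<in> P \<and> (\<forall>t\<in>I. dist (Y t x) (Y t x0) < e)"
proof (intro eventually_conj eventually_uniform_compact assms)
  show "\<forall>\<^sub>F x in nhds x0. x \<in> P" using assms by (auto simp: eventually_nhds)
  fix t0 assume "t0 \<in> I"
  have near: "\<forall>\<^sub>F z in nhds (t0, x0). z \<in> I \<times> P \<longrightarrow> Y (fst z) (snd z) \<in> ball (Y t0 x0) (e / 2)"
    using \<open>t0 \<in> I\<close> assms by (intro eventually_nhds_image[OF assms(5)]) auto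
  have "continuous_on I (\<lambda>t. Y t x0)"
    using assms by (auto intro!: continuous_on_family[OF assms(5)] continuous_intros)
  then have "\<forall>\<^sub>F t in nhds t0. t \<in> I \<longrightarrow> Y t x0 \<in> ball (Y t0 x0) (e / 2)"
    using \<open>t0 \<in> I\<close> assms by (intro eventually_nhds_image) auto
  then have near0: "\<forall>\<^sub>F z in nhds t0 \<times>\<^sub>F nhds x0. fst z \<in> I \<longrightarrow> Y (fst z) x0 \<in> ball (Y t0 x0) (e / 2)"
    using eventually_prodI[of _ "nhds t0" "\<lambda>_. True" "nhds x0"] by simp
  have inP: "\<forall>\<^sub>F z in nhds t0 \<times>\<^sub>F nhds x0. snd z \<in> P"
    using eventually_prodI[of "\<lambda>_. True" "nhds t0" "\<lambda>x. x \<in> P" "nhds x0"] assms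
    by (auto simp: eventually_nhds)
  show "\<forall>\<^sub>F z in nhds t0 \<times>\<^sub>F nhds x0. fst z \<in> I \<longrightarrow> dist (Y (fst z) (snd z)) (Y (fst z) x0) < e"
    using near[unfolded nhds_prod] near0 inP
  proof eventually_elim
    case (elim z)
    show ?case
    proof
      assume "fst z \<in> I"
      then have "dist (Y t0 x0) (Y (fst z) (snd z)) < e/2" "dist (Y t0 x0) (Y (fst z) x0) < e/2"
        using elim by (auto simp: mem_Times_iff)
      then show "dist (Y (fst z) (snd z)) (Y (fst z) x0) < e"
        by (metis dist_commute dist_triangle_half_l)
    qed
  qed
qed

text \<open>Turns continuity in time of each single solution and the equicontinuity that Gronwall
  estimates provide into joint continuity.\<close>

lemma continuous_on_familyI:
  fixes Y :: "'t::topological_space \<Rightarrow> 'a::topological_space \<Rightarrow> 'b::metric_space"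
  assumes "\<And>x. x \<in> P \<Longrightarrow> continuous_on I (\<lambda>t. Y t x)"
    and "\<And>x0 e. x0 \<in> P \<Longrightarrow> e > 0 \<Longrightarrow> \<forall>\<^sub>F x in nhds x0. x \<in> P \<longrightarrow> (\<forall>t\<in>I. dist (Y t x) (Y t x0) < e)"
  shows "continuous_on (I \<times> P) (\<lambda>z. Y (fst z) (snd z))"
  unfolding continuous_on_def tendsto_iff
proof (intro ballI allI impI)
  fix z :: "'t \<times> 'a" and e :: real assume z: "z \<in> I \<times> P" and e: "0 < e"
  define t0 x0 where "t0 = fst z" "x0 = snd z"
  have zz: "z = (t0, x0)" "t0 \<in> I" "x0 \<in> P" using z by (auto simp: t0_x0_def)
  have "\<forall>\<^sub>F t in nhds t0. t \<in> I \<longrightarrow> Y t x0 \<in> ball (Y t0 x0) (e / 2)"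
    using zz e by (intro eventually_nhds_image assms) auto
  from eventually_prodI[OF this assms(2)[OF zz(3) half_gt_zero[OF e]]]
  have "\<forall>\<^sub>F w in nhds z. w \<in> I \<times> P \<longrightarrow> dist (Y (fst w) (snd w)) (Y (fst z) (snd z)) < e"
    unfolding zz nhds_prod
  proof eventually_elim
    case (elim w)
    show ?case
    proof
      assume w: "w \<in> I \<times> P"
      then have "dist (Y (fst w) (snd w)) (Y (fst w) x0) < e/2" "dist (Y (fst w) x0) (Y t0 x0) < e/2"
        using elim by (auto simp: mem_Times_iff dist_commute)
      then show "dist (Y (fst w) (snd w)) (Y (fst (t0, x0)) (snd (t0, x0))) < e"
        using dist_triangle_half_r by (metis dist_commute fst_conv snd_conv)
    qed
  qed
  then show "\<forall>\<^sub>F w in at z within I \<times> P. dist (Y (fst w) (snd w)) (Y (fst z) (snd z)) < e"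
    unfolding eventually_at_filter by (rule eventually_mono) auto
qed

section \<open>Mean value and Gronwall estimates\<close>

lemma vector_derivative_bound:
  fixes u :: "real \<Rightarrow> 'a::real_normed_vector"
  assumes "\<And>t. t \<in> {a..b} \<Longrightarrow> (u has_vector_derivative u' t) (at t within {a..b})"
    and "\<And>t. t \<in> {a..b} \<Longrightarrow> norm (u' t) \<le> B" and "s \<in> {a..b}" "t \<in> {a..b}"
  shows "norm (u t - u s) \<le> B * \<bar>t - s\<bar>"
proof -
  have "norm (u t - u s) \<le> B * norm (t - s)"
  proof (rule differentiable_bound[of "{a..b}" u "\<lambda>x h. h *\<^sub>R u' x"])
    show "onorm (\<lambda>h. h *\<^sub>R u' x) \<le> B" if "x \<in> {a..b}" for x
      using assms(2)[OF that] by (intro onorm_le) (simp add: mult.commute[of B] mult_left_mono)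
  qed (use assms in \<open>auto simp: has_vector_derivative_def\<close>)
  then show ?thesis by simp
qed

text \<open>The function \<open>N\<close>, the squared norm plus \<open>\<epsilon>\<^sup>2\<close>,
  is differentiable even where \<open>u\<close> vanishes and satisfies |N'| <= c N. The constant c =
  2K + 1 comes from 2 |u| \<epsilon> <= |u|^2 + \<epsilon>^2. The estimate is two-sided in time, as
  needed for an initial time \<open>s\<close> inside the interval.\<close>

lemma gronwall:
  fixes u :: "real \<Rightarrow> 'a::real_inner"
  assumes u: "\<And>t. t \<in> {a..b} \<Longrightarrow> (u has_vector_derivative u' t) (at t within {a..b})"
    and u': "\<And>t. t \<in> {a..b} \<Longrightarrow> norm (u' t) \<le> K * norm (u t) + \<epsilon>"
    and K: "K \<ge> 0" "\<epsilon> \<ge> 0" and st: "s \<in> {a..b}" "t \<in> {a..b}"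
  shows "norm (u t) \<le> exp ((2 * K + 1) * (b - a)) * (norm (u s) + \<epsilon>)"
proof -
  define c where "c = 2 * K + 1"
  define N where "N t = u t \<bullet> u t + \<epsilon>\<^sup>2" for t
  define N' where "N' t = 2 * (u t \<bullet> u' t)" for t
  have N': "\<bar>N' t\<bar> \<le> c * N t" if "t \<in> {a..b}" for t
  proof -
    have "\<bar>N' t\<bar> \<le> 2 * (norm (u t) * norm (u' t))"
      using Cauchy_Schwarz_ineq2[of "u t" "u' t"] by (simp add: N'_def)
    also have "\<dots> \<le> 2 * (norm (u t) * (K * norm (u t) + \<epsilon>))"
      using u'[OF that] by (simp add: mult_left_mono)
    also have "\<dots> = 2 * K * (norm (u t))\<^sup>2 + 2 * norm (u t) * \<epsilon>"
      by (simp add: algebra_simps power2_eq_square)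
    also have "\<dots> \<le> 2 * K * (norm (u t))\<^sup>2 + ((norm (u t))\<^sup>2 + \<epsilon>\<^sup>2)"
      using sum_squares_bound[of "norm (u t)" \<epsilon>] by simp
    also have "\<dots> \<le> c * N t"
      using K by (simp add: N_def c_def power2_norm_eq_inner algebra_simps)
    finally show ?thesis .
  qed
  have dN: "(N has_derivative (\<lambda>h. h * N' t)) (at t within {a..b})" if "t \<in> {a..b}" for t
    unfolding N_def N'_def
    by (rule derivative_eq_intros u[OF that, unfolded has_vector_derivative_def] refl)+
      (simp add: algebra_simps inner_commute)
  have mono: "N x \<le> exp (c * (b - a)) * N y" if xy: "x \<in> {a..b}" "y \<in> {a..b}" for x y
  proof -
    \<comment> \<open>The sign selects the monotone quantity: exp(c t) N is nondecreasing, exp(-c t)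
      N nonincreasing, so either order of \<open>x\<close> and \<open>y\<close> is covered.\<close>
    define k where "k = (if x \<le> y then c else - c)"
    have "\<exists>t\<in>{min x y..max x y}. exp (k * max x y) * N (max x y) - exp (k * min x y) * N (min x y)
        = (max x y - min x y) * (exp (k * t) * (k * N t + N' t))"
    proof (rule mvt_very_simple)
      fix t assume "min x y \<le> t" "t \<le> max x y"
      then have "t \<in> {a..b}" "{min x y..max x y} \<subseteq> {a..b}" using xy by auto
      then show "((\<lambda>t. exp (k * t) * N t) has_derivative (\<lambda>h. h * (exp (k * t) * (k * N t + N' t))))
          (at t within {min x y..max x y})"
        by (auto intro!: derivative_eq_intros has_derivative_subset[OF dN] simp: algebra_simps)
    qed simp
    then obtain t where t: "t \<in> {min x y..max x y}" "exp (k * max x y) * N (max x y) - exp (k * min x y) * N (min x y)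
        = (max x y - min x y) * (exp (k * t) * (k * N t + N' t))" by blast
    have "t \<in> {a..b}" using t(1) xy by (auto simp: min_def max_def split: if_splits)
    from N'[OF this] have N't: "c * N t + N' t \<ge> 0" "- c * N t + N' t \<le> 0" by auto
    have "exp (k * x) * N x \<le> exp (k * y) * N y"
    proof (cases "x \<le> y")
      case True
      then have "(y - x) * (exp (c * t) * (c * N t + N' t)) \<ge> 0" using N't by simp
      then show ?thesis using t(2) True by (simp add: k_def)
    next
      case False
      then have "(x - y) * (exp (- c * t) * (- c * N t + N' t)) \<le> 0" using N't by (simp add: mult_nonneg_nonpos)
      then show ?thesis using t(2) False by (simp add: k_def)
    qed
    then have "N x \<le> exp (- k * x) * (exp (k * y) * N y)"
      using mult_left_mono[of "exp (k * x) * N x" _ "exp (- k * x)"] by (simp add: exp_minus field_simps)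
    also have "\<dots> = exp (k * (y - x)) * N y" by (simp add: exp_diff exp_minus field_simps)
    also have "\<dots> \<le> exp (c * (b - a)) * N y"
    proof -
      have "k * (y - x) = c * \<bar>y - x\<bar>" by (simp add: k_def algebra_simps)
      also have "\<dots> \<le> c * (b - a)" using K xy by (intro mult_left_mono) (auto simp: c_def)
      finally show ?thesis by (intro mult_right_mono) (auto simp: N_def)
    qed
    finally show ?thesis .
  qed
  let ?E = "exp (c * (b - a))"
  have "N t \<le> ?E * N s" by (rule mono[OF st(2,1)])
  moreover have E: "?E \<ge> 1" using K st by (simp add: c_def)
  have "(norm (u t))\<^sup>2 \<le> N t" by (simp add: N_def power2_norm_eq_inner)
  moreover have "N s \<le> (norm (u s) + \<epsilon>)\<^sup>2"
    using K by (simp add: N_def power2_norm_eq_inner[symmetric] power2_sum)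
  ultimately have "(norm (u t))\<^sup>2 \<le> ?E * (norm (u s) + \<epsilon>)\<^sup>2"
    by (smt (verit) exp_gt_zero mult_left_mono)
  \<comment> \<open>Since the factor is at least 1, it may be squared; the square root then yields
    the stated, not optimal, constant.\<close>
  also have "\<dots> \<le> ?E\<^sup>2 * (norm (u s) + \<epsilon>)\<^sup>2"
    using E by (intro mult_right_mono) (auto simp: power2_eq_square)
  finally have "(norm (u t))\<^sup>2 \<le> (?E * (norm (u s) + \<epsilon>))\<^sup>2" by (simp add: power_mult_distrib)
  then show ?thesis using K by (simp add: abs_le_square_iff[symmetric] c_def)
qed

lemma continuous_on_linear_family:
  fixes A :: "'s::topological_space \<Rightarrow> 'a::euclidean_space \<Rightarrow> 'b::real_normed_vector"
  assumes "\<And>t. t \<in> S \<Longrightarrow> linear (A t)" "\<And>v. continuous_on S (\<lambda>t. A t v)" "continuous_on S w"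
  shows "continuous_on S (\<lambda>t. A t (w t))"
proof -
  have "continuous_on S (\<lambda>t. \<Sum>i\<in>Basis. (w t \<bullet> i) *\<^sub>R A t i)"
    by (intro continuous_on_sum continuous_on_scaleR continuous_on_inner continuous_on_const assms)
  moreover have "A t (w t) = (\<Sum>i\<in>Basis. (w t \<bullet> i) *\<^sub>R A t i)" if "t \<in> S" for t
    by (rule linear_Basis_sum[OF assms(1)[OF that]])
  ultimately show ?thesis
    using continuous_on_cong[OF refl, of S "\<lambda>t. A t (w t)" "\<lambda>t. \<Sum>i\<in>Basis. (w t \<bullet> i) *\<^sub>R A t i"] by blast
qed

text \<open>Picard iteration. Only the linear equation for the derivative of the flow needs an
  existence theorem, as the solution curves themselves are given. The bound
  \<open>K * (b - a) \<le> 1 / 2\<close> is the contraction constant; intervals are later chosen so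
  short that it holds.\<close>

lemma linear_ode_exists:
  fixes A :: "real \<Rightarrow> 'a::euclidean_space \<Rightarrow> 'a"
  assumes A: "\<And>t. t \<in> {a..b} \<Longrightarrow> linear (A t)" "\<And>v. continuous_on {a..b} (\<lambda>t. A t v)"
    and g: "continuous_on {a..b} g"
    and K: "\<And>t v. t \<in> {a..b} \<Longrightarrow> norm (A t v) \<le> K * norm v" "K * (b - a) \<le> 1 / 2" "K \<ge> 0"
    and s: "s \<in> {a..b}"
  shows "\<exists>z. z s = z0 \<and> (\<forall>t\<in>{a..b}. (z has_vector_derivative A t (z t) + g t) (at t within {a..b}))"
proof -
  define q where "q w t = A t (apply_bcontfun w t) + g t" for w :: "real \<Rightarrow>\<^sub>C 'a" and t
  \<comment> \<open>The integral from \<open>s\<close> to \<open>t\<close>, written as a difference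
    of integrals from \<open>a\<close> so that \<open>t\<close> may lie before \<open>s\<close>.
    Below, \<open>clamp\<close> extends it constantly beyond the interval, which makes it a bounded
    continuous function on the line.\<close>
  define h where "h w t = z0 + integral {a..t} (q w) - integral {a..s} (q w)" for w t
  have q: "continuous_on {a..b} (q w)" for w
    unfolding q_def
    by (rule continuous_on_add[OF continuous_on_linear_family[of _ A "apply_bcontfun w"] g]) (use A in auto)
  have h: "(h w has_vector_derivative q w t) (at t within {a..b})" if "t \<in> {a..b}" for w t
    unfolding h_def
    using integral_has_vector_derivative[OF q that, of w]
    by (auto intro!: derivative_eq_intros)
  have h_cont: "continuous_on (cbox a b) (h w)" for w
    unfolding cbox_interval
    by (rule continuous_on_vector_derivative[OF h])
  have "\<exists>T. \<forall>t. apply_bcontfun T t = h w (clamp a b t)" for w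
    using continuous_on_cbox_bcontfunE[OF h_cont] by metis
  then obtain T where T: "\<And>w t. apply_bcontfun (T w) t = h w (clamp a b t)"
    by metis
  have cl: "clamp a b t \<in> {a..b}" for t
    using clamp_in_interval[of a b t] s by auto
  have "dist (T w) (T w') \<le> 1 / 2 * dist w w'" for w w'
  proof (rule dist_bound)
    fix t
    define c where "c = clamp a b t"
    have c: "c \<in> {a..b}" using cl by (simp add: c_def)
    have "norm ((h w c - h w' c) - (h w s - h w' s)) \<le> (K * dist w w') * \<bar>c - s\<bar>"
    proof (rule vector_derivative_bound[OF _ _ s c])
      show "((\<lambda>t. h w t - h w' t) has_vector_derivative q w t - q w' t) (at t within {a..b})"
        if "t \<in> {a..b}" for t
        by (intro has_vector_derivative_diff h that)
      show "norm (q w t - q w' t) \<le> K * dist w w'" if "t \<in> {a..b}" for t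
      proof -
        have "q w t - q w' t = A t (apply_bcontfun w t - apply_bcontfun w' t)"
          by (simp add: q_def linear_diff[OF A(1)[OF that]])
        also have "norm \<dots> \<le> K * norm (apply_bcontfun w t - apply_bcontfun w' t)"
          by (rule K(1)[OF that])
        also have "\<dots> \<le> K * dist w w'"
          using dist_bounded[of w t w'] K(3) by (auto simp: dist_norm intro!: mult_left_mono)
        finally show ?thesis .
      qed
    qed
    also have "\<dots> \<le> (K * dist w w') * (b - a)"
      using c s K by (intro mult_left_mono) auto
    also have "\<dots> = (K * (b - a)) * dist w w'" by simp
    also have "\<dots> \<le> 1 / 2 * dist w w'" using K by (intro mult_right_mono) auto
    finally show "dist (apply_bcontfun (T w) t) (apply_bcontfun (T w') t) \<le> 1 / 2 * dist w w'"
      by (simp add: T c_def[symmetric] dist_norm) (simp add: h_def)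
  qed
  then obtain w where w: "T w = w"
    using banach_fix_type[of "1/2" T] by (auto simp: power2_eq_square)
  have wh: "apply_bcontfun w t = h w t" if "t \<in> {a..b}" for t
    using T[of w t] that unfolding w by simp
  show ?thesis
  proof (intro exI[of _ "h w"] conjI ballI)
    show "h w s = z0" by (simp add: h_def)
    show "(h w has_vector_derivative A t (h w t) + g t) (at t within {a..b})" if "t \<in> {a..b}" for t
      using h[OF that, of w] by (simp add: q_def wh[OF that])
  qed
qed

text \<open>Recovers operator bounds from the finitely many fixed directions that
  \<open>Ck_family\<close> controls, at the cost of the factor \<open>DIM('a)\<close>.\<close>

lemma linear_norm_le_Basis:
  fixes L :: "'a::euclidean_space \<Rightarrow> 'b::real_normed_vector"
  assumes "linear L" "\<And>i. i \<in> Basis \<Longrightarrow> norm (L i) \<le> B"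
  shows "norm (L v) \<le> real DIM('a) * B * norm v"
proof -
  have "norm (L v) \<le> (\<Sum>i\<in>(Basis::'a set). norm ((v \<bullet> i) *\<^sub>R L i))"
    by (subst linear_Basis_sum[OF assms(1)]) (rule norm_sum)
  also have "\<dots> \<le> (\<Sum>i\<in>(Basis::'a set). norm v * B)"
    using assms(2) by (intro sum_mono) (auto intro!: mult_mono Basis_le_norm)
  finally show ?thesis by (simp add: algebra_simps)
qed

section \<open>Differentiability of solutions in parameters\<close>

lemma Ck_family_derivative_linear:
  assumes "Ck_family (Suc n) T P Y" "t \<in> T" "x \<in> P"
  shows "linear (fderiv (Y t) x)"
  using has_derivative_linear[OF Ck_familyD[OF assms]] .

text \<open>Near \<open>(t0, w t0)\<close> the derivatives on all basis vectors stay close to their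
  value there, so the mean value inequality on a ball linearises \<open>F t\<close> with a uniform
  error. The tube lemma then makes the error uniform along the compact curve
  \<open>w\<close>.\<close>

lemma Ck_family_uniform_derivative:
  fixes F :: "'t::topological_space \<Rightarrow> 'a::euclidean_space \<Rightarrow> 'b::real_normed_vector"
  assumes I: "compact I" and W: "open W" and F: "Ck_family (Suc 0) I W F"
    and w: "continuous_on I w" "\<And>t. t \<in> I \<Longrightarrow> w t \<in> W" and e: "e > 0"
  shows "\<forall>\<^sub>F k in nhds 0. \<forall>t\<in>I. w t + k \<in> W \<and>
    norm (F t (w t + k) - F t (w t) - fderiv (F t) (w t) k) \<le> e * norm k"
proof (rule eventually_uniform_compact[OF I])
  fix t0 assume t0: "t0 \<in> I"
  define D where "D t p = fderiv (F t) p" for t p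
  have F': "(F t has_derivative D t p) (at p)" if "t \<in> I" "p \<in> W" for t p
    unfolding D_def by (rule Ck_familyD[OF F that])
  \<comment> \<open>Two derivatives within \<open>B\<close> of the one at \<open>(t0, w t0)\<close>
    differ by at most \<open>2 * B\<close> on basis vectors, hence by
    \<open>real DIM('a) * (2 * B) = e\<close> in operator norm.\<close>
  define B where "B = e / (2 * real DIM('a))"
  have B: "B > 0" using e by (simp add: B_def)
  have D_cont: "continuous_on (I \<times> W) (\<lambda>z. D (fst z) (snd z) v)" for v
    using Ck_family_continuous[OF Ck_family_derivative[OF F]] by (simp add: D_def)
  have "\<forall>\<^sub>F z in nhds (t0, w t0). \<forall>i\<in>Basis. z \<in> I \<times> W \<longrightarrow> D (fst z) (snd z) i \<in> ball (D t0 (w t0) i) B"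
    using t0 w B D_cont
    by (intro eventually_ball_finite ballI eventually_nhds_image[OF D_cont]) auto
  then obtain N Q where N: "open N" "t0 \<in> N" and Q: "open Q" "w t0 \<in> Q"
    and NQ: "\<And>t p i. t \<in> N \<Longrightarrow> p \<in> Q \<Longrightarrow> t \<in> I \<Longrightarrow> p \<in> W \<Longrightarrow> i \<in> Basis \<Longrightarrow> D t p i \<in> ball (D t0 (w t0) i) B"
    unfolding nhds_prod eventually_prod_filter eventually_nhds by (auto; blast)
  have "open (Q \<inter> W)" "w t0 \<in> Q \<inter> W" using Q W w t0 by auto
  then obtain r where r: "r > 0" "ball (w t0) r \<subseteq> Q \<inter> W" by (meson openE)
  define S where "S = ball (w t0) r"
  have key: "w t + k \<in> W \<and> norm (F t (w t + k) - F t (w t) - D t (w t) k) \<le> e * norm k"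
    if t: "t \<in> N" "t \<in> I" "w t \<in> ball (w t0) (r / 2)" and k: "norm k < r / 2" for t k
  proof -
    have wt: "w t \<in> S" using t r by (auto simp: S_def)
    have wk: "w t + k \<in> S"
      using t k norm_triangle_ineq[of "w t - w t0" k] by (simp add: S_def dist_norm norm_minus_commute algebra_simps)
    have seg: "w t + u *\<^sub>R ((w t + k) - w t) \<in> S" if "u \<in> {0..1}" for u
      using convexD_alt[of S "w t" "w t + k" u] wt wk that
      by (simp add: S_def algebra_simps)
    have on: "onorm (D t p - D t (w t)) \<le> e" if p: "p \<in> S" for p
    proof (rule onorm_le)
      fix v
      have lin: "linear (\<lambda>v. D t p v - D t (w t) v)"
        using F'[of t p] F'[of t "w t"] t w p r
        by (intro linear_compose_sub has_derivative_linear) (auto simp: S_def)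
      have "norm (D t p v - D t (w t) v) \<le> real DIM('a) * (2 * B) * norm v"
      proof (rule linear_norm_le_Basis[OF lin])
        fix i :: 'a assume i: "i \<in> Basis"
        have "dist (D t0 (w t0) i) (D t p i) < B" "dist (D t0 (w t0) i) (D t (w t) i) < B"
          using NQ[of t p i] NQ[of t "w t" i] t i subsetD[OF r(2) p[unfolded S_def]] subsetD[OF r(2) wt[unfolded S_def]]
          by auto
        then show "norm (D t p i - D t (w t) i) \<le> 2 * B"
          using dist_triangle[of "D t p i" "D t (w t) i" "D t0 (w t0) i"]
          by (simp add: dist_norm norm_minus_commute)
      qed
      then show "norm ((D t p - D t (w t)) v) \<le> e * norm v" by (simp add: B_def)
    qed
    have "norm (F t (w t + k) - F t (w t) - D t (w t) ((w t + k) - w t)) \<le> norm ((w t + k) - w t) * e"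
    proof (rule differentiable_bound_linearization[where S=S and f'="D t" and ?x0.0="w t", OF seg _ on wt])
      show "(F t has_derivative D t x) (at x within S)" if "x \<in> S" for x
        using subsetD[OF r(2) that[unfolded S_def]] t F'[of t x] by (auto intro: has_derivative_at_withinI)
    qed
    then show ?thesis using wk r by (auto simp: S_def mult.commute)
  qed
  have 1: "\<forall>\<^sub>F t in nhds t0. t \<in> N \<and> (t \<in> I \<longrightarrow> w t \<in> ball (w t0) (r / 2))"
    using N t0 r by (intro eventually_conj eventually_nhds_image[OF w(1)]) (auto simp: eventually_nhds)
  have 2: "\<forall>\<^sub>F k in nhds (0::'a). norm k < r / 2"
    using r eventually_nhds_in_open[of "ball (0::'a) (r/2)" 0] by simp
  have "\<forall>\<^sub>F z in nhds t0 \<times>\<^sub>F nhds (0::'a). (fst z \<in> N \<and> (fst z \<in> I \<longrightarrow> w (fst z) \<in> ball (w t0) (r / 2))) \<and> norm (snd z) < r / 2"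
    by (rule eventually_prodI[OF 1 2])
  then show "\<forall>\<^sub>F z in nhds t0 \<times>\<^sub>F nhds 0. fst z \<in> I \<longrightarrow> (w (fst z) + snd z \<in> W \<and>
    norm (F (fst z) (w (fst z) + snd z) - F (fst z) (w (fst z)) - fderiv (F (fst z)) (w (fst z)) (snd z)) \<le> e * norm (snd z))"
    by (rule eventually_mono) (use key in \<open>auto simp: D_def\<close>)
qed

text \<open>The candidate \<open>Z\<close> solves the equation linearised along the solution at
  \<open>x\<close>. Three comparisons by Gronwall follow: linearity of \<open>Z t\<close>, the bound
  |l| <= C |k| for the difference \<open>l\<close> of two solutions with parameters differing by
  \<open>k\<close>, and with its help |l - Z k| = o(|k|). Only the partial derivative in the state
  variable has to satisfy the bound by \<open>K\<close>.\<close>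

lemma parametric_ode_has_derivative:
  fixes F :: "real \<Rightarrow> 'p::euclidean_space \<times> 'e::euclidean_space \<Rightarrow> 'e"
  assumes P: "open P" and U: "open U" and s: "s \<in> {a..b}"
    and F: "Ck_family (Suc 0) {a..b} (P \<times> U) F"
    and y: "continuous_on ({a..b} \<times> P) (\<lambda>z. y (fst z) (snd z))"
      "\<And>t x. t \<in> {a..b} \<Longrightarrow> x \<in> P \<Longrightarrow> y t x \<in> U"
    and ode: "\<And>t x. t \<in> {a..b} \<Longrightarrow> x \<in> P \<Longrightarrow>
      ((\<lambda>t. y t x) has_vector_derivative F t (x, y t x)) (at t within {a..b})"
    and x: "x \<in> P" and init: "(y s has_derivative \<eta>) (at x)"
    and K: "\<And>t z. t \<in> {a..b} \<Longrightarrow> norm (fderiv (F t) (x, y t x) (0, z)) \<le> K * norm z"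
      "K * (b - a) \<le> 1 / 2" "K \<ge> 0"
  shows "\<exists>Z. Z s = \<eta> \<and> (\<forall>t\<in>{a..b}. (y t has_derivative Z t) (at x) \<and>
    (\<forall>v. ((\<lambda>t. Z t v) has_vector_derivative fderiv (F t) (x, y t x) (v, Z t v))
      (at t within {a..b})))"
proof -
  define I where "I = {a..b}"
  define w where "w t = (x, y t x)" for t
  define D where "D t = fderiv (F t) (w t)" for t
  have W: "open (P \<times> U)" using P U by (rule open_Times)
  have w_cont: "continuous_on I w"
    unfolding w_def using x
    by (auto intro!: continuous_on_Pair continuous_on_family[OF y(1)[folded I_def]] continuous_intros)
  have wW: "w t \<in> P \<times> U" if "t \<in> I" for t using that x y by (auto simp: w_def I_def)
  have D_lin: "linear (D t)" if "t \<in> I" for t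
    unfolding D_def using Ck_family_derivative_linear[OF F, of t "w t"] wW that by (simp add: I_def)
  have D_cont: "continuous_on I (\<lambda>t. D t v)" for v
    unfolding D_def
    using continuous_on_family[OF Ck_family_continuous[OF Ck_family_derivative[OF F, of v]], of I "\<lambda>t. t" w]
      w_cont wW by (simp add: I_def)
  have D_add: "D t (v, z) = D t (v, 0) + D t (0, z)" if "t \<in> I" for t v z
    using linear_add[OF D_lin[OF that], of "(v, 0)" "(0, z)"] by simp
  have lin0: "linear (\<lambda>z. D t (0, z))" if "t \<in> I" for t
    using linear_compose[OF _ D_lin[OF that], of "\<lambda>z. (0, z)"] by (auto simp: o_def linear_iff)
  have linv: "linear (\<lambda>v. D t (v, 0))" if "t \<in> I" for t
    using linear_compose[OF _ D_lin[OF that], of "\<lambda>v. (v, 0)"] by (auto simp: o_def linear_iff)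
  have KD: "norm (D t (0, z)) \<le> K * norm z" if "t \<in> I" for t z
    using K(1) that by (simp add: D_def w_def I_def)
  have "\<exists>z. z s = \<eta> v \<and> (\<forall>t\<in>{a..b}. (z has_vector_derivative D t (0, z t) + D t (v, 0)) (at t within {a..b}))" for v
    by (rule linear_ode_exists[of a b "\<lambda>t z. D t (0, z)"])
      (use lin0 D_cont KD K s in \<open>auto simp: I_def\<close>)
  then have "\<forall>v. \<exists>z. z s = \<eta> v \<and> (\<forall>t\<in>I. (z has_vector_derivative D t (0, z t) + D t (v, 0)) (at t within I))"
    unfolding I_def by blast
  from choice[OF this] obtain ZZ where ZZ: "\<And>v. ZZ v s = \<eta> v"
    "\<And>v t. t \<in> I \<Longrightarrow> (ZZ v has_vector_derivative D t (0, ZZ v t) + D t (v, 0)) (at t within I)" by blast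
  define Z where "Z t v = (if t \<in> I then ZZ v t else \<eta> v)" for t v
  have Zs: "Z s = \<eta>" using ZZ by (auto simp: Z_def)
  have Z': "((\<lambda>t. Z t v) has_vector_derivative D t (v, Z t v)) (at t within I)" if "t \<in> I" for t v
    using has_vector_derivative_transform[OF that, of "\<lambda>t. Z t v" "ZZ v"] ZZ(2)[OF that, of v] that
      D_add[OF that, of v "ZZ v t"]
    by (simp add: Z_def add.commute)
  \<comment> \<open>\<open>K + 1\<close> in place of \<open>K\<close>: the linearisation error
    contributes up to \<open>e1 * norm (l t)\<close>, and \<open>e1 \<le> 1\<close>.\<close>
  define E where "E = exp ((2 * (K + 1) + 1) * (b - a))"
  have E: "E > 0" by (simp add: E_def)
  have gron: "norm (u t) \<le> E * (norm (u s) + \<epsilon>)"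
    if "\<And>t. t \<in> I \<Longrightarrow> (u has_vector_derivative u' t) (at t within I)"
      "\<And>t. t \<in> I \<Longrightarrow> norm (u' t) \<le> (K + 1) * norm (u t) + \<epsilon>" "\<epsilon> \<ge> 0" "t \<in> I"
    for u u' :: "real \<Rightarrow> 'e" and \<epsilon> t
    unfolding E_def using that K s by (intro gronwall[of a b u u']) (auto simp: I_def)
  have \<eta>: "linear \<eta>" "bounded_linear \<eta>"
    using has_derivative_linear[OF init] has_derivative_bounded_linear[OF init] by auto
  have Z_lin: "linear (Z t)" if t: "t \<in> I" for t
  proof -
    \<comment> \<open>The defect of linearity solves the homogeneous equation with initial value 0,
      because \<open>\<eta>\<close> is linear.\<close>
    have comb: "Z t (c *\<^sub>R v + v') = c *\<^sub>R Z t v + Z t v'" for c v v'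
    proof -
      define r where "r t = Z t (c *\<^sub>R v + v') - (c *\<^sub>R Z t v + Z t v')" for t
      have "norm (r t) \<le> E * (norm (r s) + 0)"
      proof (rule gron[OF _ _ _ t])
        fix t assume t: "t \<in> I"
        show "(r has_vector_derivative D t (0, r t)) (at t within I)"
          using linear_diff[OF D_lin[OF t], of "(c *\<^sub>R v + v', Z t (c *\<^sub>R v + v'))" "c *\<^sub>R (v, Z t v) + (v', Z t v')"]
            linear_add[OF D_lin[OF t], of "c *\<^sub>R (v, Z t v)" "(v', Z t v')"] linear_scale[OF D_lin[OF t], of c "(v, Z t v)"]
          by (auto intro!: derivative_eq_intros Z'[OF t] simp: r_def[abs_def])
        show "norm (D t (0, r t)) \<le> (K + 1) * norm (r t) + 0"
          using KD[OF t, of "r t"] norm_ge_zero[of "r t"] unfolding distrib_right by linarith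
      qed simp
      then show ?thesis by (simp add: r_def Zs linear_add[OF \<eta>(1)] linear_scale[OF \<eta>(1)])
    qed
    show ?thesis
      using comb[of 1] comb[of _ _ 0] comb[of 1 0 0] by (intro linearI) auto
  qed
  obtain B where B: "B \<ge> 0" "\<And>t v. t \<in> I \<Longrightarrow> norm (D t (v, 0)) \<le> B * norm v"
  proof -
    have "bounded ((\<lambda>t. \<Sum>i\<in>(Basis::'p set). norm (D t (i, 0))) ` I)"
      unfolding I_def
      by (intro compact_imp_bounded compact_continuous_image continuous_on_sum continuous_on_norm D_cont[unfolded I_def]) auto
    then obtain C where C: "\<And>t. t \<in> I \<Longrightarrow> norm (\<Sum>i\<in>(Basis::'p set). norm (D t (i, 0))) \<le> C"
      unfolding bounded_iff by auto
    have "norm (D t (v, 0)) \<le> real DIM('p) * \<bar>C\<bar> * norm v" if t: "t \<in> I" for t v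
    proof (rule linear_norm_le_Basis[OF linv[OF t]])
      fix i :: 'p assume "i \<in> Basis"
      then have "norm (D t (i, 0)) \<le> (\<Sum>i\<in>(Basis::'p set). norm (D t (i, 0)))"
        by (intro member_le_sum) auto
      then show "norm (D t (i, 0)) \<le> \<bar>C\<bar>" using C[OF t] by simp
    qed
    then show ?thesis using that[of "real DIM('p) * \<bar>C\<bar>"] by simp
  qed
  define N where "N = onorm \<eta>"
  have N: "norm (\<eta> k) \<le> N * norm k" "N \<ge> 0" for k
    unfolding N_def using onorm[OF \<eta>(2)] onorm_pos_le[OF \<eta>(2)] by auto
  \<comment> \<open>In units of |k|: \<open>N + 1\<close> bounds the initial difference, and
    \<open>B + 1\<close> the forcing, that is, the parameter part of the derivative plus its
    error.\<close>
  define C where "C = E * (N + 1 + (B + 1))"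
  have C: "C \<ge> 0" using E N B by (simp add: C_def)
  have der: "(y t has_derivative Z t) (at x)" if "t \<in> I" for t
    unfolding has_derivative_at_alt
  proof (intro conjI allI impI)
    show "bounded_linear (Z t)" using Z_lin[OF that] linear_conv_bounded_linear by blast
    fix e :: real assume e: "e > 0"
    \<comment> \<open>The last comparison ends with the factor \<open>E * (2 + C) * e1\<close>: one
      \<open>e1\<close> from the initial value and \<open>1 + C\<close> of them from the
      forcing.\<close>
    define e1 where "e1 = min 1 (e / (E * (2 + C)))"
    have e1: "e1 > 0" "e1 \<le> 1" "E * (2 + C) * e1 \<le> e"
    proof -
      have "E * (2 + C) > 0" using E C by simp
      moreover have "e1 \<le> e / (E * (2 + C))" by (simp add: e1_def)
      ultimately show "e1 > 0" "e1 \<le> 1" "E * (2 + C) * e1 \<le> e"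
        using e by (auto simp: e1_def[symmetric] pos_le_divide_eq mult.commute) (simp_all add: e1_def)
    qed
    have "\<forall>\<^sub>F k in nhds 0. \<forall>t\<in>I. w t + k \<in> P \<times> U \<and>
        norm (F t (w t + k) - F t (w t) - D t k) \<le> e1 * norm k"
      unfolding D_def
      by (rule Ck_family_uniform_derivative[OF _ W F[folded I_def] w_cont wW e1(1)]) (auto simp: I_def)
    then obtain d1 where d1: "d1 > 0"
      "\<And>k t. norm k < d1 \<Longrightarrow> t \<in> I \<Longrightarrow> norm (F t (w t + k) - F t (w t) - D t k) \<le> e1 * norm k"
      unfolding eventually_nhds_metric by auto
    have "\<forall>\<^sub>F x' in nhds x. x' \<in> P \<and> (\<forall>t\<in>I. dist (y t x') (y t x) < d1 / 2)"
      using d1 by (intro continuous_family_uniform[OF _ P x _ y(1)[folded I_def]]) (auto simp: I_def)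
    then obtain d2 where d2: "d2 > 0" "\<And>x'. dist x' x < d2 \<Longrightarrow> x' \<in> P"
      "\<And>x' t. dist x' x < d2 \<Longrightarrow> t \<in> I \<Longrightarrow> dist (y t x') (y t x) < d1 / 2"
      unfolding eventually_nhds_metric by auto
    obtain d3 where d3: "d3 > 0" "\<And>x'. norm (x' - x) < d3 \<Longrightarrow> norm (y s x' - y s x - \<eta> (x' - x)) \<le> e1 * norm (x' - x)"
      using init e1 unfolding has_derivative_at_alt by auto
    show "\<exists>d>0. \<forall>x'. norm (x' - x) < d \<longrightarrow> norm (y t x' - y t x - Z t (x' - x)) \<le> e * norm (x' - x)"
    proof (intro exI[of _ "min (d1 / 2) (min d2 d3)"] conjI allI impI)
      show "0 < min (d1 / 2) (min d2 d3)" using d1 d2 d3 by simp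
      fix x' assume x': "norm (x' - x) < min (d1 / 2) (min d2 d3)"
      define k where "k = x' - x"
      define l where "l t = y t x' - y t x" for t
      have x'P: "x' \<in> P" using d2(2)[of x'] x' by (simp add: dist_norm)
      have l': "(l has_vector_derivative F t (w t + (k, l t)) - F t (w t)) (at t within I)" if "t \<in> I" for t
        using has_vector_derivative_diff[OF ode[OF _ x'P, of t] ode[OF _ x, of t]] that
        by (simp add: l_def[abs_def] I_def w_def k_def)
      have nkl: "norm (k, l t) \<le> norm k + norm (l t)" for t by (rule norm_Pair_le)
      have err: "norm (F t (w t + (k, l t)) - F t (w t) - D t (k, l t)) \<le> e1 * (norm k + norm (l t))" if "t \<in> I" for t
      proof -
        have "norm (k, l t) < d1"
          using nkl[of t] d2(3)[of x' t] x' that by (simp add: k_def l_def dist_norm)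
        from d1(2)[OF this that] mult_left_mono[OF nkl[of t], of e1] e1(1) show ?thesis by linarith
      qed
      have ls: "norm (l s - \<eta> k) \<le> e1 * norm k" using d3(2)[of x'] x' by (simp add: l_def k_def)
      have lb: "norm (l t) \<le> C * norm k" if "t \<in> I" for t
      proof -
        have "norm (l t) \<le> E * (norm (l s) + (B + 1) * norm k)"
        proof (rule gron[OF l'])
          fix t assume t: "t \<in> I"
          have "norm (F t (w t + (k, l t)) - F t (w t)) \<le> norm (D t (k, l t)) + e1 * (norm k + norm (l t))"
            using err[OF t] norm_triangle_sub[of "F t (w t + (k, l t)) - F t (w t)" "D t (k, l t)"] by simp
          also have "norm (D t (k, l t)) \<le> B * norm k + K * norm (l t)"
            using D_add[OF t, of k "l t"] norm_triangle_ineq[of "D t (k,0)" "D t (0, l t)"] B(2)[OF t, of k] KD[OF t, of "l t"]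
            by simp
          also have "e1 * (norm k + norm (l t)) \<le> 1 * (norm k + norm (l t))"
            using e1 by (intro mult_right_mono) auto
          finally show "norm (F t (w t + (k, l t)) - F t (w t)) \<le> (K + 1) * norm (l t) + (B + 1) * norm k"
            by (simp add: algebra_simps)
        qed (use B that in auto)
        also have "norm (l s) \<le> (N + 1) * norm k"
        proof -
          have "norm (l s) \<le> norm (\<eta> k) + e1 * norm k"
            using ls norm_triangle_sub[of "l s" "\<eta> k"] by simp
          also have "\<dots> \<le> N * norm k + 1 * norm k"
            using N(1)[of k] e1 by (intro add_mono mult_right_mono) auto
          finally show ?thesis by (simp add: algebra_simps)
        qed
        finally show ?thesis using E by (simp add: C_def algebra_simps)
      qed
      have "norm (l t - Z t k) \<le> E * (norm (l s - Z s k) + e1 * (1 + C) * norm k)"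
      proof (rule gron[OF _ _ _ that])
        fix t assume t: "t \<in> I"
        show "((\<lambda>t. l t - Z t k) has_vector_derivative F t (w t + (k, l t)) - F t (w t) - D t (k, Z t k)) (at t within I)"
          by (intro has_vector_derivative_diff l' Z' t)
        \<comment> \<open>Adding and subtracting the linearisation at \<open>(k, l t)\<close> leaves
          the derivative in a direction without parameter component, where the bound by
          \<open>K\<close> applies.\<close>
        have "norm (F t (w t + (k, l t)) - F t (w t) - D t (k, Z t k))
            = norm ((F t (w t + (k, l t)) - F t (w t) - D t (k, l t)) + D t (0, l t - Z t k))"
        proof -
          have "D t (0, l t - Z t k) = D t (k, l t) - D t (k, Z t k)"
            using linear_diff[OF D_lin[OF t], of "(k, l t)" "(k, Z t k)"] by simp
          then show ?thesis by simp
        qed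
        also have "\<dots> \<le> e1 * (norm k + norm (l t)) + K * norm (l t - Z t k)"
          by (rule norm_triangle_le[OF add_mono[OF err[OF t] KD[OF t]]])
        also have "\<dots> \<le> e1 * (norm k + C * norm k) + K * norm (l t - Z t k)"
          using lb[OF t] e1 by simp
        also have "\<dots> \<le> (K + 1) * norm (l t - Z t k) + e1 * (1 + C) * norm k"
          by (simp add: algebra_simps)
        finally show "norm (F t (w t + (k, l t)) - F t (w t) - D t (k, Z t k))
          \<le> (K + 1) * norm (l t - Z t k) + e1 * (1 + C) * norm k" .
      qed (use e1 C in auto)
      also have "\<dots> \<le> E * (e1 * norm k + e1 * (1 + C) * norm k)"
        using ls E by (simp add: Zs)
      also have "\<dots> = (E * (2 + C) * e1) * norm k" by (simp add: algebra_simps)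
      also have "\<dots> \<le> e * norm k" using e1 by (intro mult_right_mono) auto
      finally show "norm (y t x' - y t x - Z t (x' - x)) \<le> e * norm (x' - x)"
        by (simp add: l_def k_def)
    qed
  qed
  show ?thesis
    using Zs der Z' unfolding D_def w_def I_def by (intro exI[of _ Z]) auto
qed

section \<open>Higher regularity in parameters\<close>

lemma linear_ode_continuous:
  fixes A :: "real \<Rightarrow> 'p::real_normed_vector \<Rightarrow> 'e::euclidean_space \<Rightarrow> 'e"
  assumes P: "open P" and s: "s \<in> {a..b}"
    and A: "\<And>t x. t \<in> {a..b} \<Longrightarrow> x \<in> P \<Longrightarrow> linear (A t x)"
      "\<And>i. continuous_on ({a..b} \<times> P) (\<lambda>z. A (fst z) (snd z) i)"
    and g: "continuous_on ({a..b} \<times> P) (\<lambda>z. g (fst z) (snd z))"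
    and K: "\<And>t x v. t \<in> {a..b} \<Longrightarrow> x \<in> P \<Longrightarrow> norm (A t x v) \<le> K * norm v" "K \<ge> 0"
    and ode: "\<And>t x. t \<in> {a..b} \<Longrightarrow> x \<in> P \<Longrightarrow>
      ((\<lambda>t. Y t x) has_vector_derivative A t x (Y t x) + g t x) (at t within {a..b})"
    and init: "continuous_on P (Y s)"
  shows "continuous_on ({a..b} \<times> P) (\<lambda>z. Y (fst z) (snd z))"
proof (rule continuous_on_familyI)
  show Yt: "continuous_on {a..b} (\<lambda>t. Y t x)" if "x \<in> P" for x
    by (rule continuous_on_vector_derivative[OF ode[OF _ that]])
  fix x0 and e :: real assume x0: "x0 \<in> P" and e: "e > 0"
  define E where "E = exp ((2 * K + 1) * (b - a))"
  have E: "E > 0" by (simp add: E_def)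
  define d where "d = e / (3 * E)"
  have d: "d > 0" using e E by (simp add: d_def)
  \<comment> \<open>The coefficients are frozen along the solution at \<open>x0\<close>: the
    difference of two solutions then solves the equation of \<open>A t x\<close> with forcing
    \<open>h t x - h t x0\<close>, which is uniformly small for \<open>x\<close> near
    \<open>x0\<close>.\<close>
  define h where "h t x = A t x (Y t x0) + g t x" for t x
  have Y0: "continuous_on ({a..b} \<times> P) (\<lambda>z. Y (fst z) x0)"
    by (rule continuous_on_compose2[OF Yt[OF x0] continuous_on_fst[OF continuous_on_id]]) auto
  have h: "continuous_on ({a..b} \<times> P) (\<lambda>z. h (fst z) (snd z))"
    unfolding h_def
    by (rule continuous_on_add[OF continuous_on_linear_family[of _ "\<lambda>z. A (fst z) (snd z)" "\<lambda>z. Y (fst z) x0"] g])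
      (use A Y0 in auto)
  have "\<forall>\<^sub>F x in nhds x0. x \<in> P \<longrightarrow> Y s x \<in> ball (Y s x0) d"
    using x0 d by (intro eventually_nhds_image[OF init]) auto
  moreover have "\<forall>\<^sub>F x in nhds x0. x \<in> P \<and> (\<forall>t\<in>{a..b}. dist (h t x) (h t x0) < d)"
    by (rule continuous_family_uniform[OF _ P x0 d h]) simp
  ultimately show "\<forall>\<^sub>F x in nhds x0. x \<in> P \<longrightarrow> (\<forall>t\<in>{a..b}. dist (Y t x) (Y t x0) < e)"
  proof eventually_elim
    case (elim x)
    show ?case
    proof (intro impI ballI)
      fix t assume x: "x \<in> P" and t: "t \<in> {a..b}"
      have "norm (Y t x - Y t x0) \<le> E * (norm (Y s x - Y s x0) + d)"
        unfolding E_def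
      proof (rule gronwall[OF _ _ K(2) _ s t])
        fix t assume t: "t \<in> {a..b}"
        show "((\<lambda>t. Y t x - Y t x0) has_vector_derivative (A t x (Y t x) + g t x) - (A t x0 (Y t x0) + g t x0)) (at t within {a..b})"
          by (intro has_vector_derivative_diff ode t x x0)
        have "(A t x (Y t x) + g t x) - (A t x0 (Y t x0) + g t x0) = A t x (Y t x - Y t x0) + (h t x - h t x0)"
          by (simp add: h_def linear_diff[OF A(1)[OF t x]])
        also have "norm \<dots> \<le> K * norm (Y t x - Y t x0) + d"
          using elim x t by (intro norm_triangle_le add_mono K) (auto simp: dist_norm less_imp_le)
        finally show "norm ((A t x (Y t x) + g t x) - (A t x0 (Y t x0) + g t x0)) \<le> K * norm (Y t x - Y t x0) + d" .
      qed (use d in simp)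
      also have "\<dots> \<le> E * (d + d)"
        using elim x E by (auto simp: dist_norm norm_minus_commute less_imp_le)
      also have "\<dots> < e" using e E by (simp add: d_def)
      finally show "dist (Y t x) (Y t x0) < e" by (simp add: dist_norm)
    qed
  qed
qed

text \<open>Differentiating the equation in a direction \<open>v\<close> produces the forcing
  \<open>DA\<close>, which collects the derivatives of \<open>A\<close> applied to \<open>Y\<close>
  and of \<open>g\<close>. The induction must therefore be general in \<open>g\<close> and
  \<open>Y\<close>, while \<open>A\<close> and its bound stay fixed.\<close>

lemma linear_ode_Ck_family:
  fixes A :: "real \<Rightarrow> 'p::euclidean_space \<Rightarrow> 'e::euclidean_space \<Rightarrow> 'e"
  assumes P: "open P" and s: "s \<in> {a..b}"
    and A: "\<And>t x. t \<in> {a..b} \<Longrightarrow> x \<in> P \<Longrightarrow> linear (A t x)"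
    and K: "\<And>t x v. t \<in> {a..b} \<Longrightarrow> x \<in> P \<Longrightarrow> norm (A t x v) \<le> K * norm v" "K * (b - a) \<le> 1 / 2" "K \<ge> 0"
    and "\<And>i. Ck_family n {a..b} P (\<lambda>t x. A t x i)"
    and "Ck_family n {a..b} P g"
    and "\<And>t x. t \<in> {a..b} \<Longrightarrow> x \<in> P \<Longrightarrow>
      ((\<lambda>t. Y t x) has_vector_derivative A t x (Y t x) + g t x) (at t within {a..b})"
    and "Ck_on n P (Y s)"
  shows "Ck_family n {a..b} P Y"
  using assms(7-)
proof (induction n arbitrary: g Y)
  case 0
  show ?case unfolding Ck_family.simps
    by (rule linear_ode_continuous[OF P s A _ _ K(1) K(3) 0(3)]) (use 0 in auto)
next
  case (Suc n)
  note An = Suc.prems(1) and gn = Suc.prems(2) and ode = Suc.prems(3) and init = Suc.prems(4)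
  have init': "Ck_family (Suc n) {s} P (\<lambda>_. Y s)" using init by (rule Ck_family_static)
  \<comment> \<open>The induction hypothesis is first spent on \<open>Y\<close> itself:
    \<open>Y\<close> enters \<open>DA\<close>, which must be of class C^n before the hypothesis
    applies to the derivatives.\<close>
  have Yn: "Ck_family n {a..b} P Y"
  proof (rule Suc.IH[OF _ _ ode])
    show "Ck_on n P (Y s)"
      using Ck_family_imp_Ck_on[OF Ck_family_SucD[OF init']] by simp
  qed (use An gn Ck_family_SucD in blast)+
  \<comment> \<open>The right-hand side as a function of the pair (parameter, state), expanded over
    \<open>Basis\<close> because the regularity of \<open>A\<close> is known only on fixed
    vectors.\<close>
  define F where "F t z = (\<Sum>i\<in>Basis. (snd z \<bullet> i) *\<^sub>R A t (fst z) i) + g t (fst z)"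
    for t and z :: "'p \<times> 'e"
  have PU: "open (P \<times> (UNIV :: 'e set))" using P by (simp add: open_Times)
  have comp_fst: "Ck_family m {a..b} (P \<times> (UNIV :: 'e set)) (\<lambda>t z. h t (fst z))"
    if "Ck_family m {a..b} P h" for h :: "real \<Rightarrow> 'p \<Rightarrow> 'e" and m
    by (rule Ck_family_compose[OF PU P Ck_family_linear[OF bounded_linear_fst PU] that]) auto
  have "Ck_family (Suc n) {a..b} (P \<times> UNIV) F"
    unfolding F_def
    by (intro Ck_family_add[OF PU] Ck_family_sum[OF PU] Ck_family_scaleR[OF PU] comp_fst An gn
        Ck_family_linear[OF _ PU] bounded_linear_inner_left_comp bounded_linear_snd)
  then have F1: "Ck_family (Suc 0) {a..b} (P \<times> UNIV) F"
    by (rule Ck_family_le[rotated]) simp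
  define DA where "DA t x v = (\<Sum>i\<in>Basis. (Y t x \<bullet> i) *\<^sub>R fderiv (\<lambda>x. A t x i) x v)
     + fderiv (g t) x v" for t x v
  have dF: "fderiv (F t) (x, Y t x) (v, z) = A t x z + DA t x v"
    if "t \<in> {a..b}" "x \<in> P" for t x v z
  proof -
    have fstd: "((\<lambda>z. h (fst z)) has_derivative (\<lambda>k. fderiv h x (fst k))) (at (x, Y t x))"
      if "h differentiable (at x)" for h :: "'p \<Rightarrow> 'e"
    proof -
      have "(h has_derivative fderiv h x) (at (fst (x, Y t x)))"
        using that by (simp add: frechet_derivative_works)
      from has_derivative_compose[OF has_derivative_fst[OF has_derivative_ident] this]
      show ?thesis by simp
    qed
    have a: "(\<lambda>x. A t x i) differentiable (at x)" for i using An[of i] that by simp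
    have gd: "g t differentiable (at x)" using gn that by simp
    have "(F t has_derivative (\<lambda>k. (\<Sum>i\<in>Basis. (Y t x \<bullet> i) *\<^sub>R fderiv (\<lambda>x. A t x i) x (fst k)
        + (snd k \<bullet> i) *\<^sub>R A t x i) + fderiv (g t) x (fst k))) (at (x, Y t x))"
      unfolding F_def
      by (rule derivative_eq_intros fstd a gd refl)+ simp
    from frechet_derivative_at[OF this, symmetric] show ?thesis
      by (simp add: DA_def sum.distrib linear_Basis_sum[OF A[OF that], of z] algebra_simps)
  qed
  have "\<forall>x\<in>P. \<exists>Z. Z s = fderiv (Y s) x \<and> (\<forall>t\<in>{a..b}. (Y t has_derivative Z t) (at x) \<and>
    (\<forall>v. ((\<lambda>t. Z t v) has_vector_derivative fderiv (F t) (x, Y t x) (v, Z t v))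
      (at t within {a..b})))"
  proof (rule ballI, rule parametric_ode_has_derivative[OF P open_UNIV s F1 Ck_family_continuous[OF Yn]])
    fix x assume x: "x \<in> P"
    show "((\<lambda>t. Y t x) has_vector_derivative F t (x, Y t x)) (at t within {a..b})"
      if "t \<in> {a..b}" "x \<in> P" for t x
      using ode[OF that] by (simp add: F_def linear_Basis_sum[OF A[OF that], of "Y t x"])
    show "(Y s has_derivative fderiv (Y s) x) (at x)"
      using Ck_familyD[OF init' _ x] by simp
    show "norm (fderiv (F t) (x, Y t x) (0, z)) \<le> K * norm z" if "t \<in> {a..b}" for t z
    proof -
      have "DA t x 0 = 0"
        using Ck_family_derivative_linear[OF An that x] Ck_family_derivative_linear[OF gn that x]
        by (simp add: DA_def linear_0)
      then show ?thesis using dF[OF that x, of 0 z] K(1)[OF that x] by simp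
    qed
  qed (use K in auto)
  from bchoice[OF this] obtain Z where Z: "\<And>x. x \<in> P \<Longrightarrow> Z x s = fderiv (Y s) x"
    "\<And>x t. x \<in> P \<Longrightarrow> t \<in> {a..b} \<Longrightarrow> (Y t has_derivative Z x t) (at x)"
    "\<And>x t v. x \<in> P \<Longrightarrow> t \<in> {a..b} \<Longrightarrow>
      ((\<lambda>t. Z x t v) has_vector_derivative fderiv (F t) (x, Y t x) (v, Z x t v)) (at t within {a..b})"
    by blast
  show ?case
  proof (rule Ck_family_SucI[OF P Ck_family_continuous[OF Yn] Z(2)])
    fix v
    show "Ck_family n {a..b} P (\<lambda>t x. Z x t v)"
    proof (rule Suc.IH[of "\<lambda>t x. DA t x v"])
      show "Ck_family n {a..b} P (\<lambda>t x. A t x i)" for i using An by (rule Ck_family_SucD)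
      show "Ck_family n {a..b} P (\<lambda>t x. DA t x v)"
        unfolding DA_def
        by (intro Ck_family_add[OF P] Ck_family_sum[OF P] Ck_family_scaleR[OF P]
            Ck_family_bounded_linear[OF bounded_linear_inner_left P Yn] Ck_family_derivative[OF An] Ck_family_derivative[OF gn])
      show "((\<lambda>t. Z x t v) has_vector_derivative A t x (Z x t v) + DA t x v) (at t within {a..b})"
        if "t \<in> {a..b}" "x \<in> P" for t x
        using Z(3)[OF that(2,1), of v] dF[OF that] by simp
      have "Ck_family n {s} P (\<lambda>t x. Z x s v)"
        by (rule Ck_family_cong[OF P _ Ck_family_derivative[OF init', of v]]) (simp add: Z(1))
      then show "Ck_on n P (\<lambda>x. Z x s v)"
        by (rule Ck_family_imp_Ck_on) simp
    qed
  qed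
qed

text \<open>Convexity of \<open>U\<close> makes \<open>V\<close> Lipschitz with constant
  \<open>K\<close>, so Gronwall gives continuity of \<open>y\<close>, and the derivative
  \<open>Z\<close> exists by linearisation. Then regularity bootstraps: if \<open>y\<close> is of
  class C^n, so are the coefficients \<open>fderiv (V t) (y t x)\<close> of the linear equation for
  \<open>Z\<close>, hence so is \<open>Z\<close>, and \<open>y\<close> gains one derivative.\<close>

lemma flow_Ck_family:
  fixes V :: "real \<Rightarrow> 'e::euclidean_space \<Rightarrow> 'e"
  assumes P: "open P" and U: "open U" "convex U" and s: "s \<in> {a..b}"
    and V: "\<And>n. Ck_family n {a..b} U V"
    and K: "\<And>t p v. t \<in> {a..b} \<Longrightarrow> p \<in> U \<Longrightarrow> norm (fderiv (V t) p v) \<le> K * norm v"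
      "K * (b - a) \<le> 1 / 2" "K \<ge> 0"
    and y: "\<And>t x. t \<in> {a..b} \<Longrightarrow> x \<in> P \<Longrightarrow> y t x \<in> U" "\<And>x. x \<in> P \<Longrightarrow> y s x = x"
    and ode: "\<And>t x. t \<in> {a..b} \<Longrightarrow> x \<in> P \<Longrightarrow>
      ((\<lambda>t. y t x) has_vector_derivative V t (y t x)) (at t within {a..b})"
  shows "Ck_family n {a..b} P y"
    and "t \<in> {a..b} \<Longrightarrow> x \<in> P \<Longrightarrow> ((\<lambda>t. fderiv (y t) x v) has_vector_derivative
      fderiv (V t) (y t x) (fderiv (y t) x v)) (at t within {a..b})"
proof -
  have V': "(V t has_derivative fderiv (V t) p) (at p)" if "t \<in> {a..b}" "p \<in> U" for t p
    by (rule Ck_familyD[OF V[of "Suc 0"] that])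
  have lip: "norm (V t p - V t q) \<le> K * norm (p - q)" if "t \<in> {a..b}" "p \<in> U" "q \<in> U" for t p q
    by (rule differentiable_bound[OF U(2) has_derivative_at_withinI[OF V'[OF that(1)]]])
      (use that K(1) in \<open>auto intro!: onorm_le\<close>)
  have y_cont: "continuous_on ({a..b} \<times> P) (\<lambda>z. y (fst z) (snd z))"
  proof (rule continuous_on_familyI)
    show "continuous_on {a..b} (\<lambda>t. y t x)" if "x \<in> P" for x
      by (rule continuous_on_vector_derivative[OF ode[OF _ that]])
    fix x0 and e :: real assume x0: "x0 \<in> P" and e: "e > 0"
    define E where "E = exp ((2 * K + 1) * (b - a))"
    have E: "E > 0" by (simp add: E_def)
    have "dist (y t x) (y t x0) < e" if x: "x \<in> P" "dist x x0 < e / E" and t: "t \<in> {a..b}" for t x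
    proof -
      have "norm (y t x - y t x0) \<le> E * (norm (y s x - y s x0) + 0)"
        unfolding E_def
      proof (rule gronwall[OF _ _ K(3) order_refl s t])
        show "((\<lambda>t. y t x - y t x0) has_vector_derivative V t (y t x) - V t (y t x0)) (at t within {a..b})"
          if "t \<in> {a..b}" for t
          by (intro has_vector_derivative_diff ode that x x0)
        show "norm (V t (y t x) - V t (y t x0)) \<le> K * norm (y t x - y t x0) + 0" if "t \<in> {a..b}" for t
          using lip[OF that y(1)[OF that x(1)] y(1)[OF that x0]] by simp
      qed
      also have "\<dots> < e" using x x0 E by (simp add: y(2) dist_norm field_simps)
      finally show ?thesis by (simp add: dist_norm)
    qed
    then show "\<forall>\<^sub>F x in nhds x0. x \<in> P \<longrightarrow> (\<forall>t\<in>{a..b}. dist (y t x) (y t x0) < e)"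
      unfolding eventually_nhds_metric using e E by (intro exI[of _ "e / E"]) auto
  qed
  \<comment> \<open>The parameter is the initial value, which the vector field does not see; it acts
    only through the initial derivative, the identity.\<close>
  define F where "F t z = V t (snd z)" for t and z :: "'e \<times> 'e"
  have PU: "open (P \<times> U)" using P U by (simp add: open_Times)
  have F: "Ck_family (Suc 0) {a..b} (P \<times> U) F"
    unfolding F_def
    by (rule Ck_family_compose[OF PU U(1) Ck_family_linear[OF bounded_linear_snd PU] V]) auto
  have dF: "fderiv (F t) (x, p) (v, z) = fderiv (V t) p z"
    if "t \<in> {a..b}" "p \<in> U" for t x p v z
  proof -
    have "(V t has_derivative fderiv (V t) p) (at (snd (x, p)))"
      using V'[OF that] by simp
    from has_derivative_compose[OF has_derivative_snd[OF has_derivative_ident] this]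
    have "(F t has_derivative (\<lambda>k. fderiv (V t) p (snd k))) (at (x, p))"
      unfolding F_def by simp
    from frechet_derivative_at[OF this, symmetric] show ?thesis by simp
  qed
  have "\<forall>x\<in>P. \<exists>Z. Z s = (\<lambda>v. v) \<and> (\<forall>t\<in>{a..b}. (y t has_derivative Z t) (at x) \<and>
    (\<forall>v. ((\<lambda>t. Z t v) has_vector_derivative fderiv (F t) (x, y t x) (v, Z t v))
      (at t within {a..b})))"
  proof (rule ballI, rule parametric_ode_has_derivative[OF P U(1) s F y_cont y(1)])
    fix x assume x: "x \<in> P"
    show "((\<lambda>t. y t x) has_vector_derivative F t (x, y t x)) (at t within {a..b})"
      if "t \<in> {a..b}" "x \<in> P" for t x
      using ode[OF that] by (simp add: F_def)
    show "(y s has_derivative (\<lambda>v. v)) (at x)"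
      by (rule has_derivative_transform_within_open[OF has_derivative_ident P x]) (simp add: y(2))
    show "norm (fderiv (F t) (x, y t x) (0, z)) \<le> K * norm z" if "t \<in> {a..b}" for t z
      using dF[OF that y(1)[OF that x]] K(1)[OF that y(1)[OF that x]] by simp
  qed (use K in auto)
  from bchoice[OF this] obtain Z where Z: "\<And>x. x \<in> P \<Longrightarrow> Z x s = (\<lambda>v. v)"
    "\<And>x t. x \<in> P \<Longrightarrow> t \<in> {a..b} \<Longrightarrow> (y t has_derivative Z x t) (at x)"
    "\<And>x t v. x \<in> P \<Longrightarrow> t \<in> {a..b} \<Longrightarrow>
      ((\<lambda>t. Z x t v) has_vector_derivative fderiv (F t) (x, y t x) (v, Z x t v)) (at t within {a..b})"
    by blast
  have Z3: "((\<lambda>t. Z x t v) has_vector_derivative fderiv (V t) (y t x) (Z x t v)) (at t within {a..b})"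
    if "t \<in> {a..b}" "x \<in> P" for t x v
    using Z(3)[OF that(2,1), of v] dF[OF that(1) y(1)[OF that]] by simp
  show "Ck_family n {a..b} P y"
  proof (induction n)
    case 0
    then show ?case using y_cont by simp
  next
    case (Suc n)
    show ?case
    proof (rule Ck_family_SucI[OF P y_cont Z(2)])
      fix v
      show "Ck_family n {a..b} P (\<lambda>t x. Z x t v)"
      proof (rule linear_ode_Ck_family[OF P s _ _ K(2,3), where g="\<lambda>t x. 0" and A="\<lambda>t x. fderiv (V t) (y t x)"])
        show "linear (fderiv (V t) (y t x))" if "t \<in> {a..b}" "x \<in> P" for t x
          by (rule has_derivative_linear[OF V'[OF that(1) y(1)[OF that]]])
        show "norm (fderiv (V t) (y t x) v) \<le> K * norm v" if "t \<in> {a..b}" "x \<in> P" for t x v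
          by (rule K(1)[OF that(1) y(1)[OF that]])
        show "Ck_family n {a..b} P (\<lambda>t x. fderiv (V t) (y t x) i)" for i
          by (rule Ck_family_compose[OF P U(1) Suc Ck_family_derivative[OF V] y(1)])
        show "Ck_family n {a..b} P (\<lambda>t x. 0::'e)" by (rule Ck_family_const[OF P])
        show "((\<lambda>t. Z x t v) has_vector_derivative fderiv (V t) (y t x) (Z x t v) + 0) (at t within {a..b})"
          if "t \<in> {a..b}" "x \<in> P" for t x
          using Z3[OF that] by simp
        have "Ck_family n {s} P (\<lambda>t x. Z x s v)"
          by (rule Ck_family_cong[OF P _ Ck_family_const[OF P, of n "{s}" v]]) (simp add: Z(1))
        then show "Ck_on n P (\<lambda>x. Z x s v)"
          by (rule Ck_family_imp_Ck_on) simp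
      qed
    qed
  qed
  show "((\<lambda>t. fderiv (y t) x v) has_vector_derivative
      fderiv (V t) (y t x) (fderiv (y t) x v)) (at t within {a..b})"
    if t: "t \<in> {a..b}" and x: "x \<in> P"
  proof -
    have eq: "fderiv (y t) x v = Z x t v" if "t \<in> {a..b}" for t
      using frechet_derivative_at[OF Z(2)[OF x that]] by simp
    show ?thesis
      unfolding eq[OF t]
      by (rule has_vector_derivative_transform[OF t _ Z3[OF t x]]) (rule eq)
  qed
qed

section \<open>Linear systems and second derivatives\<close>

text \<open>\<open>L z0\<close> is bounded below by \<open>B\<close>, so nearby \<open>L z\<close>
  are bounded below by \<open>B / 2\<close>, and \<open>L z (X z - X z0)\<close> equals
  \<open>b z - L z (X z0)\<close>, which tends to 0. These lemmas give smoothness of the Hamiltonian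
  vector field, the solution of a linear system, without inverse matrices.\<close>

lemma linear_system_continuous:
  fixes L :: "'s::topological_space \<Rightarrow> 'a::euclidean_space \<Rightarrow> 'b::euclidean_space"
  assumes L: "\<And>z. z \<in> S \<Longrightarrow> linear (L z)" "\<And>z. z \<in> S \<Longrightarrow> inj (L z)" "\<And>v. continuous_on S (\<lambda>z. L z v)"
    and b: "continuous_on S b" and X: "\<And>z. z \<in> S \<Longrightarrow> L z (X z) = b z"
  shows "continuous_on S X"
  unfolding continuous_on_def tendsto_iff
proof (intro ballI allI impI)
  fix z0 and e :: real assume z0: "z0 \<in> S" and e: "e > 0"
  obtain B where B: "B > 0" "\<And>v. B * norm v \<le> norm (L z0 v)"
    using linear_inj_bounded_below_pos[OF L(1)[OF z0] L(2)[OF z0]] by blast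
  have "\<forall>\<^sub>F z in nhds z0. \<forall>i\<in>Basis. z \<in> S \<longrightarrow> L z i \<in> ball (L z0 i) (B / (2 * real DIM('a)))"
    using z0 B by (intro eventually_ball_finite ballI eventually_nhds_image[OF L(3)]) auto
  moreover have "\<forall>\<^sub>F z in nhds z0. z \<in> S \<longrightarrow> b z - L z (X z0) \<in> ball 0 (B * e / 2)"
    using z0 B e X[OF z0] by (intro eventually_nhds_image[OF continuous_on_diff[OF b L(3)]]) auto
  ultimately have "\<forall>\<^sub>F z in nhds z0. z \<in> S \<longrightarrow> dist (X z) (X z0) < e"
  proof eventually_elim
    case (elim z)
    show ?case
    proof
      assume z: "z \<in> S"
      define v where "v = X z - X z0"
      have "norm (L z0 v - L z v) \<le> real DIM('a) * (B / (2 * real DIM('a))) * norm v"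
        by (rule linear_norm_le_Basis[OF linear_compose_sub[OF L(1)[OF z0] L(1)[OF z]]])
          (use elim(1) z in \<open>auto simp: dist_norm less_imp_le\<close>)
      then have "norm (L z0 v - L z v) \<le> B / 2 * norm v" by simp
      then have "B / 2 * norm v \<le> norm (L z v)"
        using B(2)[of v] norm_triangle_sub[of "L z0 v" "L z v"] by simp
      also have "L z v = b z - L z (X z0)" using X[OF z] by (simp add: v_def linear_diff[OF L(1)[OF z]])
      also have "norm \<dots> < B * e / 2" using elim(2) z by simp
      finally show "dist (X z) (X z0) < e" using B by (simp add: v_def dist_norm)
    qed
  qed
  then show "\<forall>\<^sub>F z in at z0 within S. dist (X z) (X z0) < e"
    unfolding eventually_at_filter by (rule eventually_mono) auto
qed

text \<open>A product rule in which \<open>g\<close> is only continuous: as \<open>f x = 0\<close>,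
  the product of \<open>g y - g x\<close> and \<open>f y\<close> is of higher order.\<close>

lemma has_derivative_scaleR_vanishing:
  fixes f :: "'a::real_normed_vector \<Rightarrow> 'b::real_normed_vector" and g :: "'a \<Rightarrow> real"
  assumes f: "(f has_derivative f') (at x)" "f x = 0" and g: "isCont g x"
  shows "((\<lambda>y. g y *\<^sub>R f y) has_derivative (\<lambda>k. g x *\<^sub>R f' k)) (at x)"
proof -
  have "((\<lambda>y. (g y - g x) *\<^sub>R f y) has_derivative (\<lambda>k. 0)) (at x)"
    unfolding has_derivative_at_alt
  proof (intro conjI allI impI)
    fix e :: real assume e: "e > 0"
    have bl: "bounded_linear f'" using f has_derivative_bounded_linear by blast
    define N where "N = onorm f' + 1"
    have N: "N > 0" using onorm_pos_le[OF bl] by (simp add: N_def)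
    obtain d1 where d1: "d1 > 0" "\<And>y. norm (y - x) < d1 \<Longrightarrow> norm (f y - f x - f' (y - x)) \<le> 1 * norm (y - x)"
      using f unfolding has_derivative_at_alt by (meson zero_less_one)
    obtain d2 where d2: "d2 > 0" "\<And>y. dist y x < d2 \<Longrightarrow> dist (g y) (g x) < e / N"
      using g e N unfolding continuous_at_eps_delta by (meson divide_pos_pos)
    show "\<exists>d>0. \<forall>y. norm (y - x) < d \<longrightarrow> norm ((g y - g x) *\<^sub>R f y - (g x - g x) *\<^sub>R f x - 0) \<le> e * norm (y - x)"
    proof (intro exI[of _ "min d1 d2"] conjI allI impI)
      show "0 < min d1 d2" using d1 d2 by simp
      fix y assume y: "norm (y - x) < min d1 d2"
      have "norm (f y) \<le> norm (f' (y - x)) + 1 * norm (y - x)"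
        using d1(2)[of y] y f(2) norm_triangle_sub[of "f y" "f' (y - x)"] by simp
      also have "\<dots> \<le> N * norm (y - x)"
        using onorm[OF bl, of "y - x"] by (simp add: N_def algebra_simps)
      finally have "norm (f y) \<le> N * norm (y - x)" .
      moreover have "\<bar>g y - g x\<bar> \<le> e / N" using d2(2)[of y] y by (simp add: dist_norm dist_real_def)
      ultimately have "\<bar>g y - g x\<bar> * norm (f y) \<le> e / N * (N * norm (y - x))"
        using e N by (intro mult_mono) auto
      then show "norm ((g y - g x) *\<^sub>R f y - (g x - g x) *\<^sub>R f x - 0) \<le> e * norm (y - x)"
        using N by simp
    qed
  qed simp
  from has_derivative_add[OF this has_derivative_scaleR_right[OF f(1), of "g x"]]
  show ?thesis by (simp add: algebra_simps)
qed

text \<open>Freezing the operator at \<open>x\<close> gives L x (X y) = b y - (L y - L x)(X y). The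
  unknown on the right is only known to be continuous, but it multiplies terms vanishing at
  \<open>x\<close>, so the right-hand side is differentiable and the inverse \<open>G\<close> of
  \<open>L x\<close> can be applied.\<close>

lemma linear_system_has_derivative:
  fixes L :: "'p::real_normed_vector \<Rightarrow> 'a::euclidean_space \<Rightarrow> 'a"
  assumes P: "open P" "x \<in> P"
    and L: "\<And>y. y \<in> P \<Longrightarrow> linear (L y)" "inj (L x)" "\<And>i. ((\<lambda>y. L y i) has_derivative L' i) (at x)"
    and b: "(b has_derivative b') (at x)" and X: "\<And>y. y \<in> P \<Longrightarrow> L y (X y) = b y" "isCont X x"
  shows "\<exists>X'. (X has_derivative X') (at x) \<and> (\<forall>v. L x (X' v) = b' v - (\<Sum>i\<in>Basis. (X x \<bullet> i) *\<^sub>R L' i v))"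
proof -
  obtain G where G: "linear G" "\<And>v. G (L x v) = v" "\<And>v. L x (G v) = v"
    using linear_injective_isomorphism[OF L(1)[OF P(2)] L(2)] by blast
  have bG: "bounded_linear G" using G(1) by (simp add: linear_conv_bounded_linear)
  have "((\<lambda>y. b y - (\<Sum>i\<in>Basis. (X y \<bullet> i) *\<^sub>R (L y i - L x i))) has_derivative
      (\<lambda>v. b' v - (\<Sum>i\<in>Basis. (X x \<bullet> i) *\<^sub>R L' i v))) (at x)"
  proof (intro has_derivative_diff b has_derivative_sum has_derivative_scaleR_vanishing)
    show "((\<lambda>y. L y i - L x i) has_derivative L' i) (at x)" for i
      using has_derivative_diff[OF L(3)[of i] has_derivative_const[of "L x i"]] by simp
    show "isCont (\<lambda>y. X y \<bullet> i) x" for i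
      using X(2) by (intro continuous_intros)
  qed simp
  from bounded_linear.has_derivative[OF bG this]
  have "((\<lambda>y. G (b y - (\<Sum>i\<in>Basis. (X y \<bullet> i) *\<^sub>R (L y i - L x i)))) has_derivative
      (\<lambda>v. G (b' v - (\<Sum>i\<in>Basis. (X x \<bullet> i) *\<^sub>R L' i v)))) (at x)" .
  then have "(X has_derivative (\<lambda>v. G (b' v - (\<Sum>i\<in>Basis. (X x \<bullet> i) *\<^sub>R L' i v)))) (at x)"
  proof (rule has_derivative_transform_within_open[OF _ P])
    fix y assume y: "y \<in> P"
    have "b y = (\<Sum>i\<in>Basis. (X y \<bullet> i) *\<^sub>R L y i)"
      using X(1)[OF y] linear_Basis_sum[OF L(1)[OF y], of "X y"] by simp
    then have "b y - (\<Sum>i\<in>Basis. (X y \<bullet> i) *\<^sub>R (L y i - L x i)) = L x (X y)"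
      using linear_Basis_sum[OF L(1)[OF P(2)], of "X y"] by (simp add: scaleR_diff_right sum_subtractf)
    then show "G (b y - (\<Sum>i\<in>Basis. (X y \<bullet> i) *\<^sub>R (L y i - L x i))) = X y" using G by simp
  qed
  then show ?thesis using G(3) by blast
qed

text \<open>The same scheme as for differential equations: the derivative of the solution solves the
  system with the same \<open>L\<close> and another right-hand side.\<close>

lemma linear_system_Ck_family:
  fixes L :: "'t::topological_space \<Rightarrow> 'p::real_normed_vector \<Rightarrow> 'a::euclidean_space \<Rightarrow> 'a"
  assumes P: "open P"
    and L: "\<And>t x. t \<in> T \<Longrightarrow> x \<in> P \<Longrightarrow> linear (L t x)" "\<And>t x. t \<in> T \<Longrightarrow> x \<in> P \<Longrightarrow> inj (L t x)"
    and "\<And>i. Ck_family n T P (\<lambda>t x. L t x i)" "Ck_family n T P b"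
    and "\<And>t x. t \<in> T \<Longrightarrow> x \<in> P \<Longrightarrow> L t x (X t x) = b t x"
  shows "Ck_family n T P X"
  using assms(4-)
proof (induction n arbitrary: b X)
  case 0
  show ?case unfolding Ck_family.simps
    by (rule linear_system_continuous[of _ "\<lambda>z. L (fst z) (snd z)" "\<lambda>z. b (fst z) (snd z)"])
      (use 0 L in auto)
next
  case (Suc n)
  have Xn: "Ck_family n T P X"
    by (rule Suc.IH[OF _ _ Suc.prems(3)]) (use Suc.prems Ck_family_SucD in blast)+
  have X_cont: "continuous_on (T \<times> P) (\<lambda>z. X (fst z) (snd z))" by (rule Ck_family_continuous[OF Xn])
  define b' where "b' t x v = fderiv (b t) x v -
      (\<Sum>i\<in>Basis. (X t x \<bullet> i) *\<^sub>R fderiv (\<lambda>x. L t x i) x v)" for t x v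
  have "\<exists>X'. (X t has_derivative X') (at x) \<and> (\<forall>v. L t x (X' v) = b' t x v)" if "t \<in> T" "x \<in> P" for t x
    unfolding b'_def
  proof (rule linear_system_has_derivative[OF P that(2), of "L t"])
    show "((\<lambda>y. L t y i) has_derivative fderiv (\<lambda>x. L t x i) x) (at x)" for i
      by (rule Ck_familyD[OF Suc.prems(1) that])
    show "(b t has_derivative fderiv (b t) x) (at x)"
      by (rule Ck_familyD[OF Suc.prems(2) that])
    have "continuous_on P (X t)"
      by (rule continuous_on_family[OF X_cont, of P "\<lambda>_. t" "\<lambda>x. x"]) (use that in auto)
    then show "isCont (X t) x" using P that continuous_on_eq_continuous_at by blast
  qed (use that L Suc.prems in auto)
  then have "\<forall>z\<in>T \<times> P. \<exists>X'. (X (fst z) has_derivative X') (at (snd z)) \<and> (\<forall>v. L (fst z) (snd z) (X' v) = b' (fst z) (snd z) v)"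
    by auto
  from bchoice[OF this] obtain X' where X':
    "\<And>t x. t \<in> T \<Longrightarrow> x \<in> P \<Longrightarrow> (X t has_derivative X' (t, x)) (at x)"
    "\<And>t x v. t \<in> T \<Longrightarrow> x \<in> P \<Longrightarrow> L t x (X' (t, x) v) = b' t x v" by auto
  show ?case
  proof (rule Ck_family_SucI[OF P X_cont X'(1)])
    fix v
    show "Ck_family n T P (\<lambda>t x. X' (t, x) v)"
    proof (rule Suc.IH[of "\<lambda>t x. b' t x v"])
      show "Ck_family n T P (\<lambda>t x. L t x i)" for i using Suc.prems(1) by (rule Ck_family_SucD)
      have "Ck_family n T P (\<lambda>t x. fderiv (b t) x v +
          (- 1) *\<^sub>R (\<Sum>i\<in>Basis. (X t x \<bullet> i) *\<^sub>R fderiv (\<lambda>x. L t x i) x v))"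
        by (intro Ck_family_add[OF P] Ck_family_scaleR[OF P] Ck_family_const[OF P] Ck_family_sum[OF P]
            Ck_family_derivative[OF Suc.prems(1)] Ck_family_derivative[OF Suc.prems(2)]
            Ck_family_bounded_linear[OF bounded_linear_inner_left P Xn])
      then show "Ck_family n T P (\<lambda>t x. b' t x v)" by (simp add: b'_def)
    qed (use X'(2) in auto)
  qed
qed

text \<open>The mean value theorem, once in the direction \<open>u\<close> for the difference in
  \<open>w\<close>, then in the direction \<open>w\<close>. The left-hand side is symmetric in
  \<open>u\<close> and \<open>w\<close>, which is how the two mixed derivatives are
  compared.\<close>

lemma second_difference_mvt:
  fixes g :: "'a::real_normed_vector \<Rightarrow> real"
  assumes g: "\<And>x. x \<in> P \<Longrightarrow> g differentiable (at x)"
    "\<And>x. x \<in> P \<Longrightarrow> (\<lambda>x. fderiv g x u) differentiable (at x)"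
    and h: "h > 0" "\<And>a b. a \<in> {0..h} \<Longrightarrow> b \<in> {0..h} \<Longrightarrow> p + a *\<^sub>R u + b *\<^sub>R w \<in> P"
  shows "\<exists>a\<in>{0..h}. \<exists>b\<in>{0..h}. g (p + h *\<^sub>R u + h *\<^sub>R w) - g (p + h *\<^sub>R u) - g (p + h *\<^sub>R w) + g p
    = h * (h * fderiv (\<lambda>x. fderiv g x u) (p + a *\<^sub>R u + b *\<^sub>R w) w)"
proof -
  define D where "D x = fderiv g x u" for x
  have g1: "(g has_derivative fderiv g x) (at x)" if "x \<in> P" for x
    using g(1)[OF that] frechet_derivative_works by blast
  have g2: "(D has_derivative fderiv D x) (at x)" if "x \<in> P" for x
    unfolding D_def[abs_def] using g(2)[OF that] by (simp add: frechet_derivative_works[symmetric])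
  have da: "((\<lambda>a. g (p + a *\<^sub>R u + b *\<^sub>R w)) has_derivative (\<lambda>k. k * D (p + a *\<^sub>R u + b *\<^sub>R w))) (at a within S)"
    if "a \<in> {0..h}" "b \<in> {0..h}" for a b S
  proof -
    have "((\<lambda>a. p + a *\<^sub>R u + b *\<^sub>R w) has_derivative (\<lambda>k. k *\<^sub>R u)) (at a within S)"
      by (auto intro!: derivative_eq_intros)
    from has_derivative_compose[OF this g1[OF h(2)[OF that]]] show ?thesis
      using linear_scale[OF has_derivative_linear[OF g1[OF h(2)[OF that]]]] by (simp add: D_def)
  qed
  have db: "((\<lambda>b. D (p + a *\<^sub>R u + b *\<^sub>R w)) has_derivative (\<lambda>k. k * fderiv D (p + a *\<^sub>R u + b *\<^sub>R w) w)) (at b within S)"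
    if "a \<in> {0..h}" "b \<in> {0..h}" for a b S
  proof -
    have "((\<lambda>b. p + a *\<^sub>R u + b *\<^sub>R w) has_derivative (\<lambda>k. k *\<^sub>R w)) (at b within S)"
      by (auto intro!: derivative_eq_intros)
    from has_derivative_compose[OF this g2[OF h(2)[OF that]]] show ?thesis
      using linear_scale[OF has_derivative_linear[OF g2[OF h(2)[OF that]]]] by simp
  qed
  have "\<exists>a\<in>{0..h}. (g (p + h *\<^sub>R u + h *\<^sub>R w) - g (p + h *\<^sub>R u + 0 *\<^sub>R w)) - (g (p + 0 *\<^sub>R u + h *\<^sub>R w) - g (p + 0 *\<^sub>R u + 0 *\<^sub>R w))
      = (h - 0) * D (p + a *\<^sub>R u + h *\<^sub>R w) - (h - 0) * D (p + a *\<^sub>R u + 0 *\<^sub>R w)"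
    by (rule mvt_very_simple[where f="\<lambda>a. g (p + a *\<^sub>R u + h *\<^sub>R w) - g (p + a *\<^sub>R u + 0 *\<^sub>R w)"
          and f'="\<lambda>a k. k * D (p + a *\<^sub>R u + h *\<^sub>R w) - k * D (p + a *\<^sub>R u + 0 *\<^sub>R w)"])
      (use h(1) in \<open>auto intro!: has_derivative_diff da simp del: scaleR_zero_left\<close>)
  then obtain a where a: "a \<in> {0..h}" "g (p + h *\<^sub>R u + h *\<^sub>R w) - g (p + h *\<^sub>R u) - g (p + h *\<^sub>R w) + g p
      = h * (D (p + a *\<^sub>R u + h *\<^sub>R w) - D (p + a *\<^sub>R u + 0 *\<^sub>R w))" by (auto simp: algebra_simps)
  have "\<exists>b\<in>{0..h}. D (p + a *\<^sub>R u + h *\<^sub>R w) - D (p + a *\<^sub>R u + 0 *\<^sub>R w)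
      = (h - 0) * fderiv D (p + a *\<^sub>R u + b *\<^sub>R w) w"
    by (rule mvt_very_simple[where f="\<lambda>b. D (p + a *\<^sub>R u + b *\<^sub>R w)"
          and f'="\<lambda>b k. k * fderiv D (p + a *\<^sub>R u + b *\<^sub>R w) w"])
      (use h(1) a(1) in \<open>auto intro!: db\<close>)
  then show ?thesis using a by (auto simp: D_def[abs_def])
qed

lemma second_derivative_symmetric:
  fixes g :: "'a::real_normed_vector \<Rightarrow> real"
  assumes P: "open P" "p \<in> P" and g: "Ck_on 2 P g"
  shows "fderiv (\<lambda>x. fderiv g x u) p w
    = fderiv (\<lambda>x. fderiv g x w) p u"
proof (rule ccontr)
  define f where "f u w x = fderiv (\<lambda>x. fderiv g x u) x w" for u w x
  assume neq: "\<not> ?thesis"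
  have g2: "Ck_on (Suc (Suc 0)) P g" using g by (simp add: numeral_2_eq_2)
  have f_cont: "continuous_on P (f u w)" for u w using g2 by (simp add: f_def[abs_def])
  define e where "e = \<bar>f u w p - f w u p\<bar> / 2"
  have e: "e > 0" using neq by (simp add: e_def f_def)
  have "\<forall>\<^sub>F x in nhds p. x \<in> P \<and> (x \<in> P \<longrightarrow> f u w x \<in> ball (f u w p) e) \<and> (x \<in> P \<longrightarrow> f w u x \<in> ball (f w u p) e)"
    using P e by (intro eventually_conj eventually_nhds_image[OF f_cont]) (auto simp: eventually_nhds)
  then obtain d where d: "d > 0" "\<And>x. dist x p < d \<Longrightarrow> x \<in> P" "\<And>x. dist x p < d \<Longrightarrow> \<bar>f u w x - f u w p\<bar> < e"
    "\<And>x. dist x p < d \<Longrightarrow> \<bar>f w u x - f w u p\<bar> < e"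
    unfolding eventually_nhds_metric by (auto simp: dist_real_def abs_minus_commute)
  \<comment> \<open>Keeps the parallelogram with sides \<open>h *\<^sub>R u\<close> and
    \<open>h *\<^sub>R w\<close> inside the ball of radius \<open>d\<close>; the summand 1 avoids
    division by zero.\<close>
  define h where "h = d / (norm u + norm w + 1)"
  have pos: "norm u + norm w + 1 > 0" using norm_ge_zero[of u] norm_ge_zero[of w] by linarith
  have h: "h > 0" using d pos by (simp add: h_def)
  have close: "dist (p + a *\<^sub>R u + b *\<^sub>R w) p < d" if "a \<in> {0..h}" "b \<in> {0..h}" for a b
  proof -
    have "norm (a *\<^sub>R u + b *\<^sub>R w) \<le> \<bar>a\<bar> * norm u + \<bar>b\<bar> * norm w"
      using norm_triangle_ineq[of "a *\<^sub>R u" "b *\<^sub>R w"] by simp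
    also have "\<dots> \<le> h * norm u + h * norm w"
      using that by (intro add_mono mult_right_mono) auto
    also have "\<dots> < h * (norm u + norm w + 1)" using h by (simp add: algebra_simps)
    also have "\<dots> = d" using pos by (simp add: h_def)
    finally show ?thesis by (simp add: dist_norm add.assoc)
  qed
  have close': "dist (p + a *\<^sub>R w + b *\<^sub>R u) p < d" if "a \<in> {0..h}" "b \<in> {0..h}" for a b
    using close[OF that(2,1)] by (simp add: add.assoc add.commute[of "a *\<^sub>R w"])
  have diff: "g differentiable (at x)" "(\<lambda>x. fderiv g x v) differentiable (at x)" if "x \<in> P" for x v
    using g2 that by auto
  obtain a b where ab: "a \<in> {0..h}" "b \<in> {0..h}"
    "g (p + h *\<^sub>R u + h *\<^sub>R w) - g (p + h *\<^sub>R u) - g (p + h *\<^sub>R w) + g p = h * (h * f u w (p + a *\<^sub>R u + b *\<^sub>R w))"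
    using second_difference_mvt[of P g u h p w] diff h d(2) close unfolding f_def by blast
  obtain a' b' where ab': "a' \<in> {0..h}" "b' \<in> {0..h}"
    "g (p + h *\<^sub>R w + h *\<^sub>R u) - g (p + h *\<^sub>R w) - g (p + h *\<^sub>R u) + g p = h * (h * f w u (p + a' *\<^sub>R w + b' *\<^sub>R u))"
    using second_difference_mvt[of P g w h p u] diff h d(2) close' unfolding f_def by blast
  have "h * (h * f u w (p + a *\<^sub>R u + b *\<^sub>R w)) = h * (h * f w u (p + a' *\<^sub>R w + b' *\<^sub>R u))"
    using ab(3) ab'(3) by (simp add: algebra_simps)
  then have "f u w (p + a *\<^sub>R u + b *\<^sub>R w) = f w u (p + a' *\<^sub>R w + b' *\<^sub>R u)" using h by simp
  then show False
    using d(3)[OF close[OF ab(1,2)]] d(4)[OF close'[OF ab'(1,2)]]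
      abs_triangle_ineq4[of "f u w p - f u w (p + a *\<^sub>R u + b *\<^sub>R w)" "f w u p - f w u (p + a' *\<^sub>R w + b' *\<^sub>R u)"]
    by (simp add: e_def abs_minus_commute)
qed

section \<open>From local smooth extensions to the class C^n\<close>

lemma smooth_on_imp_Ck_family:
  assumes "open U" "smooth_on (T \<times> U) (\<lambda>z. f (fst z) (snd z))"
  shows "Ck_family n T U f"
proof (rule Ck_family_local)
  fix t x assume "t \<in> T" "x \<in> U"
  then obtain W g where W: "open W" "(t, x) \<in> W" "\<And>n. Ck_on n W g"
    "\<And>z. z \<in> (T \<times> U) \<inter> W \<Longrightarrow> g z = f (fst z) (snd z)"
    using assms(2) unfolding smooth_on_def by fastforce
  obtain N Q where N: "open N" "open Q" "(t, x) \<in> N \<times> Q" "N \<times> Q \<subseteq> W"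
    using open_prod_elim[OF W(1,2)] by blast
  \<comment> \<open>Only derivatives in \<open>u\<close> are taken, and \<open>U\<close> is open, so
    it does not matter how the extension \<open>g\<close> continues \<open>f\<close> beyond
    \<open>T\<close>.\<close>
  have "Ck_family n (T \<inter> N) (U \<inter> Q) (\<lambda>t u. g (t, u))"
    by (rule Ck_on_imp_Ck_family[OF W(3)]) (use N assms in auto)
  then have "Ck_family n (T \<inter> N) (U \<inter> Q) f"
    by (rule Ck_family_cong[rotated 2]) (use N assms W(4) in auto)
  then show "\<exists>N Q. open N \<and> t \<in> N \<and> open Q \<and> x \<in> Q \<and> Ck_family n (T \<inter> N) (U \<inter> Q) f"
    using N by (intro exI[of _ N] exI[of _ Q]) auto
qed

text \<open>On an open set a local extension coincides with \<open>f\<close> near the point. The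
  one-point time set \<open>{0}\<close> makes the locality lemma for families available; the
  following lemmas use a one-point time set in the same way.\<close>

lemma smooth_on_open_iff:
  assumes "open S"
  shows "smooth_on S f \<longleftrightarrow> (\<forall>n. Ck_on n S f)"
proof
  assume f: "smooth_on S f"
  show "\<forall>n. Ck_on n S f"
  proof
    fix n
    have "Ck_family n {0::real} S (\<lambda>_. f)"
    proof (rule Ck_family_local)
      fix t :: real and x assume "t \<in> {0}" "x \<in> S"
      then obtain U g where U: "open U" "x \<in> U" "\<And>n. Ck_on n U g" "\<And>y. y \<in> S \<inter> U \<Longrightarrow> g y = f y"
        using f unfolding smooth_on_def by metis
      have "Ck_family n ({0::real} \<inter> UNIV) (S \<inter> U) (\<lambda>_. g)"
        by (rule Ck_family_subset[OF Ck_family_static[OF U(3)]]) auto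
      then have "Ck_family n ({0::real} \<inter> UNIV) (S \<inter> U) (\<lambda>_. f)"
        by (rule Ck_family_cong[rotated 2]) (use U assms in auto)
      then show "\<exists>N U. open N \<and> t \<in> N \<and> open U \<and> x \<in> U \<and> Ck_family n ({0::real} \<inter> N) (S \<inter> U) (\<lambda>_. f)"
        using U by (intro exI[of _ UNIV] exI[of _ U]) auto
    qed
    then show "Ck_on n S f"
      by (rule Ck_family_imp_Ck_on) simp
  qed
next
  assume "\<forall>n. Ck_on n S f"
  then show "smooth_on S f" using assms unfolding smooth_on_def by blast
qed

lemma Ck_on_subset:
  "Ck_on n S f \<Longrightarrow> S' \<subseteq> S \<Longrightarrow> Ck_on n S' f"
  by (rule Ck_family_imp_Ck_on[OF Ck_family_subset[OF Ck_family_static[of n S f "{0::real}"], of "{0}"]]) auto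

lemma Ck_on_cong:
  assumes "open S" "\<And>x. x \<in> S \<Longrightarrow> f x = g x" "Ck_on n S f"
  shows "Ck_on n S g"
  by (rule Ck_family_imp_Ck_on[OF Ck_family_cong[OF assms(1) _ Ck_family_static[OF assms(3), of "{0::real}"]]])
    (use assms in auto)

lemma Ck_on_compose:
  fixes f :: "'a::real_normed_vector \<Rightarrow> 'b::euclidean_space"
  assumes "open S" "open U" "Ck_on n S f" "Ck_on n U g"
    and "f ` S \<subseteq> U"
  shows "Ck_on n S (\<lambda>x. g (f x))"
  by (rule Ck_family_imp_Ck_on[OF Ck_family_compose[OF assms(1,2)
          Ck_family_static[OF assms(3), of "{0::real}"] Ck_family_static[OF assms(4)]]])
    (use assms in auto)

lemma Ck_on_has_derivative:
  assumes "Ck_on (Suc n) S f" "x \<in> S"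
  shows "(f has_derivative fderiv f x) (at x)"
  using assms by (simp add: frechet_derivative_works[symmetric])

section \<open>Charts and tangent vectors\<close>

locale smooth_manifold =
  fixes \<A> :: "('m::{t2_space, second_countable_topology}, 'e::euclidean_space) chart set"
  assumes atlas: "smooth_atlas \<A>"
begin

abbreviation chart_img :: "('m, 'e) chart \<Rightarrow> 'e set" where
  "chart_img c \<equiv> snd c ` fst c"

abbreviation coord_map :: "('m, 'e) chart \<Rightarrow> ('m, 'e) chart \<Rightarrow> ('m \<Rightarrow> 'm) \<Rightarrow> 'e \<Rightarrow> 'e" where
  "coord_map c d F \<equiv> snd d \<circ> F \<circ> chart_inv c"

lemma ex_chart: "\<exists>c\<in>\<A>. x \<in> fst c"
  using atlas unfolding smooth_atlas_def by blast

lemma chart_at: "chart_at \<A> x \<in> \<A>" "x \<in> fst (chart_at \<A> x)"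
proof -
  have "\<exists>c. c \<in> \<A> \<and> x \<in> fst c" using ex_chart by blast
  from someI_ex[OF this] show "chart_at \<A> x \<in> \<A>" "x \<in> fst (chart_at \<A> x)"
    unfolding chart_at_def by auto
qed

lemma
  assumes "c \<in> \<A>"
  shows open_chart: "open (fst c)" and open_chart_img: "open (chart_img c)"
    and chart_homeomorphism: "homeomorphism (fst c) (chart_img c) (snd c) (chart_inv c)"
  using atlas assms unfolding smooth_atlas_def by blast+

lemma chart_continuous:
  assumes "c \<in> \<A>"
  shows "continuous_on (fst c) (snd c)" "continuous_on (chart_img c) (chart_inv c)"
  using chart_homeomorphism[OF assms] by (auto simp: homeomorphism_def)

lemma chart_inv_left: "c \<in> \<A> \<Longrightarrow> x \<in> fst c \<Longrightarrow> chart_inv c (snd c x) = x"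
  using chart_homeomorphism[of c] by (auto simp: homeomorphism_def)

lemma chart_inv_right: "c \<in> \<A> \<Longrightarrow> p \<in> chart_img c \<Longrightarrow> snd c (chart_inv c p) = p"
  using chart_homeomorphism[of c] by (auto simp: homeomorphism_def)

lemma chart_inv_mem: "c \<in> \<A> \<Longrightarrow> p \<in> chart_img c \<Longrightarrow> chart_inv c p \<in> fst c"
  using chart_inv_left[of c] by auto

lemma open_chart_preimage:
  assumes "c \<in> \<A>" "open W"
  shows "open {p \<in> chart_img c. chart_inv c p \<in> W}"
proof -
  have "{p \<in> chart_img c. chart_inv c p \<in> W} = chart_img c \<inter> chart_inv c -` W" by auto
  then show ?thesis
    using continuous_open_preimage[OF chart_continuous(2)[OF assms(1)] open_chart_img[OF assms(1)] assms(2)]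
    by simp
qed

lemma open_chart_vimage:
  assumes "c \<in> \<A>" "open N"
  shows "open {x \<in> fst c. snd c x \<in> N}"
proof -
  have "{x \<in> fst c. snd c x \<in> N} = fst c \<inter> snd c -` N" by auto
  then show ?thesis
    using continuous_open_preimage[OF chart_continuous(1)[OF assms(1)] open_chart[OF assms(1)] assms(2)]
    by simp
qed

lemma chart_image_Int:
  assumes "c \<in> \<A>"
  shows "snd c ` (fst c \<inter> W) = {p \<in> chart_img c. chart_inv c p \<in> W}"
  using chart_inv_left[OF assms] chart_inv_right[OF assms] chart_inv_mem[OF assms] by force

lemma transition_smooth:
  assumes "c \<in> \<A>" "d \<in> \<A>"
  shows "open (snd c ` (fst c \<inter> fst d))" "Ck_on n (snd c ` (fst c \<inter> fst d)) (snd d \<circ> chart_inv c)"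
proof -
  show o: "open (snd c ` (fst c \<inter> fst d))"
    unfolding chart_image_Int[OF assms(1)] by (rule open_chart_preimage[OF assms(1) open_chart[OF assms(2)]])
  have "smooth_on (snd c ` (fst c \<inter> fst d)) (snd d \<circ> chart_inv c)"
    using atlas assms unfolding smooth_atlas_def by blast
  then show "Ck_on n (snd c ` (fst c \<inter> fst d)) (snd d \<circ> chart_inv c)"
    using smooth_on_open_iff[OF o] by blast
qed

abbreviation trans_deriv :: "('m, 'e) chart \<Rightarrow> ('m, 'e) chart \<Rightarrow> 'm \<Rightarrow> 'e \<Rightarrow> 'e" where
  "trans_deriv c d x \<equiv> fderiv (snd d \<circ> chart_inv c) (snd c x)"

lemma transition_has_derivative:
  assumes "c \<in> \<A>" "d \<in> \<A>" "x \<in> fst c" "x \<in> fst d"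
  shows "((snd d \<circ> chart_inv c) has_derivative trans_deriv c d x) (at (snd c x))"
  by (rule Ck_on_has_derivative[OF transition_smooth(2)[OF assms(1,2), of "Suc 0"]]) (use assms in auto)

lemma chart_change_has_derivative:
  assumes "c \<in> \<A>" "d \<in> \<A>" "x \<in> fst c" "x \<in> fst d"
    and "((g \<circ> chart_inv d) has_derivative D) (at (snd d x))"
  shows "((g \<circ> chart_inv c) has_derivative (\<lambda>u. D (trans_deriv c d x u))) (at (snd c x))"
proof -
  have "((g \<circ> chart_inv d) has_derivative D) (at ((snd d \<circ> chart_inv c) (snd c x)))"
    using assms chart_inv_left by simp
  from diff_chain_at[OF transition_has_derivative[OF assms(1-4)] this]
  have "((g \<circ> chart_inv d) \<circ> (snd d \<circ> chart_inv c) has_derivative (\<lambda>u. D (trans_deriv c d x u))) (at (snd c x))"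
    by (simp add: o_def)
  then show ?thesis
  proof (rule has_derivative_transform_within_open[OF _ transition_smooth(1)[OF assms(1,2)]])
    show "snd c x \<in> snd c ` (fst c \<inter> fst d)" using assms by auto
    fix p assume "p \<in> snd c ` (fst c \<inter> fst d)"
    then show "((g \<circ> chart_inv d) \<circ> (snd d \<circ> chart_inv c)) p = (g \<circ> chart_inv c) p"
      using chart_inv_left[OF assms(1)] chart_inv_left[OF assms(2)] by auto
  qed
qed

lemma trans_deriv_compose:
  assumes "c \<in> \<A>" "d \<in> \<A>" "e \<in> \<A>" "x \<in> fst c" "x \<in> fst d" "x \<in> fst e"
  shows "trans_deriv c e x u = trans_deriv d e x (trans_deriv c d x u)"
  using frechet_derivative_at[OF chart_change_has_derivative[OF assms(1,2,4,5) transition_has_derivative[OF assms(2,3,5,6)]], symmetric]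
  by simp

lemma trans_deriv_self:
  assumes "c \<in> \<A>" "x \<in> fst c"
  shows "trans_deriv c c x u = u"
proof -
  have "((snd c \<circ> chart_inv c) has_derivative (\<lambda>u. u)) (at (snd c x))"
    by (rule has_derivative_transform_within_open[OF has_derivative_ident open_chart_img[OF assms(1)]])
      (use assms(2) chart_inv_right[OF assms(1)] in auto)
  from frechet_derivative_at[OF this, symmetric] show ?thesis by simp
qed

abbreviation toc :: "('m, 'e) chart \<Rightarrow> 'm \<Rightarrow> 'e \<Rightarrow> ('m, 'e) tvec" where
  "toc \<equiv> tangent_of_coords \<A>"

lemma toc_apply: "d \<in> \<A> \<Longrightarrow> x \<in> fst d \<Longrightarrow> toc c x u d = trans_deriv c d x u"
  by (simp add: tangent_of_coords_def)

lemma toc_self: "c \<in> \<A> \<Longrightarrow> x \<in> fst c \<Longrightarrow> toc c x u c = u"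
  by (simp add: toc_apply trans_deriv_self)

lemma toc_tangent:
  assumes "c \<in> \<A>" "x \<in> fst c"
  shows "toc c x u \<in> tangent_space \<A> x"
proof -
  have "toc c x u d = trans_deriv b d x (toc c x u b)"
    if "b \<in> \<A>" "d \<in> \<A>" "x \<in> fst b" "x \<in> fst d" for b d
    using trans_deriv_compose[OF assms(1) that(1,2) assms(2) that(3,4), of u] that
    by (simp only: toc_apply)
  moreover have "toc c x u d = 0" if "\<not> (d \<in> \<A> \<and> x \<in> fst d)" for d
    unfolding tangent_of_coords_def using that by (rule if_not_P)
  ultimately show ?thesis unfolding tangent_space_def by blast
qed

lemma tangent_eq_toc:
  assumes "v \<in> tangent_space \<A> x" "c \<in> \<A>" "x \<in> fst c"
  shows "v = toc c x (v c)"
proof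
  fix d
  show "v d = toc c x (v c) d"
  proof (cases "d \<in> \<A> \<and> x \<in> fst d")
    case True
    then have "v d = trans_deriv c d x (v c)"
      using assms unfolding tangent_space_def by blast
    then show ?thesis using toc_apply[of d x c "v c"] True by argo
  next
    case False
    then have "v d = 0" using assms(1) unfolding tangent_space_def by blast
    then show ?thesis unfolding tangent_of_coords_def if_not_P[OF False] .
  qed
qed

lemma tangent_transform:
  assumes "v \<in> tangent_space \<A> x" "c \<in> \<A>" "d \<in> \<A>" "x \<in> fst c" "x \<in> fst d"
  shows "v d = trans_deriv c d x (v c)"
  using assms unfolding tangent_space_def by blast

lemma toc_transition:
  assumes "c \<in> \<A>" "d \<in> \<A>" "x \<in> fst c" "x \<in> fst d"
  shows "toc d x (trans_deriv c d x u) = toc c x u"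
  using tangent_eq_toc[OF toc_tangent[OF assms(1,3)] assms(2,4), of u] toc_apply[OF assms(2,4)] by simp

lemma differential_fun_eq:
  assumes "c \<in> \<A>" "x \<in> fst c" "v \<in> tangent_space \<A> x" "((f \<circ> chart_inv c) has_derivative D) (at (snd c x))"
  shows "differential_fun \<A> f x v = D (v c)"
  using frechet_derivative_at[OF chart_change_has_derivative[OF chart_at(1) assms(1) chart_at(2) assms(2,4)], symmetric]
    tangent_transform[OF assms(3) chart_at(1) assms(1) chart_at(2) assms(2)]
  by (simp add: differential_fun_def Let_def)

text \<open>The definition uses the arbitrary chart \<open>chart_at\<close>; changes of chart in
  source and target show that any pair of charts computes the differential. The set \<open>N\<close>
  keeps \<open>F\<close> within the target chart near the point.\<close>

lemma differential_map_eq: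
  assumes "c \<in> \<A>" "d \<in> \<A>" "x \<in> fst c" "F x \<in> fst d" and v: "v \<in> tangent_space \<A> x"
    and D: "(coord_map c d F has_derivative D) (at (snd c x))"
    and N: "open N" "snd c x \<in> N" "N \<subseteq> chart_img c" "\<And>p. p \<in> N \<Longrightarrow> F (chart_inv c p) \<in> fst d"
  shows "differential_map \<A> F x v = toc d (F x) (D (v c))"
proof
  fix e
  show "differential_map \<A> F x v e = toc d (F x) (D (v c)) e"
  proof (cases "e \<in> \<A> \<and> F x \<in> fst e")
    case True
    then have e: "e \<in> \<A>" "F x \<in> fst e" by auto
    have "((snd e \<circ> chart_inv d) has_derivative trans_deriv d e (F x)) (at (coord_map c d F (snd c x)))"
      using transition_has_derivative[OF assms(2) e(1) assms(4) e(2)] assms chart_inv_left by simp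
    from diff_chain_at[OF D this]
    have "((snd e \<circ> chart_inv d) \<circ> (coord_map c d F) has_derivative (\<lambda>u. trans_deriv d e (F x) (D u))) (at (snd c x))"
      by (simp add: o_def)
    then have "(coord_map c e F has_derivative (\<lambda>u. trans_deriv d e (F x) (D u))) (at (snd c x))"
      by (rule has_derivative_transform_within_open[OF _ N(1,2)]) (use N chart_inv_left[OF assms(2)] in auto)
    from chart_change_has_derivative[OF chart_at(1) assms(1) chart_at(2) assms(3) this]
    have "fderiv (snd e \<circ> F \<circ> chart_inv (chart_at \<A> x)) (snd (chart_at \<A> x) x) =
        (\<lambda>u. trans_deriv d e (F x) (D (trans_deriv (chart_at \<A> x) c x u)))"
      by (rule frechet_derivative_at[symmetric])
    then show ?thesis
      using True tangent_transform[OF v chart_at(1) assms(1) chart_at(2) assms(3)]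
      by (simp add: differential_map_def Let_def tangent_of_coords_def)
  qed (auto simp: differential_map_def tangent_of_coords_def Let_def)
qed

end

section \<open>Symplectic forms in coordinates\<close>

locale symplectic = smooth_manifold \<A>
  for \<A> :: "('m::{t2_space, second_countable_topology}, 'e::euclidean_space) chart set" +
  fixes \<omega> :: "'m \<Rightarrow> ('m, 'e) tvec \<Rightarrow> ('m, 'e) tvec \<Rightarrow> real"
  assumes form: "two_form \<A> \<omega>" and closed: "closed_two_form \<A> \<omega>" and nondegenerate: "nondegenerate_two_form \<A> \<omega>"
begin

abbreviation Om :: "('m, 'e) chart \<Rightarrow> 'e \<Rightarrow> 'e \<Rightarrow> 'e \<Rightarrow> real" where
  "Om \<equiv> form_coords \<A> \<omega>"

lemma Om_bilinear:
  assumes "c \<in> \<A>" "p \<in> chart_img c"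
  shows "linear (Om c p u)" "linear (\<lambda>u. Om c p u w)" "Om c p u w = - Om c p w u"
proof -
  have b: "bilinear (Om c p)" and a: "\<And>u. Om c p u u = 0"
    using form assms unfolding two_form_def by blast+
  show l: "linear (Om c p u)" and r: "linear (\<lambda>u. Om c p u w)" using b by (auto simp: bilinear_def)
  show "Om c p u w = - Om c p w u"
    using a[of "u + w"] a[of u] a[of w] bilinear_ladd[OF b] bilinear_radd[OF b] by simp
qed

lemma Om_smooth:
  assumes "c \<in> \<A>"
  shows "Ck_on n (chart_img c) (\<lambda>p. Om c p u w)"
  using form assms smooth_on_open_iff[OF open_chart_img[OF assms]] unfolding two_form_def by blast

lemma Om_closed:
  assumes "c \<in> \<A>" "p \<in> chart_img c"
  shows "fderiv (\<lambda>q. Om c q v w) p u - fderiv (\<lambda>q. Om c q u w) p v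
    + fderiv (\<lambda>q. Om c q u v) p w = 0"
  using closed assms unfolding closed_two_form_def by blast

lemma Om_toc:
  assumes "c \<in> \<A>" "x \<in> fst c"
  shows "Om c (snd c x) u w = \<omega> x (toc c x u) (toc c x w)"
  by (simp add: form_coords_def Let_def chart_inv_left[OF assms])

lemma form_eq_Om:
  assumes "c \<in> \<A>" "x \<in> fst c" "v \<in> tangent_space \<A> x" "w \<in> tangent_space \<A> x"
  shows "\<omega> x v w = Om c (snd c x) (v c) (w c)"
  using tangent_eq_toc[OF assms(3,1,2)] tangent_eq_toc[OF assms(4,1,2)] Om_toc[OF assms(1,2)] by simp

lemma Om_nondegenerate:
  assumes "c \<in> \<A>" "x \<in> fst c" and u: "\<And>w. Om c (snd c x) u w = 0"
  shows "u = 0"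
proof -
  have "\<omega> x (toc c x u) w = 0" if "w \<in> tangent_space \<A> x" for w
    using form_eq_Om[OF assms(1,2) toc_tangent[OF assms(1,2)] that, of u] u toc_self[OF assms(1,2)] by simp
  then have "toc c x u = (\<lambda>_. 0)"
    using nondegenerate toc_tangent[OF assms(1,2), of u] unfolding nondegenerate_two_form_def by blast
  then show ?thesis using toc_self[OF assms(1,2), of u] by simp
qed

text \<open>The isomorphism v -> \<omega>(v, .) in coordinates, with covectors turned into vectors
  by the inner product. It casts the definition of a Hamiltonian vector field as a linear system on
  \<open>'e\<close>.\<close>

definition flat :: "('m, 'e) chart \<Rightarrow> 'e \<Rightarrow> 'e \<Rightarrow> 'e" where
  "flat c p u = (\<Sum>j\<in>Basis. Om c p u j *\<^sub>R j)"

lemma flat_linear: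
  assumes "c \<in> \<A>" "p \<in> chart_img c"
  shows "linear (flat c p)"
  unfolding flat_def
  by (rule linear_compose_sum, intro ballI linear_compose[OF Om_bilinear(2)[OF assms], unfolded o_def])
    (simp add: linear_iff scaleR_left_distrib)

lemma flat_inner: "j \<in> Basis \<Longrightarrow> flat c p u \<bullet> j = Om c p u j"
  by (simp add: flat_def)

lemma flat_eq_imp:
  assumes "c \<in> \<A>" "p \<in> chart_img c" "linear D" "flat c p u = (\<Sum>j\<in>Basis. D j *\<^sub>R j)"
  shows "Om c p u w = D w"
proof -
  have "Om c p u j = D j" if "j \<in> Basis" for j
    using flat_inner[OF that, of c p u] assms(4) that by simp
  then show ?thesis
    using linear_Basis_sum[OF Om_bilinear(1)[OF assms(1,2)], of u w] linear_Basis_sum[OF assms(3), of w] by simp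
qed

lemma flat_inj:
  assumes "c \<in> \<A>" "p \<in> chart_img c"
  shows "inj (flat c p)"
proof -
  have "u = 0" if "flat c p u = 0" for u
  proof (rule Om_nondegenerate[OF assms(1) chart_inv_mem[OF assms]])
    show "Om c (snd c (chart_inv c p)) u w = 0" for w
      unfolding chart_inv_right[OF assms]
      by (rule flat_eq_imp[OF assms, of "\<lambda>_. 0"]) (use that in \<open>auto simp: linear_iff\<close>)
  qed
  then show ?thesis using linear_injective_0[OF flat_linear[OF assms]] by blast
qed

text \<open>Nondegeneracy makes \<open>flat\<close> injective, hence bijective by dimension; this
  justifies the definite description and identifies its coordinates in every chart.\<close>

lemma ham_vector_field:
  assumes c: "c \<in> \<A>" "x \<in> fst c" and D: "((h \<circ> chart_inv c) has_derivative D) (at (snd c x))"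
  shows "ham_vector_field \<A> \<omega> h x \<in> tangent_space \<A> x"
    and "Om c (snd c x) (ham_vector_field \<A> \<omega> h x c) w = D w"
proof -
  have p: "snd c x \<in> chart_img c" using c by simp
  have linD: "linear D" using has_derivative_linear[OF D] .
  have "surj (flat c (snd c x))"
    using linear_injective_imp_surjective[OF flat_linear[OF c(1) p] flat_inj[OF c(1) p]] by simp
  then obtain u where u: "flat c (snd c x) u = (\<Sum>j\<in>Basis. D j *\<^sub>R j)" by (metis surjD)
  have Omu: "Om c (snd c x) u w = D w" for w by (rule flat_eq_imp[OF c(1) p linD u])
  have ex1: "\<exists>!v. v \<in> tangent_space \<A> x \<and> (\<forall>w\<in>tangent_space \<A> x. \<omega> x v w = differential_fun \<A> h x w)"
  proof (rule ex1I[of _ "toc c x u"])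
    show "toc c x u \<in> tangent_space \<A> x \<and> (\<forall>w\<in>tangent_space \<A> x. \<omega> x (toc c x u) w = differential_fun \<A> h x w)"
      using toc_tangent[OF c] form_eq_Om[OF c toc_tangent[OF c]] differential_fun_eq[OF c _ D] toc_self[OF c] Omu
      by simp
    fix v assume v: "v \<in> tangent_space \<A> x \<and> (\<forall>w\<in>tangent_space \<A> x. \<omega> x v w = differential_fun \<A> h x w)"
    have "v c - u = 0"
    proof (rule Om_nondegenerate[OF c])
      fix w
      have "Om c (snd c x) (v c) w = D w"
        using v toc_tangent[OF c, of w] form_eq_Om[OF c _ toc_tangent[OF c], of v w]
          differential_fun_eq[OF c toc_tangent[OF c, of w] D] toc_self[OF c, of w] by simp
      then show "Om c (snd c x) (v c - u) w = 0"
        using Omu[of w] linear_diff[OF Om_bilinear(2)[OF c(1) p], of "v c" u w] by simp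
    qed
    then show "v = toc c x u" using tangent_eq_toc[OF _ c, of v] v by simp
  qed
  from theI'[OF ex1]
  have T: "ham_vector_field \<A> \<omega> h x \<in> tangent_space \<A> x"
    and eq: "\<And>w. w \<in> tangent_space \<A> x \<Longrightarrow> \<omega> x (ham_vector_field \<A> \<omega> h x) w = differential_fun \<A> h x w"
    unfolding ham_vector_field_def by auto
  show "ham_vector_field \<A> \<omega> h x \<in> tangent_space \<A> x" by (rule T)
  show "Om c (snd c x) (ham_vector_field \<A> \<omega> h x c) w = D w"
    using eq[OF toc_tangent[OF c], of w] form_eq_Om[OF c T toc_tangent[OF c], of w]
      differential_fun_eq[OF c toc_tangent[OF c] D, of w] toc_self[OF c, of w] by simp
qed

section \<open>Smoothness of the Hamiltonian vector field\<close>

definition ham_coords :: "(real \<Rightarrow> 'm \<Rightarrow> real) \<Rightarrow> ('m, 'e) chart \<Rightarrow> real \<Rightarrow> 'e \<Rightarrow> 'e" where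
  "ham_coords H c t p = ham_vector_field \<A> \<omega> (H t) (chart_inv c p) c"

lemma smooth_fun_family_coords:
  assumes "smooth_fun_family \<A> T H" "c \<in> \<A>"
  shows "Ck_family n T (chart_img c) (\<lambda>t. H t \<circ> chart_inv c)"
proof (rule smooth_on_imp_Ck_family[OF open_chart_img[OF assms(2)]])
  show "smooth_on (T \<times> chart_img c) (\<lambda>z. (H (fst z) \<circ> chart_inv c) (snd z))"
    using assms unfolding smooth_fun_family_def by (simp add: case_prod_unfold)
qed

lemma ham_coords_eq:
  assumes H: "smooth_fun_family \<A> T H" and c: "c \<in> \<A>" "p \<in> chart_img c" "t \<in> T"
  shows "Om c p (ham_coords H c t p) w = fderiv (H t \<circ> chart_inv c) p w"
proof -
  have "((H t \<circ> chart_inv c) has_derivative fderiv (H t \<circ> chart_inv c) p) (at (snd c (chart_inv c p)))"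
    using Ck_familyD[OF smooth_fun_family_coords[OF H c(1)] c(3,2)] chart_inv_right[OF c(1,2)] by simp
  from ham_vector_field(2)[OF c(1) chart_inv_mem[OF c(1,2)] this] show ?thesis
    unfolding ham_coords_def chart_inv_right[OF c(1,2)] .
qed

lemma ham_coords_Ck_family:
  assumes H: "smooth_fun_family \<A> T H" and c: "c \<in> \<A>"
  shows "Ck_family n T (chart_img c) (ham_coords H c)"
proof (rule linear_system_Ck_family[where L="\<lambda>t. flat c" and b="\<lambda>t p. \<Sum>j\<in>Basis. fderiv (H t \<circ> chart_inv c) p j *\<^sub>R j"])
  note O = open_chart_img[OF c]
  show "open (chart_img c)" by (rule O)
  show "Ck_family n T (chart_img c) (\<lambda>t x. flat c x i)" for i
    unfolding flat_def
    by (intro Ck_family_sum[OF O] Ck_family_scaleR[OF O] Ck_family_const[OF O] Ck_family_static Om_smooth c)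
  show "Ck_family n T (chart_img c) (\<lambda>t p. \<Sum>j\<in>Basis. fderiv (H t \<circ> chart_inv c) p j *\<^sub>R j)"
    by (intro Ck_family_sum[OF O] Ck_family_scaleR[OF O] Ck_family_const[OF O]
        Ck_family_derivative[OF smooth_fun_family_coords[OF H c]])
  show "flat c p (ham_coords H c t p) = (\<Sum>j\<in>Basis. fderiv (H t \<circ> chart_inv c) p j *\<^sub>R j)"
    if "t \<in> T" "p \<in> chart_img c" for t p
    unfolding flat_def ham_coords_eq[OF H c that(2,1)] ..
qed (use flat_linear[OF c] flat_inj[OF c] in auto)

text \<open>A local notion, so that a flow can be composed from short pieces each lying in one
  chart. Invariance of the form is required in coordinates on a whole neighbourhood, which also
  carries the smoothness.\<close>

definition sympl_at :: "('m, 'e) chart \<Rightarrow> ('m, 'e) chart \<Rightarrow> ('m \<Rightarrow> 'm) \<Rightarrow> 'm \<Rightarrow> bool" where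
  "sympl_at c d F x \<longleftrightarrow> (\<exists>N. open N \<and> snd c x \<in> N \<and> N \<subseteq> chart_img c \<and> (\<forall>p\<in>N. F (chart_inv c p) \<in> fst d) \<and>
     (\<forall>n. Ck_on n N (coord_map c d F)) \<and>
     (\<forall>p\<in>N. \<forall>u w. Om d (coord_map c d F p)
        (fderiv (coord_map c d F) p u)
        (fderiv (coord_map c d F) p w) = Om c p u w))"

lemma sympl_at_compose:
  assumes d: "d \<in> \<A>" and c: "c \<in> \<A>" "x \<in> fst c"
    and F: "sympl_at c d F x" and G: "sympl_at d e G (F x)"
  shows "sympl_at c e (G \<circ> F) x"
proof -
  define f where "f = coord_map c d F"
  define g where "g = coord_map d e G"
  obtain N where N: "open N" "snd c x \<in> N" "N \<subseteq> chart_img c" "\<And>p. p \<in> N \<Longrightarrow> F (chart_inv c p) \<in> fst d"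
    "\<And>n. Ck_on n N f"
    "\<And>p u w. p \<in> N \<Longrightarrow> Om d (f p) (fderiv f p u) (fderiv f p w) = Om c p u w"
    using F unfolding sympl_at_def f_def by metis
  obtain Q where Q: "open Q" "snd d (F x) \<in> Q" "Q \<subseteq> chart_img d" "\<And>p. p \<in> Q \<Longrightarrow> G (chart_inv d p) \<in> fst e"
    "\<And>n. Ck_on n Q g"
    "\<And>p u w. p \<in> Q \<Longrightarrow> Om e (g p) (fderiv g p u) (fderiv g p w) = Om d p u w"
    using G unfolding sympl_at_def g_def by metis
  define N' where "N' = N \<inter> f -` Q"
  have oN': "open N'"
    unfolding N'_def
    by (rule continuous_open_preimage[OF Ck_on_continuous[OF N(5)] N(1) Q(1)])
  have fi: "chart_inv d (f p) = F (chart_inv c p)" if "p \<in> N'" for p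
    using N(4) that chart_inv_left[OF d] by (simp add: f_def N'_def)
  have eq: "(coord_map c e (G \<circ> F)) p = g (f p)" if "p \<in> N'" for p
    using fi[OF that] by (simp add: g_def)
  have smooth: "Ck_on n N' (\<lambda>p. g (f p))" for n
    by (rule Ck_on_compose[OF oN' Q(1) Ck_on_subset[OF N(5)] Q(5)]) (auto simp: N'_def)
  have D: "fderiv (coord_map c e (G \<circ> F)) p u = fderiv g (f p) (fderiv f p u)"
    if p: "p \<in> N'" for p u
  proof -
    have "(f has_derivative fderiv f p) (at p)"
      using Ck_on_has_derivative[OF N(5)] p by (simp add: N'_def)
    moreover have "(g has_derivative fderiv g (f p)) (at (f p))"
      using Ck_on_has_derivative[OF Q(5)] p by (simp add: N'_def)
    ultimately have "((\<lambda>p. g (f p)) has_derivative (\<lambda>u. fderiv g (f p) (fderiv f p u))) (at p)"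
      by (rule has_derivative_compose)
    then have "(coord_map c e (G \<circ> F) has_derivative (\<lambda>u. fderiv g (f p) (fderiv f p u))) (at p)"
      by (rule has_derivative_transform_within_open[OF _ oN' p]) (rule eq[symmetric])
    from frechet_derivative_at[OF this, symmetric] show ?thesis by simp
  qed
  show ?thesis unfolding sympl_at_def
  proof (intro exI[of _ N'] conjI ballI allI)
    show "open N'" by (rule oN')
    show "snd c x \<in> N'" using N(2) Q(2) chart_inv_left[OF c] by (simp add: N'_def f_def)
    show "N' \<subseteq> chart_img c" using N(3) by (auto simp: N'_def)
    show "(G \<circ> F) (chart_inv c p) \<in> fst e" if "p \<in> N'" for p
      using Q(4)[of "f p"] fi[OF that] that by (simp add: N'_def)
    show "Ck_on n N' (coord_map c e (G \<circ> F))" for n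
      by (rule Ck_on_cong[OF oN' _ smooth]) (rule eq[symmetric])
    show "Om e (coord_map c e (G \<circ> F) p) (fderiv (coord_map c e (G \<circ> F)) p u)
        (fderiv (coord_map c e (G \<circ> F)) p w) = Om c p u w" if p: "p \<in> N'" for p u w
      unfolding D[OF p] eq[OF p] using Q(6)[of "f p"] N(6)[of p] p by (simp add: N'_def)
  qed
qed

lemma sympl_at_id:
  assumes "c \<in> \<A>" "d \<in> \<A>" "x \<in> fst c" "x \<in> fst d"
  shows "sympl_at c d id x"
  unfolding sympl_at_def
proof (intro exI[of _ "snd c ` (fst c \<inter> fst d)"] conjI ballI allI)
  show "open (snd c ` (fst c \<inter> fst d))" by (rule transition_smooth(1)[OF assms(1,2)])
  show "Ck_on n (snd c ` (fst c \<inter> fst d)) (coord_map c d id)" for n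
    using transition_smooth(2)[OF assms(1,2)] by simp
  show "id (chart_inv c p) \<in> fst d" if "p \<in> snd c ` (fst c \<inter> fst d)" for p
    using that chart_inv_left[OF assms(1)] by auto
  fix p u w assume "p \<in> snd c ` (fst c \<inter> fst d)"
  then obtain y where y: "p = snd c y" "y \<in> fst c" "y \<in> fst d" by auto
  show "Om d (coord_map c d id p) (fderiv (coord_map c d id) p u)
      (fderiv (coord_map c d id) p w) = Om c p u w"
    using y Om_toc[OF assms(1) y(2)] Om_toc[OF assms(2) y(3)] chart_inv_left[OF assms(1) y(2)]
      toc_transition[OF assms(1,2) y(2,3)] by simp
qed (use assms in auto)

text \<open>A change of chart is the coordinate expression of \<open>id\<close>, so composing with
  \<open>id\<close> on both sides replaces the charts.\<close>

lemma sympl_at_charts: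
  assumes "sympl_at c d F x" "c \<in> \<A>" "d \<in> \<A>" "x \<in> fst c" "F x \<in> fst d"
    and "c' \<in> \<A>" "d' \<in> \<A>" "x \<in> fst c'" "F x \<in> fst d'"
  shows "sympl_at c' d' F x"
proof -
  have "sympl_at c' d (F \<circ> id) x"
    by (rule sympl_at_compose[OF assms(2,6,8) sympl_at_id[OF assms(6,2,8,4)]]) (use assms in simp)
  then have "sympl_at c' d' (id \<circ> (F \<circ> id)) x"
    by (rule sympl_at_compose[OF assms(3,6,8)]) (use sympl_at_id[OF assms(3,7,5,9)] in simp)
  then show ?thesis by simp
qed

lemma symplectomorphism_sympl_at:
  assumes F: "symplectomorphism \<A> \<omega> F" and c: "c \<in> \<A>" "d \<in> \<A>" "x \<in> fst c" "F x \<in> fst d"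
  shows "sympl_at c d F x"
proof -
  define N where "N = snd c ` (fst c \<inter> F -` fst d)"
  have sm: "smooth_map \<A> F" using F unfolding symplectomorphism_def by blast
  have cont: "continuous_on UNIV F" using sm unfolding smooth_map_def by blast
  have "open (F -` fst d)" using open_vimage[OF open_chart[OF c(2)] cont] .
  then have oN: "open N"
    unfolding N_def chart_image_Int[OF c(1)] by (rule open_chart_preimage[OF c(1)])
  have N: "N \<subseteq> chart_img c" "\<And>p. p \<in> N \<Longrightarrow> F (chart_inv c p) \<in> fst d"
    using chart_inv_left[OF c(1)] by (auto simp: N_def)
  have smooth: "Ck_on n N (coord_map c d F)" for n
    using sm c smooth_on_open_iff[OF oN] unfolding smooth_map_def N_def by blast
  show ?thesis unfolding sympl_at_def
  proof (intro exI[of _ N] conjI ballI allI)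
    fix p u w assume p: "p \<in> N"
    define y where "y = chart_inv c p"
    have y: "y \<in> fst c" "snd c y = p" "F y \<in> fst d"
      using p N(1) chart_inv_mem[OF c(1)] chart_inv_right[OF c(1)] N(2)[OF p] by (auto simp: y_def)
    define D where "D = fderiv (coord_map c d F) p"
    have D: "(coord_map c d F has_derivative D) (at (snd c y))"
      unfolding D_def y(2) by (rule Ck_on_has_derivative[OF smooth p])
    have dm: "differential_map \<A> F y (toc c y u) = toc d (F y) (D u)" for u
      using differential_map_eq[OF c(1,2) y(1,3) toc_tangent[OF c(1) y(1)] D oN _ N] p y(2) toc_self[OF c(1) y(1)] by simp
    have "\<omega> (F y) (toc d (F y) (D u)) (toc d (F y) (D w)) = \<omega> y (toc c y u) (toc c y w)"
      using F toc_tangent[OF c(1) y(1)] unfolding symplectomorphism_def dm[symmetric] by blast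
    then show "Om d (coord_map c d F p) (fderiv (coord_map c d F) p u)
       (fderiv (coord_map c d F) p w) = Om c p u w"
      using Om_toc[OF c(1) y(1)] Om_toc[OF c(2) y(3)] y by (simp add: D_def y_def)
  qed (use oN N smooth c in \<open>auto simp: N_def\<close>)
qed

lemma sympl_at_continuous:
  assumes "sympl_at c d F x" "c \<in> \<A>" "d \<in> \<A>" "x \<in> fst c"
  shows "\<exists>W. open W \<and> x \<in> W \<and> continuous_on W F"
proof -
  obtain N where N: "open N" "snd c x \<in> N" "N \<subseteq> chart_img c" "\<And>p. p \<in> N \<Longrightarrow> F (chart_inv c p) \<in> fst d"
    "\<And>n. Ck_on n N (coord_map c d F)"
    using assms(1) unfolding sympl_at_def by metis
  define W where "W = {y \<in> fst c. snd c y \<in> N}"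
  have W: "open W" unfolding W_def by (rule open_chart_vimage[OF assms(2) N(1)])
  have 1: "continuous_on W (snd c)" by (rule continuous_on_subset[OF chart_continuous(1)[OF assms(2)]]) (auto simp: W_def)
  have 2: "continuous_on W (\<lambda>y. (coord_map c d F) (snd c y))"
    by (rule continuous_on_compose2[OF Ck_on_continuous[OF N(5)] 1]) (auto simp: W_def)
  have "continuous_on W (\<lambda>y. chart_inv d (coord_map c d F (snd c y)))"
    by (rule continuous_on_compose2[OF chart_continuous(2)[OF assms(3)] 2]) (use N in \<open>auto simp: W_def\<close>)
  then have "continuous_on W F"
  proof (rule continuous_on_eq)
    fix y assume "y \<in> W"
    then have "y \<in> fst c" "F (chart_inv c (snd c y)) \<in> fst d" using N(4) by (auto simp: W_def)
    then show "chart_inv d (coord_map c d F (snd c y)) = F y"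
      using chart_inv_left[OF assms(2)] chart_inv_left[OF assms(3)] by simp
  qed
  then show ?thesis using W N(2) assms(4) by (intro exI[of _ W]) (auto simp: W_def)
qed

definition symplectic_at :: "('m \<Rightarrow> 'm) \<Rightarrow> 'm \<Rightarrow> bool" where
  "symplectic_at F x \<longleftrightarrow> (\<exists>c\<in>\<A>. \<exists>d\<in>\<A>. x \<in> fst c \<and> F x \<in> fst d \<and> sympl_at c d F x)"

lemma symplectic_at_charts:
  assumes "symplectic_at F x" "c \<in> \<A>" "d \<in> \<A>" "x \<in> fst c" "F x \<in> fst d"
  shows "sympl_at c d F x"
  using assms sympl_at_charts unfolding symplectic_at_def by metis

lemma symplectic_at_compose:
  assumes "symplectic_at F x" "symplectic_at G (F x)"
  shows "symplectic_at (G \<circ> F) x"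
proof -
  obtain c d e where c: "c \<in> \<A>" "d \<in> \<A>" "e \<in> \<A>" "x \<in> fst c" "F x \<in> fst d" "G (F x) \<in> fst e"
    using ex_chart by meson
  have "sympl_at c e (G \<circ> F) x"
    by (rule sympl_at_compose[OF c(2,1,4) symplectic_at_charts[OF assms(1) c(1,2,4,5)]
          symplectic_at_charts[OF assms(2) c(2,3,5,6)]])
  then show ?thesis using c unfolding symplectic_at_def by auto
qed

lemma symplectic_at_id: "symplectic_at id x"
  using sympl_at_id ex_chart unfolding symplectic_at_def by fastforce

definition locally_symplectic :: "('m \<Rightarrow> 'm) \<Rightarrow> bool" where
  "locally_symplectic F \<longleftrightarrow> (\<forall>x. symplectic_at F x)"

lemma locally_symplectic_charts:
  assumes "locally_symplectic F" "c \<in> \<A>" "d \<in> \<A>" "x \<in> fst c" "F x \<in> fst d"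
  shows "sympl_at c d F x"
  using assms symplectic_at_charts unfolding locally_symplectic_def by blast

lemma locally_symplectic_smooth_map:
  assumes "locally_symplectic F"
  shows "smooth_map \<A> F"
  unfolding smooth_map_def
proof (intro conjI ballI)
  show "continuous_on UNIV F"
  proof (rule continuous_on_local)
    show "\<exists>W. open W \<and> z \<in> W \<and> continuous_on (UNIV \<inter> W) F" for z
      using assms sympl_at_continuous unfolding locally_symplectic_def symplectic_at_def by simp metis
  qed
  fix c d assume c: "c \<in> \<A>" "d \<in> \<A>"
  show "smooth_on (snd c ` (fst c \<inter> F -` fst d)) (coord_map c d F)"
    unfolding smooth_on_def
  proof
    fix p assume "p \<in> snd c ` (fst c \<inter> F -` fst d)"
    then obtain x where x: "x \<in> fst c" "F x \<in> fst d" "p = snd c x" by auto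
    have "sympl_at c d F x" by (rule locally_symplectic_charts[OF assms c x(1,2)])
    then obtain N where "open N" "p \<in> N" "\<And>n. Ck_on n N (coord_map c d F)"
      unfolding sympl_at_def x(3) by metis
    then show "\<exists>U g. open U \<and> p \<in> U \<and> (\<forall>n. Ck_on n U g) \<and>
        (\<forall>y\<in>snd c ` (fst c \<inter> F -` fst d) \<inter> U. g y = (coord_map c d F) y)" by blast
  qed
qed

lemma symplectomorphismI:
  assumes "bij F" "locally_symplectic F" "locally_symplectic (inv F)"
  shows "symplectomorphism \<A> \<omega> F"
  unfolding symplectomorphism_def
proof (intro conjI allI ballI)
  fix x v w assume v: "v \<in> tangent_space \<A> x" and w: "w \<in> tangent_space \<A> x"
  obtain c d where c: "c \<in> \<A>" "d \<in> \<A>" "x \<in> fst c" "F x \<in> fst d"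
    using ex_chart by meson
  have "sympl_at c d F x" by (rule locally_symplectic_charts[OF assms(2) c])
  then obtain N where N: "open N" "snd c x \<in> N" "N \<subseteq> chart_img c" "\<And>p. p \<in> N \<Longrightarrow> F (chart_inv c p) \<in> fst d"
    "\<And>n. Ck_on n N (coord_map c d F)"
    and Nom: "\<And>p u w. p \<in> N \<Longrightarrow> Om d (coord_map c d F p) (fderiv (coord_map c d F) p u)
      (fderiv (coord_map c d F) p w) = Om c p u w"
    unfolding sympl_at_def by metis
  note D = Ck_on_has_derivative[OF N(5) N(2)]
  have dm: "differential_map \<A> F x v = toc d (F x) (fderiv (coord_map c d F) (snd c x) (v c))"
    if "v \<in> tangent_space \<A> x" for v
    by (rule differential_map_eq[OF c that D N(1-4)])
  show "\<omega> (F x) (differential_map \<A> F x v) (differential_map \<A> F x w) = \<omega> x v w"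
    unfolding dm[OF v] dm[OF w] Om_toc[OF c(2,4), symmetric] form_eq_Om[OF c(1,3) v w]
    using Nom[OF N(2), of "v c" "w c"] chart_inv_left[OF c(1,3)] by simp
qed (use assms locally_symplectic_smooth_map in auto)

lemma symplectomorphismD:
  assumes "symplectomorphism \<A> \<omega> F" shows "locally_symplectic F"
  unfolding locally_symplectic_def symplectic_at_def
  using symplectomorphism_sympl_at[OF assms] ex_chart by meson

end

section \<open>Hamiltonian flows\<close>

lemma smooth_on_subset:
  assumes "smooth_on S f" "S' \<subseteq> S" shows "smooth_on S' f"
  unfolding smooth_on_def
proof
  fix x assume "x \<in> S'"
  then have "x \<in> S" using assms(2) by blast
  from bspec[OF assms(1)[unfolded smooth_on_def] this]
  obtain U g where "open U" "x \<in> U" "\<forall>n. Ck_on n U g" "\<forall>y\<in>S \<inter> U. g y = f y"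
    by (elim exE conjE)
  then show "\<exists>U g. open U \<and> x \<in> U \<and> (\<forall>n. Ck_on n U g) \<and> (\<forall>y\<in>S' \<inter> U. g y = f y)"
    using assms(2) by (intro exI[of _ U] exI[of _ g]) auto
qed

lemma has_velocity_subset: "has_velocity \<A> \<gamma> v s I \<Longrightarrow> J \<subseteq> I \<Longrightarrow> has_velocity \<A> \<gamma> v s J"
  unfolding has_velocity_def by (meson has_vector_derivative_within_subset)

lemma eventually_at_within_nhds:
  "(\<forall>\<^sub>F t in nhds \<tau>. t \<in> S \<longrightarrow> Q t) \<Longrightarrow> \<forall>\<^sub>F t in at \<tau> within S. Q t"
  unfolding eventually_at_filter by (erule eventually_mono) simp

context symplectic
begin

section \<open>The form evaluated on moving vectors at a moving point\<close>

lemma Om_Basis_sum: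
  assumes "c \<in> \<A>" "p \<in> chart_img c"
  shows "Om c p a b = (\<Sum>i\<in>Basis. \<Sum>j\<in>Basis. (a \<bullet> i) * ((b \<bullet> j) * Om c p i j))"
proof -
  have "Om c p a b = (\<Sum>i\<in>Basis. (a \<bullet> i) *\<^sub>R Om c p i b)"
    by (rule linear_Basis_sum[OF Om_bilinear(2)[OF assms]])
  also have "\<dots> = (\<Sum>i\<in>Basis. (a \<bullet> i) *\<^sub>R (\<Sum>j\<in>Basis. (b \<bullet> j) *\<^sub>R Om c p i j))"
    using linear_Basis_sum[OF Om_bilinear(1)[OF assms], of _ b] by simp
  finally show ?thesis by (simp add: sum_distrib_left)
qed

lemma Om_deriv:
  assumes "c \<in> \<A>" "p \<in> chart_img c"
  shows "((\<lambda>q. Om c q a b) has_derivative fderiv (\<lambda>q. Om c q a b) p) (at p)"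
  by (rule Ck_on_has_derivative[OF Om_smooth[OF assms(1)] assms(2)])

lemma Om_deriv_Basis_sum:
  assumes "c \<in> \<A>" "p \<in> chart_img c"
  shows "fderiv (\<lambda>q. Om c q a b) p v =
    (\<Sum>i\<in>Basis. \<Sum>j\<in>Basis. (a \<bullet> i) * ((b \<bullet> j) * fderiv (\<lambda>q. Om c q i j) p v))"
proof -
  have "((\<lambda>q. \<Sum>i\<in>Basis. \<Sum>j\<in>Basis. (a \<bullet> i) * ((b \<bullet> j) * Om c q i j)) has_derivative
      (\<lambda>v. \<Sum>i\<in>Basis. \<Sum>j\<in>Basis. (a \<bullet> i) * ((b \<bullet> j) * fderiv (\<lambda>q. Om c q i j) p v))) (at p)"
    by (intro has_derivative_sum has_derivative_mult_right Om_deriv assms)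
  then have "((\<lambda>q. Om c q a b) has_derivative
      (\<lambda>v. \<Sum>i\<in>Basis. \<Sum>j\<in>Basis. (a \<bullet> i) * ((b \<bullet> j) * fderiv (\<lambda>q. Om c q i j) p v))) (at p)"
    by (rule has_derivative_transform_within_open[OF _ open_chart_img[OF assms(1)] assms(2)])
      (simp add: Om_Basis_sum[OF assms(1), of _ a b])
  from frechet_derivative_at[OF this, symmetric] show ?thesis by simp
qed

text \<open>Smoothness of the form is known only for its coefficients on fixed vectors, hence the
  product rule is applied to the double expansion over \<open>Basis\<close>. The derivative is taken
  within \<open>S\<close> to allow closed time intervals.\<close>

lemma Om_has_derivative:
  fixes y a b :: "'z::real_normed_vector \<Rightarrow> 'e"
  assumes c: "c \<in> \<A>" and y: "\<And>z. z \<in> S \<Longrightarrow> y z \<in> chart_img c" and z: "z \<in> S"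
    and y': "(y has_derivative y') (at z within S)" and a': "(a has_derivative a') (at z within S)"
    and b': "(b has_derivative b') (at z within S)"
  shows "((\<lambda>z. Om c (y z) (a z) (b z)) has_derivative (\<lambda>h. fderiv (\<lambda>q. Om c q (a z) (b z)) (y z) (y' h)
    + Om c (y z) (a' h) (b z) + Om c (y z) (a z) (b' h))) (at z within S)"
proof -
  note p = y[OF z]
  have coeff: "((\<lambda>z. Om c (y z) i j) has_derivative (\<lambda>h. fderiv (\<lambda>q. Om c q i j) (y z) (y' h))) (at z within S)" for i j
    by (rule has_derivative_compose[OF y' Om_deriv[OF c p]])
  let ?D = "\<lambda>h. \<Sum>i\<in>Basis. \<Sum>j\<in>Basis. (a z \<bullet> i) * ((b z \<bullet> j) * fderiv (\<lambda>q. Om c q i j) (y z) (y' h) +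
      (b' h \<bullet> j) * Om c (y z) i j) + (a' h \<bullet> i) * ((b z \<bullet> j) * Om c (y z) i j)"
  have "((\<lambda>z. \<Sum>i\<in>Basis. \<Sum>j\<in>Basis. (a z \<bullet> i) * ((b z \<bullet> j) * Om c (y z) i j)) has_derivative ?D) (at z within S)"
    by (intro has_derivative_sum has_derivative_mult coeff has_derivative_inner_left a' b')
  also have "?D = (\<lambda>h. fderiv (\<lambda>q. Om c q (a z) (b z)) (y z) (y' h) + Om c (y z) (a' h) (b z) + Om c (y z) (a z) (b' h))"
    unfolding Om_deriv_Basis_sum[OF c p, of "a z" "b z"] Om_Basis_sum[OF c p, of "a' _" "b z"] Om_Basis_sum[OF c p, of "a z" "b' _"]
    by (simp add: sum.distrib distrib_left add_ac)
  finally show ?thesis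
    by (rule has_derivative_transform[OF z, rotated]) (simp add: Om_Basis_sum[OF c y, of _ "a _" "b _"])
qed

end

locale ham_isotopy = symplectic \<A> \<omega>
  for \<A> :: "('m::{t2_space, second_countable_topology}, 'e::euclidean_space) chart set"
    and \<omega> :: "'m \<Rightarrow> ('m, 'e) tvec \<Rightarrow> ('m, 'e) tvec \<Rightarrow> real" +
  fixes H :: "real \<Rightarrow> 'm \<Rightarrow> real"
  assumes H: "H \<in> ham_functions \<A> \<omega> UNIV"
begin

abbreviation XH :: "real \<Rightarrow> 'm \<Rightarrow> ('m, 'e) tvec" where
  "XH t \<equiv> ham_vector_field \<A> \<omega> (H t)"

abbreviation V :: "('m, 'e) chart \<Rightarrow> real \<Rightarrow> 'e \<Rightarrow> 'e" where
  "V \<equiv> ham_coords H"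

abbreviation DV :: "('m, 'e) chart \<Rightarrow> real \<Rightarrow> 'e \<Rightarrow> 'e \<Rightarrow> 'e" where
  "DV c t p \<equiv> fderiv (V c t) p"

abbreviation \<Phi> :: "real \<Rightarrow> 'm \<Rightarrow> 'm" where
  "\<Phi> \<equiv> ham_flow \<A> \<omega> H"

lemma H_smooth: "smooth_fun_family \<A> {0..1} H"
  using H by (simp add: ham_functions_def)

lemma V_Ck: "c \<in> \<A> \<Longrightarrow> Ck_family n {0..1} (chart_img c) (V c)"
  by (rule ham_coords_Ck_family[OF H_smooth])

lemma V_has_derivative:
  assumes "c \<in> \<A>" "t \<in> {0..1}" "p \<in> chart_img c"
  shows "(V c t has_derivative DV c t p) (at p)"
  by (rule Ck_familyD[OF V_Ck[OF assms(1)] assms(2,3)])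

text \<open>The infinitesimal form of the invariance of the symplectic form under the flow: differentiating
  the defining equation of the Hamiltonian vector field, the second derivatives of \<open>H\<close> cancel by
  symmetry and what is left is the exterior derivative of the form.\<close>

lemma Lie_derivative_zero:
  assumes c: "c \<in> \<A>" "p \<in> chart_img c" and t: "t \<in> {0..1}"
  shows "fderiv (\<lambda>q. Om c q a b) p (V c t p) + Om c p (DV c t p a) b + Om c p a (DV c t p b) = 0"
proof -
  define dH where "dH w q = fderiv (H t \<circ> chart_inv c) q w" for w q
  have lin: "Om c p (DV c t p v) w = fderiv (dH w) p v - fderiv (\<lambda>q. Om c q (V c t p) w) p v" for v w
  proof -
    note O = open_chart_img[OF c(1)]
    have VO: "(V c t has_derivative DV c t p) (at p within chart_img c)"
      by (rule has_derivative_at_withinI[OF V_has_derivative[OF c(1) t c(2)]])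
    have "((\<lambda>q. Om c q (V c t q) w) has_derivative (\<lambda>h. fderiv (\<lambda>q. Om c q (V c t p) w) p h
        + Om c p (DV c t p h) w + Om c p (V c t p) 0)) (at p within chart_img c)"
      by (rule Om_has_derivative[OF c(1) _ c(2) has_derivative_ident VO has_derivative_const])
    then have "((\<lambda>q. Om c q (V c t q) w) has_derivative (\<lambda>h. fderiv (\<lambda>q. Om c q (V c t p) w) p h
        + Om c p (DV c t p h) w)) (at p)"
      using at_within_open[OF c(2) O] linear_0[OF Om_bilinear(1)[OF c]] by simp
    then have "(dH w has_derivative (\<lambda>h. fderiv (\<lambda>q. Om c q (V c t p) w) p h
        + Om c p (DV c t p h) w)) (at p)"
      by (rule has_derivative_transform_within_open[OF _ O c(2)])
        (simp add: ham_coords_eq[OF H_smooth c(1) _ t] dH_def)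
    from frechet_derivative_at[OF this, symmetric] show ?thesis by simp
  qed
  have "fderiv (dH a) p b = fderiv (dH b) p a"
    unfolding dH_def[abs_def]
    by (rule second_derivative_symmetric[OF open_chart_img[OF c(1)] c(2)
          Ck_family_imp_Ck_on[OF smooth_fun_family_coords[OF H_smooth c(1)] t]])
  then show ?thesis
    using lin[of a b] lin[of b a] Om_bilinear(3)[OF c, of a "DV c t p b"] Om_closed[OF c, of a b "V c t p"] by simp
qed

text \<open>Solutions on arbitrary subintervals of [0,1] without a distinguished initial time,
  whereas \<open>solves_ode\<close> starts at 0. Continuity is enough, since regularity is derived
  separately.\<close>

definition sol :: "real \<Rightarrow> real \<Rightarrow> (real \<Rightarrow> 'm) \<Rightarrow> bool" where
  "sol a b \<gamma> \<longleftrightarrow> 0 \<le> a \<and> b \<le> 1 \<and> continuous_on {a..b} \<gamma> \<and>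
     (\<forall>\<tau>\<in>{a..b}. has_velocity \<A> \<gamma> (XH \<tau> (\<gamma> \<tau>)) \<tau> {a..b})"

lemma sol_subset: "sol a b \<gamma> \<Longrightarrow> a \<le> a' \<Longrightarrow> b' \<le> b \<Longrightarrow> sol a' b' \<gamma>"
  unfolding sol_def
  by (auto elim!: continuous_on_subset intro!: has_velocity_subset[of \<A> \<gamma> _ _ "{a..b}" "{a'..b'}"])

lemma sol_coords:
  assumes "sol a b \<gamma>" "c \<in> \<A>" "\<tau> \<in> {a..b}" "\<gamma> \<tau> \<in> fst c"
  shows "((snd c \<circ> \<gamma>) has_vector_derivative V c \<tau> (snd c (\<gamma> \<tau>))) (at \<tau> within {a..b})"
  using assms chart_inv_left[OF assms(2,4)] unfolding sol_def has_velocity_def ham_coords_def by auto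

text \<open>Compactness of the product of [0,1] with a closed ball gives the constants that decide
  how short a time step must be.\<close>

lemma chart_bounds:
  assumes c: "c \<in> \<A>" "p \<in> chart_img c"
  shows "\<exists>R>0. \<exists>K\<ge>0. \<exists>M\<ge>0. cball p R \<subseteq> chart_img c \<and>
    (\<forall>t\<in>{0..1}. \<forall>q\<in>cball p R. norm (V c t q) \<le> M \<and> (\<forall>v. norm (DV c t q v) \<le> K * norm v))"
proof -
  obtain R where R: "R > 0" "cball p R \<subseteq> chart_img c"
    using open_contains_cball[of "chart_img c"] open_chart_img[OF c(1)] c(2) by blast
  let ?S = "{0..1::real} \<times> cball p R"
  have cS: "compact ?S" by (intro compact_Times) auto
  have sub: "?S \<subseteq> {0..1} \<times> chart_img c" using R by auto
  have bound: "\<exists>B. \<forall>z\<in>?S. norm (f z) \<le> B" if "continuous_on ({0..1} \<times> chart_img c) f" for f :: "real \<times> 'e \<Rightarrow> 'e"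
    using compact_imp_bounded[OF compact_continuous_image[OF continuous_on_subset[OF that sub] cS]]
    unfolding bounded_iff by auto
  obtain M where M: "\<And>z. z \<in> ?S \<Longrightarrow> norm (V c (fst z) (snd z)) \<le> M"
    using bound[OF Ck_family_continuous[OF V_Ck[OF c(1)]]] by blast
  have "\<exists>B. \<forall>z\<in>?S. norm (DV c (fst z) (snd z) i) \<le> B" for i
    using bound[OF Ck_family_continuous[OF Ck_family_derivative[OF V_Ck[OF c(1)]]]] by blast
  then obtain B where B: "\<And>i z. z \<in> ?S \<Longrightarrow> norm (DV c (fst z) (snd z) i) \<le> B i" by metis
  define K where "K = real DIM('e) * (\<Sum>i\<in>(Basis::'e set). \<bar>B i\<bar>)"
  have K: "K \<ge> 0" by (simp add: K_def sum_nonneg)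
  have "norm (DV c t q v) \<le> K * norm v" if t: "t \<in> {0..1}" and q: "q \<in> cball p R" for t q v
    unfolding K_def
  proof (rule linear_norm_le_Basis)
    show "linear (DV c t q)"
      by (rule has_derivative_linear[OF V_has_derivative[OF c(1) t]]) (use q R in auto)
    fix i :: 'e assume "i \<in> Basis"
    then have "\<bar>B i\<bar> \<le> (\<Sum>i\<in>(Basis::'e set). \<bar>B i\<bar>)" by (intro member_le_sum) auto
    then show "norm (DV c t q i) \<le> (\<Sum>i\<in>(Basis::'e set). \<bar>B i\<bar>)" using B[of "(t, q)" i] t q by simp
  qed
  moreover have "norm (V c t q) \<le> \<bar>M\<bar>" if "t \<in> {0..1}" "q \<in> cball p R" for t q
    using M[of "(t, q)"] that by simp
  ultimately show ?thesis
    using R K by (intro exI[of _ R] exI[of _ K] exI[of _ "\<bar>M\<bar>"] conjI) auto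
qed

lemma V_lipschitz:
  assumes c: "c \<in> \<A>" and R: "cball p R \<subseteq> chart_img c"
    "\<And>q v. q \<in> cball p R \<Longrightarrow> norm (DV c t q v) \<le> K * norm v" and t: "t \<in> {0..1}"
    and q: "q \<in> cball p R" "q' \<in> cball p R"
  shows "norm (V c t q - V c t q') \<le> K * norm (q - q')"
  by (rule differentiable_bound[OF convex_cball has_derivative_at_withinI[OF V_has_derivative[OF c t]]])
    (use R q in \<open>auto intro!: onorm_le\<close>)

text \<open>The truth value of \<open>\<gamma> \<tau> = \<gamma>' \<tau>\<close> is locally constant
  on the connected time interval: distinct values stay distinct by the Hausdorff property, equal
  values stay equal by Gronwall in a chart.\<close>

lemma sol_unique:
  assumes sol: "sol a b \<gamma>" "sol a b \<gamma>'" and s: "s \<in> {a..b}" "\<gamma> s = \<gamma>' s" and t: "t \<in> {a..b}"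
  shows "\<gamma> t = \<gamma>' t"
proof -
  have cont: "continuous_on {a..b} \<gamma>" "continuous_on {a..b} \<gamma>'" using sol by (auto simp: sol_def)
  have ab: "0 \<le> a" "b \<le> 1" using sol by (auto simp: sol_def)
  have "(\<gamma> s = \<gamma>' s) = (\<gamma> t = \<gamma>' t)"
  proof (rule connected_local_const[OF connected_Icc s(1) t], intro ballI eventually_at_within_nhds)
    fix \<tau> assume \<tau>: "\<tau> \<in> {a..b}"
    show "\<forall>\<^sub>F t in nhds \<tau>. t \<in> {a..b} \<longrightarrow> (\<gamma> \<tau> = \<gamma>' \<tau>) = (\<gamma> t = \<gamma>' t)"
    proof (cases "\<gamma> \<tau> = \<gamma>' \<tau>")
      case False
      then obtain W W' where W: "open W" "open W'" "\<gamma> \<tau> \<in> W" "\<gamma>' \<tau> \<in> W'" "W \<inter> W' = {}"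
        using hausdorff by metis
      have "\<forall>\<^sub>F t in nhds \<tau>. t \<in> {a..b} \<longrightarrow> \<gamma> t \<in> W" "\<forall>\<^sub>F t in nhds \<tau>. t \<in> {a..b} \<longrightarrow> \<gamma>' t \<in> W'"
        by (rule eventually_nhds_image[OF _ \<tau>]; use cont W in simp)+
      then show ?thesis by eventually_elim (use False W(5) in auto)
    next
      case True
      obtain c where c: "c \<in> \<A>" "\<gamma> \<tau> \<in> fst c" using ex_chart by blast
      obtain R K M where R: "R > 0" "K \<ge> 0" "cball (snd c (\<gamma> \<tau>)) R \<subseteq> chart_img c"
        "\<And>t q v. t \<in> {0..1} \<Longrightarrow> q \<in> cball (snd c (\<gamma> \<tau>)) R \<Longrightarrow> norm (DV c t q v) \<le> K * norm v"
        using chart_bounds[OF c(1), of "snd c (\<gamma> \<tau>)"] c(2) by blast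
      define W where "W = {y \<in> fst c. snd c y \<in> ball (snd c (\<gamma> \<tau>)) R}"
      have W: "open W" "\<gamma> \<tau> \<in> W"
        unfolding W_def using open_chart_vimage[OF c(1) open_ball] c R by auto
      have "\<forall>\<^sub>F t in nhds \<tau>. t \<in> {a..b} \<longrightarrow> \<gamma> t \<in> W" "\<forall>\<^sub>F t in nhds \<tau>. t \<in> {a..b} \<longrightarrow> \<gamma>' t \<in> W"
        by (rule eventually_nhds_image[OF _ \<tau>]; use cont W True in simp)+
      then have "\<forall>\<^sub>F t in nhds \<tau>. t \<in> {a..b} \<longrightarrow> \<gamma> t \<in> W \<and> \<gamma>' t \<in> W" by eventually_elim auto
      then obtain e where e: "e > 0" "\<And>t. dist t \<tau> < e \<Longrightarrow> t \<in> {a..b} \<Longrightarrow> \<gamma> t \<in> W \<and> \<gamma>' t \<in> W"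
        unfolding eventually_nhds_metric by auto
      have "\<gamma> t = \<gamma>' t" if t: "t \<in> {a..b}" "dist t \<tau> < e" for t
      proof -
        define a' b' where "a' = min t \<tau>" and "b' = max t \<tau>"
        have ab': "a \<le> a'" "b' \<le> b" "t \<in> {a'..b'}" "\<tau> \<in> {a'..b'}" using t \<tau> by (auto simp: a'_def b'_def)
        have inW: "\<gamma> r \<in> W \<and> \<gamma>' r \<in> W" if "r \<in> {a'..b'}" for r
          using that t \<tau> by (intro e(2)) (auto simp: a'_def b'_def dist_real_def min_def max_def split: if_splits)
        have sol': "sol a' b' \<gamma>" "sol a' b' \<gamma>'" using sol_subset[OF _ ab'(1,2)] sol by auto
        have "norm (snd c (\<gamma> t) - snd c (\<gamma>' t)) \<le> exp ((2 * K + 1) * (b' - a')) * (norm (snd c (\<gamma> \<tau>) - snd c (\<gamma>' \<tau>)) + 0)"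
        proof (rule gronwall[OF _ _ R(2) order_refl ab'(4,3)])
          fix r assume r: "r \<in> {a'..b'}"
          have rc: "\<gamma> r \<in> fst c" "\<gamma>' r \<in> fst c" using inW[OF r] by (auto simp: W_def)
          show "((\<lambda>t. snd c (\<gamma> t) - snd c (\<gamma>' t)) has_vector_derivative V c r (snd c (\<gamma> r)) - V c r (snd c (\<gamma>' r))) (at r within {a'..b'})"
            using has_vector_derivative_diff[OF sol_coords[OF sol'(1) c(1) r rc(1)] sol_coords[OF sol'(2) c(1) r rc(2)]]
            by (simp add: o_def)
          have r01: "r \<in> {0..1}" using r ab ab' by auto
          show "norm (V c r (snd c (\<gamma> r)) - V c r (snd c (\<gamma>' r))) \<le> K * norm (snd c (\<gamma> r) - snd c (\<gamma>' r)) + 0"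
            using V_lipschitz[OF c(1) R(3) R(4)[OF r01] r01, of "snd c (\<gamma> r)" "snd c (\<gamma>' r)"] inW[OF r] by (simp add: W_def)
        qed
        then have "snd c (\<gamma> t) = snd c (\<gamma>' t)" using True by simp
        moreover have "\<gamma> t \<in> fst c" "\<gamma>' t \<in> fst c" using inW[OF ab'(3)] by (auto simp: W_def)
        ultimately show ?thesis using chart_inv_left[OF c(1)] by metis
      qed
      then show ?thesis unfolding eventually_nhds_metric using e(1) True by auto
    qed
  qed
  then show ?thesis using s(2) by simp
qed

lemma sol_cong:
  assumes "sol a b \<gamma>" "\<And>t. t \<in> {a..b} \<Longrightarrow> \<gamma> t = \<gamma>' t"
  shows "sol a b \<gamma>'"
  unfolding sol_def has_velocity_def
proof (intro conjI ballI impI)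
  show "continuous_on {a..b} \<gamma>'" using assms continuous_on_eq[of "{a..b}" \<gamma> \<gamma>'] by (simp add: sol_def)
  fix \<tau> c assume \<tau>: "\<tau> \<in> {a..b}" and c: "c \<in> \<A>" "\<gamma>' \<tau> \<in> fst c"
  have "((snd c \<circ> \<gamma>) has_vector_derivative XH \<tau> (\<gamma> \<tau>) c) (at \<tau> within {a..b})"
    using assms \<tau> c unfolding sol_def has_velocity_def by metis
  then show "((snd c \<circ> \<gamma>') has_vector_derivative XH \<tau> (\<gamma>' \<tau>) c) (at \<tau> within {a..b})"
    unfolding assms(2)[OF \<tau>, symmetric]
    by (rule has_vector_derivative_transform[OF \<tau>, rotated]) (use assms(2) in simp)
qed (use assms in \<open>auto simp: sol_def\<close>)

lemma solves_ode_subset: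
  assumes "solves_ode \<A> W 1 x \<gamma>" "t \<le> 1"
  shows "solves_ode \<A> W t x \<gamma>"
  unfolding solves_ode_def smooth_curve_def
proof (intro conjI ballI)
  have sub: "{0..t} \<subseteq> {0..1}" using assms(2) by auto
  show "continuous_on {0..t} \<gamma>"
    using assms(1) continuous_on_subset[OF _ sub] unfolding solves_ode_def smooth_curve_def by blast
  show "\<gamma> 0 = x" using assms(1) unfolding solves_ode_def by blast
  show "smooth_on {s \<in> {0..t}. \<gamma> s \<in> fst c} (snd c \<circ> \<gamma>)" if "c \<in> \<A>" for c
    by (rule smooth_on_subset[of "{s \<in> {0..1}. \<gamma> s \<in> fst c}"])
      (use assms(1) that sub in \<open>auto simp: solves_ode_def smooth_curve_def\<close>)
  show "has_velocity \<A> \<gamma> (W s (\<gamma> s)) s {0..t}" if "s \<in> {0..t}" for s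
    using assms(1) that sub has_velocity_subset[OF _ sub] unfolding solves_ode_def by blast
qed

lemma solves_ode_sol:
  assumes "solves_ode \<A> XH t x \<gamma>" "t \<le> 1"
  shows "sol 0 t \<gamma>" "\<gamma> 0 = x"
  using assms unfolding solves_ode_def smooth_curve_def sol_def by auto

text \<open>The flow picks for each \<open>t\<close> the endpoint of a solution on [0,t]. By
  uniqueness these are all restrictions of the single solution on [0,1] that compatibility
  provides.\<close>

lemma flow_sol: "sol 0 1 (\<lambda>t. \<Phi> t x)" and flow_0: "\<Phi> 0 x = x"
proof -
  have "x \<in> flow_domain \<A> XH 1" using H unfolding ham_functions_def compatible_def by blast
  then obtain \<gamma> where \<gamma>: "solves_ode \<A> XH 1 x \<gamma>" unfolding flow_domain_def by blast
  have eq: "\<Phi> t x = \<gamma> t" if t: "t \<in> {0..1}" for t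
    unfolding ham_flow_def flow_def
  proof (rule the_equality)
    show "\<exists>\<gamma>'. solves_ode \<A> XH t x \<gamma>' \<and> \<gamma> t = \<gamma>' t"
      using solves_ode_subset[OF \<gamma>] t by auto
    fix y assume "\<exists>\<gamma>'. solves_ode \<A> XH t x \<gamma>' \<and> y = \<gamma>' t"
    then obtain \<gamma>' where \<gamma>': "solves_ode \<A> XH t x \<gamma>'" "y = \<gamma>' t" by blast
    show "y = \<gamma> t"
      unfolding \<gamma>'(2)
      by (rule sol_unique[OF solves_ode_sol(1)[OF \<gamma>'(1)] solves_ode_sol(1)[OF solves_ode_subset[OF \<gamma>]], of 0])
        (use t solves_ode_sol(2)[OF \<gamma>'(1)] solves_ode_sol(2)[OF \<gamma>] in auto)
  qed
  show "sol 0 1 (\<lambda>t. \<Phi> t x)"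
    by (rule sol_cong[OF solves_ode_sol(1)[OF \<gamma>]]) (use eq in auto)
  show "\<Phi> 0 x = x" using eq[of 0] solves_ode_sol(2)[OF \<gamma>] by simp
qed

text \<open>Surjectivity is part of compatibility with the whole manifold, and injectivity is
  uniqueness run backwards in time.\<close>

lemma flow_bij:
  assumes "t \<in> {0..1}" shows "bij (\<Phi> t)"
proof (rule bijI)
  show "inj (\<Phi> t)"
  proof (rule injI)
    fix x y assume "\<Phi> t x = \<Phi> t y"
    from sol_unique[OF flow_sol flow_sol assms this, of 0] show "x = y" by (simp add: flow_0)
  qed
  show "surj (\<Phi> t)" using H assms unfolding ham_functions_def compatible_def ham_flow_def by auto
qed

text \<open>The evolution from time \<open>s\<close> to time \<open>t\<close>. Solutions are given
  only from time 0, so it goes back to time 0 through the inverse of the bijection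
  \<open>\<Phi> s\<close>.\<close>

definition evol :: "real \<Rightarrow> real \<Rightarrow> 'm \<Rightarrow> 'm" where
  "evol s t m = \<Phi> t (inv (\<Phi> s) m)"

lemma evol_sol: "sol 0 1 (\<lambda>t. evol s t m)"
  unfolding evol_def by (rule flow_sol)

lemma evol_self: "s \<in> {0..1} \<Longrightarrow> evol s s m = m"
  unfolding evol_def using flow_bij[of s] by (simp add: bij_is_surj surj_f_inv_f)

lemma evol_flow: "s \<in> {0..1} \<Longrightarrow> evol s t \<circ> \<Phi> s = \<Phi> t"
  unfolding evol_def using flow_bij[of s] by (auto simp: bij_is_inj)

lemma inv_flow_evol: "s \<in> {0..1} \<Longrightarrow> inv (\<Phi> s) \<circ> evol t s = inv (\<Phi> t)"
  unfolding evol_def using flow_bij[of s] by (auto simp: bij_is_inj)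

end

section \<open>Invariance of the form, first for short times and then for the whole flow\<close>

context ham_isotopy
begin

text \<open>A continuity argument, since coordinates mean nothing once the curve leaves the chart.
  As long as it stays in the compact set \<open>D\<close>, its speed is at most \<open>M\<close>, so
  it moves less than \<open>R / 2\<close> and lies in the open set \<open>D0\<close>. As
  \<open>D\<close> is closed in the Hausdorff space and contains \<open>D0\<close>, the property
  \<open>Q\<close> is locally constant in time.\<close>

lemma sol_stays_in_ball:
  assumes c: "c \<in> \<A>" and R: "cball p R \<subseteq> chart_img c"
    and M: "\<And>t q. t \<in> {0..1} \<Longrightarrow> q \<in> cball p R \<Longrightarrow> norm (V c t q) \<le> M" "M * (b - a) < R / 2"
    and sol: "sol a b \<gamma>" and s: "s \<in> {a..b}" "\<gamma> s \<in> fst c" "dist p (snd c (\<gamma> s)) < R / 2"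
    and t: "t \<in> {a..b}"
  shows "\<gamma> t \<in> fst c \<and> snd c (\<gamma> t) \<in> ball p R"
proof -
  define D where "D = chart_inv c ` cball p R"
  define D0 where "D0 = {y \<in> fst c. snd c y \<in> ball p R}"
  have ab: "0 \<le> a" "b \<le> 1" and cont: "continuous_on {a..b} \<gamma>" using sol by (auto simp: sol_def)
  have M0: "M \<ge> 0" if "R \<ge> 0"
    using order_trans[OF norm_ge_zero M(1)[of a p]] that ab s(1) by simp
  have R0: "R > 0" using s(3) zero_le_dist[of p "snd c (\<gamma> s)"] by linarith
  have "compact D" unfolding D_def
    by (intro compact_continuous_image continuous_on_subset[OF chart_continuous(2)[OF c] R] compact_cball)
  then have closedD: "closed D" by (rule compact_imp_closed)
  have openD0: "open D0" unfolding D0_def by (rule open_chart_vimage[OF c open_ball])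
  have D_iff: "y \<in> D \<longleftrightarrow> y \<in> fst c \<and> snd c y \<in> cball p R" for y
    using chart_inv_left[OF c] chart_inv_right[OF c] chart_inv_mem[OF c] R unfolding D_def
    by (auto simp: image_iff; force)
  have D0D: "D0 \<subseteq> D" by (auto simp: D_iff D0_def)
  have sD0: "\<gamma> s \<in> D0" using s R0 by (auto simp: D0_def)
  define Q where "Q t \<longleftrightarrow> (\<forall>\<tau>\<in>{min s t..max s t}. \<gamma> \<tau> \<in> D)" for t
  have Q_imp: "\<gamma> t \<in> D0" if "Q t" "t \<in> {a..b}" for t
  proof -
    define a' b' where "a' = min s t" and "b' = max s t"
    have ab': "a \<le> a'" "b' \<le> b" "s \<in> {a'..b'}" "t \<in> {a'..b'}" using s that by (auto simp: a'_def b'_def)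
    have inD: "\<gamma> \<tau> \<in> fst c \<and> snd c (\<gamma> \<tau>) \<in> cball p R" if "\<tau> \<in> {a'..b'}" for \<tau>
      using \<open>Q t\<close> that unfolding Q_def a'_def b'_def D_iff by blast
    have sol': "sol a' b' \<gamma>" using sol_subset[OF sol ab'(1,2)] .
    have "norm ((snd c \<circ> \<gamma>) t - (snd c \<circ> \<gamma>) s) \<le> M * \<bar>t - s\<bar>"
      by (rule vector_derivative_bound[OF sol_coords[OF sol' c] _ ab'(3,4)])
        (use inD M(1) ab ab' in auto)
    also have "\<dots> \<le> M * (b - a)" using M0 R0 s that by (intro mult_left_mono) auto
    finally have "dist (snd c (\<gamma> s)) (snd c (\<gamma> t)) < R / 2" using M(2) by (simp add: dist_norm norm_minus_commute)
    then have "dist p (snd c (\<gamma> t)) < R"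
      using s(3) dist_triangle[of p "snd c (\<gamma> t)" "snd c (\<gamma> s)"] by simp
    then show ?thesis using inD[OF ab'(4)] by (simp add: D0_def)
  qed
  have "Q s = Q t"
  proof (rule connected_local_const[OF connected_Icc s(1) t], intro ballI eventually_at_within_nhds)
    fix \<tau> assume \<tau>: "\<tau> \<in> {a..b}"
    show "\<forall>\<^sub>F t in nhds \<tau>. t \<in> {a..b} \<longrightarrow> Q \<tau> = Q t"
    proof (cases "Q \<tau>")
      case True
      have "\<forall>\<^sub>F t in nhds \<tau>. t \<in> {a..b} \<longrightarrow> \<gamma> t \<in> D0"
        by (rule eventually_nhds_image[OF cont \<tau> openD0 Q_imp[OF True \<tau>]])
      then obtain e where e: "e > 0" "\<And>t. dist t \<tau> < e \<Longrightarrow> t \<in> {a..b} \<Longrightarrow> \<gamma> t \<in> D0"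
        unfolding eventually_nhds_metric by auto
      have "Q t" if t: "t \<in> {a..b}" "dist t \<tau> < e" for t
        unfolding Q_def
      proof
        fix r assume r: "r \<in> {min s t..max s t}"
        show "\<gamma> r \<in> D"
        proof (cases "r \<in> {min s \<tau>..max s \<tau>}")
          case True
          then show ?thesis using \<open>Q \<tau>\<close> by (auto simp: Q_def)
        next
          case False
          then have "dist r \<tau> < e" using r t(2) by (auto simp: dist_real_def min_def max_def split: if_splits)
          moreover have "r \<in> {a..b}" using r t(1) s(1) by auto
          ultimately show ?thesis using e(2) D0D by blast
        qed
      qed
      then show ?thesis using True e(1) unfolding eventually_nhds_metric by auto
    next
      case False
      then obtain r where r: "r \<in> {min s \<tau>..max s \<tau>}" "\<gamma> r \<notin> D" by (auto simp: Q_def)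
      have "\<forall>\<^sub>F t in nhds \<tau>. t \<in> {a..b} \<longrightarrow> \<not> Q t"
      proof (cases "r = \<tau>")
        case True
        have "\<forall>\<^sub>F t in nhds \<tau>. t \<in> {a..b} \<longrightarrow> \<gamma> t \<in> - D"
          by (rule eventually_nhds_image[OF cont \<tau>]) (use closedD r True in auto)
        then show ?thesis by eventually_elim (auto simp: Q_def)
      next
        case False
        have "r \<in> {min s t..max s t}" if "dist t \<tau> < dist r \<tau>" for t
          using that r(1) False by (auto simp: dist_real_def min_def max_def split: if_splits)
        then show ?thesis using False r(2) unfolding eventually_nhds_metric
          by (intro exI[of _ "dist r \<tau>"]) (auto simp: Q_def)
      qed
      then show ?thesis by eventually_elim (use False in simp)
    qed
  qed
  moreover have "Q s" using sD0 D0D by (auto simp: Q_def)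
  ultimately show ?thesis using Q_imp[OF _ t] by (simp add: D0_def)
qed

text \<open>The radius \<open>e\<close> and the set \<open>W\<close> are the same for all pairs
  \<open>s\<close>, \<open>t\<close>, in either order, which permits steps forward and backward in
  time.\<close>

lemma evol_symplectic:
  assumes \<tau>: "\<tau> \<in> {0..1}"
  shows "\<exists>e>0. \<exists>W. open W \<and> m \<in> W \<and> (\<forall>s\<in>{0..1}. \<forall>t\<in>{0..1}. \<forall>y\<in>W.
    \<bar>s - \<tau>\<bar> < e \<longrightarrow> \<bar>t - \<tau>\<bar> < e \<longrightarrow> symplectic_at (evol s t) y)"
proof -
  obtain c where c: "c \<in> \<A>" "m \<in> fst c" using ex_chart by blast
  define p where "p = snd c m"
  obtain R K M where R: "R > 0" "cball p R \<subseteq> chart_img c" and K: "K \<ge> 0" and M: "M \<ge> 0"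
    and bounds: "\<And>t q. t \<in> {0..1} \<Longrightarrow> q \<in> cball p R \<Longrightarrow> norm (V c t q) \<le> M"
      "\<And>t q v. t \<in> {0..1} \<Longrightarrow> q \<in> cball p R \<Longrightarrow> norm (DV c t q v) \<le> K * norm v"
    using chart_bounds[OF c(1), of p] c(2) unfolding p_def by blast
  \<comment> \<open>Over a time span of at most \<open>2 * e\<close>, the first bound ensures
    \<open>K * (b - a) \<le> 1 / 2\<close>, and the second that a curve starting within
    \<open>R / 2\<close> of \<open>p\<close> stays within \<open>R\<close>. The summands 1 avoid
    division by zero.\<close>
  define e where "e = min (1 / (4 * (K + 1))) (R / (8 * (M + 1)))"
  have e: "e > 0" using R K M by (simp add: e_def)
  have Ke: "K * (2 * e) \<le> 1 / 2"
  proof -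
    have "e \<le> 1 / (4 * (K + 1))" by (simp add: e_def)
    then have "e * (4 * (K + 1)) \<le> 1" using K by (simp add: pos_le_divide_eq)
    then show ?thesis using e by (simp add: algebra_simps)
  qed
  have Me: "M * (2 * e) < R / 2"
  proof -
    have "e \<le> R / (8 * (M + 1))" by (simp add: e_def)
    then have "e * (8 * (M + 1)) \<le> R" using M by (simp add: pos_le_divide_eq)
    moreover have "M * (2 * e) \<ge> 0" using M e by simp
    ultimately show ?thesis using R e by (simp add: algebra_simps)
  qed
  define a b where "a = max 0 (\<tau> - e)" and "b = min 1 (\<tau> + e)"
  have ab: "{a..b} \<subseteq> {0..1}" "b - a \<le> 2 * e" "0 \<le> a" "b \<le> 1" using \<tau> e by (auto simp: a_def b_def)
  have "K * (b - a) \<le> K * (2 * e)" "M * (b - a) \<le> M * (2 * e)" using ab K M by (auto intro!: mult_left_mono)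
  then have Kab: "K * (b - a) \<le> 1 / 2" and Mab: "M * (b - a) < R / 2" using Ke Me by linarith+
  define P where "P = ball p (R / 2)"
  define U where "U = ball p R"
  have PU: "open P" "open U" "convex U" "P \<subseteq> U" "U \<subseteq> cball p R" using R by (auto simp: P_def U_def)
  define W where "W = {y \<in> fst c. snd c y \<in> P}"
  have W: "open W" "m \<in> W"
    unfolding W_def using open_chart_vimage[OF c(1) PU(1)] c R by (auto simp: P_def p_def)
  have "sympl_at c c (evol s t) x \<and> evol s t x \<in> fst c" if s: "s \<in> {a..b}" and t: "t \<in> {a..b}" and x: "x \<in> W" for s t x
  proof -
    define y where "y t q = snd c (evol s t (chart_inv c q))" for t q
    have s01: "s \<in> {0..1}" using s ab by auto
    have sol: "sol a b (\<lambda>t. evol s t z)" for z by (rule sol_subset[OF evol_sol ab(3,4)])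
    have q: "chart_inv c q \<in> fst c" "snd c (chart_inv c q) = q" "q \<in> chart_img c" if "q \<in> P" for q
    proof -
      show "q \<in> chart_img c" using that PU R(2) by blast
      then show "chart_inv c q \<in> fst c" "snd c (chart_inv c q) = q"
        using chart_inv_mem[OF c(1)] chart_inv_right[OF c(1)] by auto
    qed
    have stay: "evol s t (chart_inv c q) \<in> fst c \<and> y t q \<in> U" if "t \<in> {a..b}" "q \<in> P" for t q
      unfolding y_def U_def
      by (rule sol_stays_in_ball[OF c(1) R(2) bounds(1) Mab sol s _ _ that(1)])
        (use q[OF that(2)] that(2) evol_self[OF s01] in \<open>auto simp: P_def\<close>)
    have ys: "y s q = q" if "q \<in> P" for q using q[OF that] evol_self[OF s01] by (simp add: y_def)
    have ode: "((\<lambda>t. y t q) has_vector_derivative V c t (y t q)) (at t within {a..b})" if "t \<in> {a..b}" "q \<in> P" for t q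
      using sol_coords[OF sol c(1) that(1), of "chart_inv c q"] stay[OF that] by (simp add: y_def o_def)
    have VU: "Ck_family n {a..b} U (V c)" for n
      by (rule Ck_family_subset[OF V_Ck[OF c(1)]]) (use ab PU R in auto)
    have KU: "norm (DV c t q v) \<le> K * norm v" if "t \<in> {a..b}" "q \<in> U" for t q v
      using bounds(2) that ab PU by blast
    have yU: "\<And>t q. t \<in> {a..b} \<Longrightarrow> q \<in> P \<Longrightarrow> y t q \<in> U" using stay by blast
    have yC: "Ck_family n {a..b} P y" for n
      by (rule flow_Ck_family(1)[OF PU(1-3) s VU KU Kab K yU ys ode])
    have yD: "((\<lambda>t. fderiv (y t) q v) has_vector_derivative
        DV c t (y t q) (fderiv (y t) q v)) (at t within {a..b})" if "t \<in> {a..b}" "q \<in> P" for t q v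
      by (rule flow_Ck_family(2)[OF PU(1-3) s VU KU Kab K yU ys ode that])
    have yeq: "coord_map c c (evol s t) = y t" for t by (auto simp: y_def)
    have inv: "Om c (y t q) (fderiv (y t) q u) (fderiv (y t) q w) = Om c q u w"
      if q: "q \<in> P" for q u w
    proof -
      define A where "A u t = fderiv (y t) q u" for u t
      define g where "g t = Om c (y t q) (A u t) (A w t)" for t
      have yO: "y t q \<in> chart_img c" if "t \<in> {a..b}" for t using stay[OF that q] PU R by auto
      have A': "((A u) has_derivative (\<lambda>h. h *\<^sub>R DV c t (y t q) (A u t))) (at t within {a..b})" if "t \<in> {a..b}" for t u
        using yD[OF that q, of u] unfolding A_def[abs_def] has_vector_derivative_def .
      \<comment> \<open>Both transported vectors solve the linearised equation, so the derivative of
        \<open>g\<close> is the vanishing expression of \<open>Lie_derivative_zero\<close> scaled by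
        \<open>h\<close>.\<close>
      have g': "(g has_derivative (\<lambda>h. 0)) (at t within {a..b})" if t: "t \<in> {a..b}" for t
      proof -
        have t01: "t \<in> {0..1}" using t ab by auto
        have "(g has_derivative (\<lambda>h. fderiv (\<lambda>q. Om c q (A u t) (A w t)) (y t q) (h *\<^sub>R V c t (y t q))
           + Om c (y t q) (h *\<^sub>R DV c t (y t q) (A u t)) (A w t) + Om c (y t q) (A u t) (h *\<^sub>R DV c t (y t q) (A w t)))) (at t within {a..b})"
          unfolding g_def[abs_def]
          by (rule Om_has_derivative[OF c(1) yO t ode[OF t q, unfolded has_vector_derivative_def] A'[OF t] A'[OF t]])
        moreover have "fderiv (\<lambda>q. Om c q (A u t) (A w t)) (y t q) (h *\<^sub>R V c t (y t q))
           + Om c (y t q) (h *\<^sub>R DV c t (y t q) (A u t)) (A w t) + Om c (y t q) (A u t) (h *\<^sub>R DV c t (y t q) (A w t)) = 0" for h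
          using Lie_derivative_zero[OF c(1) yO[OF t] t01, of "A u t" "A w t"]
            linear_scale[OF has_derivative_linear[OF Om_deriv[OF c(1) yO[OF t]]]]
            linear_scale[OF Om_bilinear(1)[OF c(1) yO[OF t]]] linear_scale[OF Om_bilinear(2)[OF c(1) yO[OF t]]]
          by (simp add: distrib_left[symmetric])
        ultimately show ?thesis by simp
      qed
      have "norm (g t - g s) \<le> 0 * norm (t - s)"
        by (rule differentiable_bound[of "{a..b}" g "\<lambda>_ h. 0"]) (use g' s t in \<open>auto simp: onorm_zero\<close>)
      then have "g t = g s" by simp
      moreover have "A u s = u" for u
      proof -
        have "(y s has_derivative (\<lambda>v. v)) (at q)"
          by (rule has_derivative_transform_within_open[OF has_derivative_ident PU(1) q]) (simp add: ys)
        from frechet_derivative_at[OF this, symmetric] show ?thesis by (simp add: A_def)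
      qed
      ultimately show ?thesis using ys[OF q] by (simp add: g_def A_def)
    qed
    have "sympl_at c c (evol s t) x"
      unfolding sympl_at_def yeq
    proof (intro exI[of _ P] conjI ballI allI)
      show "P \<subseteq> chart_img c" using q by blast
      show "snd c x \<in> P" using x by (simp add: W_def)
      show "Ck_on n P (y t)" for n by (rule Ck_family_imp_Ck_on[OF yC t])
      show "evol s t (chart_inv c q) \<in> fst c" if "q \<in> P" for q using stay[OF t that] by blast
    qed (use PU inv in auto)
    moreover have "evol s t x \<in> fst c"
      using stay[OF t, of "snd c x"] x chart_inv_left[OF c(1), of x] by (simp add: W_def)
    ultimately show ?thesis by blast
  qed
  note this[THEN conjunct1] this[THEN conjunct2]
  then have "symplectic_at (evol s t) x" if "s \<in> {a..b}" "t \<in> {a..b}" "x \<in> W" for s t x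
    unfolding symplectic_at_def
    by (intro bexI[of _ c] conjI) (use that c(1) in \<open>auto simp: W_def\<close>)
  moreover have "s \<in> {a..b}" if "s \<in> {0..1}" "\<bar>s - \<tau>\<bar> < e" for s
    using that by (auto simp: a_def b_def)
  ultimately show ?thesis using e W by (intro exI[of _ e] exI[of _ W] conjI) auto
qed

text \<open>The passage from short times to [0,1] is made by connectedness: the property
  \<open>Q\<close> is locally constant in \<open>t\<close> and holds at 0, where the flow is
  \<open>id\<close>. Carrying the inverse along in \<open>Q\<close> replaces an inverse function
  theorem.\<close>

lemma flow_symplectic_at:
  assumes "t \<in> {0..1}"
  shows "symplectic_at (\<Phi> t) x \<and> symplectic_at (inv (\<Phi> t)) (\<Phi> t x)"
proof -
  define Q where "Q t \<longleftrightarrow> symplectic_at (\<Phi> t) x \<and> symplectic_at (inv (\<Phi> t)) (\<Phi> t x)" for t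
  have cont: "continuous_on {0..1} (\<lambda>t. \<Phi> t x)" using flow_sol[of x] by (simp add: sol_def)
  have "Q 0 = Q t"
  proof (rule connected_local_const[OF connected_Icc _ assms], simp, intro ballI eventually_at_within_nhds)
    fix \<tau> :: real assume \<tau>: "\<tau> \<in> {0..1}"
    from evol_symplectic[OF \<tau>, of "\<Phi> \<tau> x"]
    obtain e W where e: "e > 0" and W: "open W" "\<Phi> \<tau> x \<in> W"
      "\<forall>s\<in>{0..1}. \<forall>t\<in>{0..1}. \<forall>y\<in>W. \<bar>s - \<tau>\<bar> < e \<longrightarrow> \<bar>t - \<tau>\<bar> < e \<longrightarrow> symplectic_at (evol s t) y"
      by (elim exE conjE)
    \<comment> \<open>Symmetric in \<open>s\<close> and \<open>t\<close>: used from
      \<open>\<tau>\<close> to \<open>t\<close> and back, it gives the equivalence that local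
      constancy requires.\<close>
    have step: "Q t" if "Q s" "s \<in> {0..1}" "t \<in> {0..1}" "\<bar>s - \<tau>\<bar> < e" "\<bar>t - \<tau>\<bar> < e" "\<Phi> s x \<in> W" "\<Phi> t x \<in> W" for s t
    proof -
      have "symplectic_at (evol s t \<circ> \<Phi> s) x"
        by (rule symplectic_at_compose) (use that W(3) in \<open>auto simp: Q_def\<close>)
      then have 1: "symplectic_at (\<Phi> t) x" using evol_flow[OF that(2)] by simp
      have "evol t s (\<Phi> t x) = \<Phi> s x" using fun_cong[OF evol_flow[OF that(3), of s], of x] by simp
      then have "symplectic_at (inv (\<Phi> s) \<circ> evol t s) (\<Phi> t x)"
        by (intro symplectic_at_compose) (use that W(3) in \<open>auto simp: Q_def\<close>)
      then have "symplectic_at (inv (\<Phi> t)) (\<Phi> t x)" using inv_flow_evol[OF that(2)] by simp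
      with 1 show ?thesis by (simp add: Q_def)
    qed
    have "\<forall>\<^sub>F t in nhds \<tau>. t \<in> {0..1} \<longrightarrow> \<Phi> t x \<in> W"
      by (rule eventually_nhds_image[OF cont \<tau> W(1,2)])
    moreover have "\<forall>\<^sub>F t in nhds \<tau>. \<bar>t - \<tau>\<bar> < e"
      unfolding eventually_nhds_metric using e by (auto simp: dist_real_def)
    ultimately show "\<forall>\<^sub>F t in nhds \<tau>. t \<in> {0..1} \<longrightarrow> Q \<tau> = Q t"
    proof eventually_elim
      case (elim t)
      show ?case
      proof
        assume t: "t \<in> {0..1}"
        have "Q t" if "Q \<tau>"
          by (rule step[OF that \<tau> t]) (use elim t e W(2) in auto)
        moreover have "Q \<tau>" if "Q t"
          by (rule step[OF that t \<tau>]) (use elim t e W(2) in auto)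
        ultimately show "Q \<tau> = Q t" by blast
      qed
    qed
  qed
  moreover have "\<Phi> 0 = id" using flow_0 by auto
  then have "Q 0" using symplectic_at_id by (simp add: Q_def)
  ultimately show ?thesis by (simp add: Q_def)
qed

lemma flow_locally_symplectic: "locally_symplectic (\<Phi> 1)" "locally_symplectic (inv (\<Phi> 1))"
proof -
  show "locally_symplectic (\<Phi> 1)" using flow_symplectic_at[of 1] by (simp add: locally_symplectic_def)
  have "symplectic_at (inv (\<Phi> 1)) y" for y
    using flow_symplectic_at[of 1 "inv (\<Phi> 1) y"] surj_f_inv_f[OF bij_is_surj[OF flow_bij[of 1]], of y] by simp
  then show "locally_symplectic (inv (\<Phi> 1))" by (simp add: locally_symplectic_def)
qed

end

section \<open>Displacement by maps extending the circle action\<close>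

lemma vector_derivative_at_0:
  assumes "\<And>e. e > 0 \<Longrightarrow> \<exists>\<delta>>0. \<forall>t. 0 < t \<longrightarrow> t < \<delta> \<longrightarrow> \<bar>g t - g 0 - t * D\<bar> \<le> e * t"
  shows "vector_derivative g (at 0 within {0..1}) = (D::real)"
proof -
  have "(g has_vector_derivative D) (at 0 within {0..1})"
    unfolding has_vector_derivative_def has_derivative_within_alt
  proof (intro conjI allI impI)
    show "bounded_linear (\<lambda>x. x *\<^sub>R D)" by (rule bounded_linear_scaleR_left)
    fix e :: real assume "e > 0"
    then obtain \<delta> where "\<delta> > 0" "\<And>t. 0 < t \<Longrightarrow> t < \<delta> \<Longrightarrow> \<bar>g t - g 0 - t * D\<bar> \<le> e * t" using assms by meson
    then have "norm (g y - g 0 - (y - 0) *\<^sub>R D) \<le> e * norm (y - 0)" if "y \<in> {0..1}" "norm (y - 0) < \<delta>" for y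
      using that by (cases "y = 0") auto
    then show "\<exists>d>0. \<forall>y\<in>{0..1}. norm (y - 0) < d \<longrightarrow> norm (g y - g 0 - (y - 0) *\<^sub>R D) \<le> e * norm (y - 0)"
      using \<open>\<delta> > 0\<close> by blast
  qed
  then show ?thesis using vector_derivative_within_closed_interval[of 0 1 0 g D] by simp
qed

section \<open>First-order growth of functions along the isotopy\<close>

context symplectic
begin

lemma smooth_fun_compose:
  assumes f: "smooth_fun \<A> f" and F: "locally_symplectic F" and c: "c \<in> \<A>" "x \<in> fst c"
  shows "\<exists>N. open N \<and> snd c x \<in> N \<and> N \<subseteq> chart_img c \<and> Ck_on 1 N (f \<circ> F \<circ> chart_inv c)"
    and "v \<in> tangent_space \<A> x \<Longrightarrow> differential_fun \<A> (f \<circ> F) x v = differential_fun \<A> f (F x) (differential_map \<A> F x v)"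
proof -
  obtain d where d: "d \<in> \<A>" "F x \<in> fst d" using ex_chart by blast
  define g where "g = coord_map c d F"
  obtain N where N: "open N" "snd c x \<in> N" "N \<subseteq> chart_img c" "\<And>p. p \<in> N \<Longrightarrow> F (chart_inv c p) \<in> fst d"
    "\<And>n. Ck_on n N g"
    using locally_symplectic_charts[OF F c(1) d(1) c(2) d(2)] unfolding sympl_at_def g_def by metis
  have fd: "Ck_on n (chart_img d) (f \<circ> chart_inv d)" for n
    using f d smooth_on_open_iff[OF open_chart_img[OF d(1)]] unfolding smooth_fun_def by blast
  have gO: "g ` N \<subseteq> chart_img d" using N(4) by (auto simp: g_def)
  have eq: "(f \<circ> chart_inv d) (g p) = (f \<circ> F \<circ> chart_inv c) p" if "p \<in> N" for p
    using N(4)[OF that] chart_inv_left[OF d(1)] by (simp add: g_def)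
  have "Ck_on n N (f \<circ> F \<circ> chart_inv c)" for n
    by (rule Ck_on_cong[OF N(1) eq Ck_on_compose[OF N(1) open_chart_img[OF d(1)] N(5) fd gO]])
  then show "\<exists>N. open N \<and> snd c x \<in> N \<and> N \<subseteq> chart_img c \<and> Ck_on 1 N (f \<circ> F \<circ> chart_inv c)"
    using N by blast
  assume v: "v \<in> tangent_space \<A> x"
  define D where "D = fderiv g (snd c x)"
  have D: "(g has_derivative D) (at (snd c x))"
    unfolding D_def by (rule Ck_on_has_derivative[OF N(5) N(2)])
  define D' where "D' = fderiv (f \<circ> chart_inv d) (snd d (F x))"
  have D': "((f \<circ> chart_inv d) has_derivative D') (at (snd d (F x)))"
    unfolding D'_def by (rule Ck_on_has_derivative[OF fd]) (use d in auto)
  have dm: "differential_map \<A> F x v = toc d (F x) (D (v c))"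
    by (rule differential_map_eq[OF c(1) d(1) c(2) d(2) v D[unfolded g_def] N(1-4)])
  have "g (snd c x) = snd d (F x)" by (simp add: g_def chart_inv_left[OF c])
  then have "((\<lambda>p. (f \<circ> chart_inv d) (g p)) has_derivative (\<lambda>u. D' (D u))) (at (snd c x))"
    using has_derivative_compose[OF D, of "f \<circ> chart_inv d" D'] D' by simp
  then have "((f \<circ> F \<circ> chart_inv c) has_derivative (\<lambda>u. D' (D u))) (at (snd c x))"
    by (rule has_derivative_transform_within_open[OF _ N(1,2) eq])
  then have "differential_fun \<A> (f \<circ> F) x v = D' (D (v c))"
    by (rule differential_fun_eq[OF c v])
  also have "\<dots> = differential_fun \<A> f (F x) (differential_map \<A> F x v)"
    unfolding dm differential_fun_eq[OF d toc_tangent[OF d] D'] toc_self[OF d] ..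
  finally show "differential_fun \<A> (f \<circ> F) x v = differential_fun \<A> f (F x) (differential_map \<A> F x v)" .
qed

text \<open>A one-sided derivative \<open>D\<close> at \<open>x\<close> whose error estimate holds,
  with the same \<open>D\<close>, for all base points near \<open>x\<close>. This uniformity is what
  the compactness argument needs; a derivative at each single point would not do.\<close>

definition linear_growth :: "(real \<Rightarrow> 'm \<Rightarrow> 'm) \<Rightarrow> ('m \<Rightarrow> real) \<Rightarrow> 'm \<Rightarrow> real \<Rightarrow> bool" where
  "linear_growth \<psi> h x D \<longleftrightarrow> (\<forall>e>0. \<exists>W \<delta>. open W \<and> x \<in> W \<and> \<delta> > 0 \<and>
      (\<forall>y\<in>W. \<forall>t. 0 < t \<longrightarrow> t < \<delta> \<longrightarrow> \<bar>h (\<psi> t y) - h y - t * D\<bar> \<le> e * t))"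

text \<open>The vector \<open>v\<close> is the initial velocity of the isotopy at \<open>x0\<close>,
  read off a smooth extension of its coordinate expression across time 0. It is chosen before
  \<open>h\<close>, because the growth of \<open>f\<close> and of its composition with a
  symplectomorphism will be compared along the same vector.\<close>

lemma isotopy_velocity:
  assumes \<psi>: "smooth_map_family \<A> {0..1} \<psi>" "\<psi> 0 = id" and c: "c \<in> \<A>" "x0 \<in> fst c"
  shows "\<exists>v\<in>tangent_space \<A> x0. \<forall>h N. open N \<and> snd c x0 \<in> N \<and> N \<subseteq> chart_img c \<and>
      Ck_on 1 N (h \<circ> chart_inv c) \<longrightarrow> linear_growth \<psi> h x0 (differential_fun \<A> h x0 v)"
proof -
  define S where "S = {(p, snd c x) | p x. p \<in> {0..1::real} \<and> x \<in> fst c \<and> \<psi> p x \<in> fst c}"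
  define z0 where "z0 = (0::real, snd c x0)"
  have z0: "z0 \<in> S" unfolding z0_def S_def using c \<psi>(2) by auto
  have "smooth_on S (\<lambda>(p, u). snd c (\<psi> p (chart_inv c u)))"
    using \<psi>(1) c unfolding smooth_map_family_def S_def by blast
  from bspec[OF this[unfolded smooth_on_def] z0]
  obtain U G where U: "open U" "z0 \<in> U" "\<forall>n. Ck_on n U G"
    "\<forall>z\<in>S \<inter> U. G z = (case z of (p, u) \<Rightarrow> snd c (\<psi> p (chart_inv c u)))"
    by (elim exE conjE)
  have GS: "G (t, snd c x) = snd c (\<psi> t x)" if "(t, snd c x) \<in> U" "t \<in> {0..1}" "x \<in> fst c" "\<psi> t x \<in> fst c" for t x
  proof -
    have "(t, snd c x) \<in> S \<inter> U" using that unfolding S_def by blast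
    from bspec[OF U(4) this] show ?thesis by (simp add: chart_inv_left[OF c(1) that(3)])
  qed
  have Gz: "G z0 = snd c x0" using GS[of 0 x0] U(2) c \<psi>(2) by (simp add: z0_def)
  define G' where "G' = fderiv G z0"
  have G': "(G has_derivative G') (at z0)"
    unfolding G'_def using U(3)[rule_format, of 1] U(2) by (simp add: frechet_derivative_works[symmetric])
  define v where "v = toc c x0 (G' (1, 0))"
  have vT: "v \<in> tangent_space \<A> x0" unfolding v_def by (rule toc_tangent[OF c])
  show ?thesis
    unfolding linear_growth_def
  proof (intro bexI[OF _ vT] allI impI, elim conjE)
    fix h :: "'m \<Rightarrow> real" and N and e :: real
    assume N: "open N" "snd c x0 \<in> N" "N \<subseteq> chart_img c" and "Ck_on 1 N (h \<circ> chart_inv c)" and e: "e > 0"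
    then have h: "Ck_on (Suc 0) N (h \<circ> chart_inv c)" by (simp only: One_nat_def)
    define k where "k z = (h \<circ> chart_inv c) (G z)" for z
    define Q where "Q = U \<inter> G -` N"
    have Q: "open Q" "z0 \<in> Q"
      unfolding Q_def using U N Gz
      by (auto intro!: continuous_open_preimage[OF Ck_on_continuous[OF U(3)[rule_format, of 0]]])
    have kQ: "Ck_on (Suc 0) Q k"
      unfolding k_def
      by (rule Ck_on_compose[OF Q(1) N(1) Ck_on_subset[OF U(3)[rule_format]] h])
        (auto simp: Q_def)
    define k' where "k' z = fderiv k z (1, 0)" for z
    have k'_cont: "continuous_on Q k'" using kQ by (simp add: k'_def[abs_def])
    have k_der: "(k has_derivative fderiv k z) (at z)" if "z \<in> Q" for z
      by (rule Ck_on_has_derivative[OF kQ that])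
    define D where "D = fderiv (h \<circ> chart_inv c) (snd c x0)"
    have D: "((h \<circ> chart_inv c) has_derivative D) (at (snd c x0))"
      unfolding D_def by (rule Ck_on_has_derivative[OF h N(2)])
    have "(k has_derivative (\<lambda>w. D (G' w))) (at z0)"
      unfolding k_def[abs_def] using has_derivative_compose[OF G', of "h \<circ> chart_inv c" D] D Gz by simp
    from frechet_derivative_at[OF this, symmetric] have "k' z0 = D (G' (1, 0))" by (simp add: k'_def)
    also have "\<dots> = differential_fun \<A> h x0 v"
      using differential_fun_eq[OF c vT D] toc_self[OF c, of "G' (1, 0)"] by (simp add: v_def)
    finally have k'0: "k' z0 = differential_fun \<A> h x0 v" .
    have "\<forall>\<^sub>F z in nhds z0. z \<in> Q \<and> (z \<in> Q \<longrightarrow> k' z \<in> ball (k' z0) e)"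
      using Q e by (intro eventually_conj eventually_nhds_image[OF k'_cont]) (auto simp: eventually_nhds)
    then obtain A where A: "open A" "z0 \<in> A" "\<And>z. z \<in> A \<Longrightarrow> z \<in> Q \<and> \<bar>k' z - k' z0\<bar> < e"
      unfolding eventually_nhds by (auto simp: dist_real_def abs_minus_commute)
    obtain T P where TP: "open T" "open P" "z0 \<in> T \<times> P" "T \<times> P \<subseteq> A" using open_prod_elim[OF A(1,2)] by blast
    obtain d1 where d1: "d1 > 0" "ball 0 d1 \<subseteq> T" using TP by (auto simp: z0_def elim: openE)
    have cont\<psi>: "continuous_on ({0..1} \<times> UNIV) (\<lambda>z. \<psi> (fst z) (snd z))"
      using \<psi>(1) unfolding smooth_map_family_def by (simp add: case_prod_unfold)
    have "\<forall>\<^sub>F z in nhds (0, x0). z \<in> {0..1} \<times> UNIV \<longrightarrow> \<psi> (fst z) (snd z) \<in> fst c"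
      by (rule eventually_nhds_image[OF cont\<psi>]) (use c \<psi>(2) open_chart[OF c(1)] in auto)
    then obtain B where "open B" "(0, x0) \<in> B" and B: "\<And>z. z \<in> B \<Longrightarrow> z \<in> {0..1} \<times> UNIV \<Longrightarrow> \<psi> (fst z) (snd z) \<in> fst c"
      unfolding eventually_nhds by auto
    then obtain T' W' where T': "open T'" "open W'" "(0, x0) \<in> T' \<times> W'" "T' \<times> W' \<subseteq> B"
      using open_prod_elim by metis
    obtain d2 where d2: "d2 > 0" "ball 0 d2 \<subseteq> T'" using T' by (auto elim: openE)
    define W where "W = W' \<inter> {x \<in> fst c. snd c x \<in> P}"
    define \<delta> where "\<delta> = min 1 (min d1 d2)"
    have W: "open W" "x0 \<in> W"
      unfolding W_def using open_chart_vimage[OF c(1) TP(2)] T' c TP by (auto simp: z0_def)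
    have \<delta>: "\<delta> > 0" using d1 d2 by (simp add: \<delta>_def)
    have key: "\<bar>h (\<psi> t x) - h x - t * differential_fun \<A> h x0 v\<bar> \<le> e * t" if x: "x \<in> W" and t: "0 < t" "t < \<delta>" for x t
    proof -
      have inA: "(r, snd c x) \<in> A" if "r \<in> {0..t}" for r
        using that t d1 TP(4) x by (auto simp: \<delta>_def W_def subset_iff)
      have in\<psi>: "\<psi> r x \<in> fst c" if "r \<in> {0..t}" for r
        using that t d2 T'(4) x B[of "(r, x)"] by (auto simp: \<delta>_def W_def subset_iff)
      have kh: "k (r, snd c x) = h (\<psi> r x)" if "r \<in> {0..t}" for r
      proof -
        have "G (r, snd c x) = snd c (\<psi> r x)"
          using A(3)[OF inA[OF that]] in\<psi>[OF that] that t x by (intro GS) (auto simp: Q_def \<delta>_def W_def)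
        then show ?thesis using chart_inv_left[OF c(1) in\<psi>[OF that]] by (simp add: k_def)
      qed
      \<comment> \<open>The increment is \<open>t\<close> times a time derivative taken at a point
        of \<open>A\<close>, where this derivative is within \<open>e\<close> of its value at
        \<open>z0\<close>.\<close>
      have "\<exists>r\<in>{0<..<t}. k (t, snd c x) - k (0, snd c x) = (t - 0) * k' (r, snd c x)"
      proof (rule mvt_simple[OF t(1)])
        fix r assume r: "0 \<le> r" "r \<le> t"
        then have rQ: "(r, snd c x) \<in> Q" using A(3)[OF inA[of r]] by simp
        have "((\<lambda>r. (r, snd c x)) has_derivative (\<lambda>h. (h, 0))) (at r within {0..t})"
          by (auto intro!: derivative_eq_intros)
        from has_derivative_compose[OF this k_der[OF rQ]]
        have "((\<lambda>r. k (r, snd c x)) has_derivative (\<lambda>h. fderiv k (r, snd c x) (h, 0))) (at r within {0..t})" .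
        moreover have "fderiv k (r, snd c x) (h, 0) = h * k' (r, snd c x)" for h
          using linear_scale[OF has_derivative_linear[OF k_der[OF rQ]], of h "(1, 0)"] by (simp add: k'_def)
        ultimately show "((\<lambda>r. k (r, snd c x)) has_derivative (\<lambda>h. h * k' (r, snd c x))) (at r within {0..t})" by simp
      qed
      then obtain r where r: "r \<in> {0<..<t}" "h (\<psi> t x) - h x = t * k' (r, snd c x)"
        using kh[of t] kh[of 0] t \<psi>(2) by auto
      have "\<bar>h (\<psi> t x) - h x - t * differential_fun \<A> h x0 v\<bar> = t * \<bar>k' (r, snd c x) - k' z0\<bar>"
        unfolding r(2) k'0[symmetric] using t by (simp add: abs_mult right_diff_distrib[symmetric])
      also have "\<dots> \<le> t * e" using A(3)[OF inA[of r]] r t by (intro mult_left_mono) auto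
      finally show ?thesis by (simp add: mult.commute)
    qed
    then show "\<exists>W \<delta>. open W \<and> x0 \<in> W \<and> \<delta> > 0 \<and> (\<forall>x\<in>W. \<forall>t. 0 < t \<longrightarrow> t < \<delta> \<longrightarrow>
        \<bar>h (\<psi> t x) - h x - t * differential_fun \<A> h x0 v\<bar> \<le> e * t)"
      using W \<delta> by (intro exI[of _ W] exI[of _ \<delta>]) auto
  qed
qed

text \<open>Locally near a pair of points, the values of \<open>f\<close> on the two sides are
  separated by a gap linear in \<open>t\<close>; compactness of the set of pairs then gives one
  range of times for all of them.\<close>

lemma eventually_disjoint:
  assumes \<psi>: "smooth_map_family \<A> {0..1} \<psi>" "\<psi> 0 = id" and X\<^sub>0: "compact X\<^sub>0"
    and f: "smooth_fun \<A> f" "rigidifying \<A> \<omega> X\<^sub>0 (differential_fun \<A> f)"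
    and F: "locally_symplectic F" and \<theta>: "symplectomorphism \<A> \<omega> \<theta>" "\<And>x. x \<in> X\<^sub>0 \<Longrightarrow> \<theta> x = x"
    and sgn: "\<And>x. x \<in> X\<^sub>0 \<Longrightarrow> f x \<ge> 0" "\<And>x. x \<in> X\<^sub>0 \<Longrightarrow> f (F x) \<le> 0"
    and der: "\<And>x. x \<in> X\<^sub>0 \<Longrightarrow> vector_derivative (\<lambda>t. f (\<psi> t x)) (at 0 within {0..1}) > 0"
      "\<And>x. x \<in> X\<^sub>0 \<Longrightarrow> vector_derivative (\<lambda>t. f (F (\<psi> t x))) (at 0 within {0..1}) \<le> 0"
  shows "\<forall>\<^sub>F t in at_right 0. \<forall>z\<in>X\<^sub>0 \<times> X\<^sub>0. \<theta> (\<psi> t (fst z)) \<noteq> F (\<psi> t (snd z))"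
proof (rule eventually_uniform_compact[OF compact_Times[OF X\<^sub>0 X\<^sub>0]])
  fix z0 assume "z0 \<in> X\<^sub>0 \<times> X\<^sub>0"
  then obtain x0 y0 where z0: "z0 = (x0, y0)" "x0 \<in> X\<^sub>0" "y0 \<in> X\<^sub>0" by auto
  have \<theta>L: "locally_symplectic \<theta>" by (rule symplectomorphismD[OF \<theta>(1)])
  have idL: "locally_symplectic id" using symplectic_at_id by (simp add: locally_symplectic_def)
  have R: "\<exists>v\<in>tangent_space \<A> x. \<forall>E. locally_symplectic E \<longrightarrow> linear_growth \<psi> (f \<circ> E) x (differential_fun \<A> (f \<circ> E) x v)" for x
  proof -
    obtain c where c: "c \<in> \<A>" "x \<in> fst c" using ex_chart by blast
    from isotopy_velocity[OF \<psi> c] obtain v where v: "v \<in> tangent_space \<A> x"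
      and est: "\<forall>h N. open N \<and> snd c x \<in> N \<and> N \<subseteq> chart_img c \<and>
      Ck_on 1 N (h \<circ> chart_inv c) \<longrightarrow> linear_growth \<psi> h x (differential_fun \<A> h x v)"
      by (elim bexE)
    show ?thesis
    proof (intro bexI[of _ v] allI impI)
      fix E assume "locally_symplectic E"
      from smooth_fun_compose(1)[OF f(1) this c] obtain N where
        "open N" "snd c x \<in> N" "N \<subseteq> chart_img c" "Ck_on 1 N (f \<circ> E \<circ> chart_inv c)" by blast
      with est[rule_format, of N "f \<circ> E"] show "linear_growth \<psi> (f \<circ> E) x (differential_fun \<A> (f \<circ> E) x v)" by blast
    qed (rule v)
  qed
  \<comment> \<open>\<open>vector_derivative\<close> is informative only if the derivative exists;
    linear growth supplies existence and identifies it with the differential, so the sign hypotheses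
    become usable.\<close>
  have R_vd: "vector_derivative (\<lambda>t. h (\<psi> t x)) (at 0 within {0..1}) = D" if "linear_growth \<psi> h x D" for h x D
  proof (rule vector_derivative_at_0)
    fix e :: real assume "e > 0"
    from that[unfolded linear_growth_def, rule_format, OF this]
    obtain W \<delta> where "x \<in> W" "\<delta> > 0" "\<forall>y\<in>W. \<forall>t. 0 < t \<longrightarrow> t < \<delta> \<longrightarrow> \<bar>h (\<psi> t y) - h y - t * D\<bar> \<le> e * t"
      by (elim exE conjE)
    then show "\<exists>\<delta>>0. \<forall>t. 0 < t \<longrightarrow> t < \<delta> \<longrightarrow> \<bar>h (\<psi> t x) - h (\<psi> 0 x) - t * D\<bar> \<le> e * t"
      using \<psi>(2) by (intro exI[of _ \<delta>]) auto
  qed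
  from R[of x0] obtain v where v: "v \<in> tangent_space \<A> x0"
    "\<forall>E. locally_symplectic E \<longrightarrow> linear_growth \<psi> (f \<circ> E) x0 (differential_fun \<A> (f \<circ> E) x0 v)"
    by (elim bexE)
  from R[of y0] obtain w where w:
    "\<forall>E. locally_symplectic E \<longrightarrow> linear_growth \<psi> (f \<circ> E) y0 (differential_fun \<A> (f \<circ> E) y0 w)"
    by (elim bexE)
  define d where "d = differential_fun \<A> f x0 v"
  have d: "d > 0" using R_vd[OF v(2)[rule_format, OF idL]] der(1)[OF z0(2)] by (simp add: d_def)
  obtain c where c: "c \<in> \<A>" "x0 \<in> fst c" using ex_chart by blast
  have "differential_fun \<A> (f \<circ> \<theta>) x0 v = differential_fun \<A> f (\<theta> x0) (differential_map \<A> \<theta> x0 v)"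
    by (rule smooth_fun_compose(2)[OF f(1) \<theta>L c v(1)])
  \<comment> \<open>The only use of rigidity: the differential of \<open>f\<close> takes the same
    value on \<open>v\<close> and on its image under \<open>\<theta>\<close>.\<close>
  also have "\<dots> = d" unfolding d_def using f(2) \<theta> z0(2) v(1) unfolding rigidifying_def by blast
  finally have R\<theta>: "linear_growth \<psi> (f \<circ> \<theta>) x0 d" using v(2)[rule_format, OF \<theta>L] by simp
  define d' where "d' = differential_fun \<A> (f \<circ> F) y0 w"
  have RF: "linear_growth \<psi> (f \<circ> F) y0 d'" using w[rule_format, OF F] by (simp add: d'_def)
  have d': "d' \<le> 0" using R_vd[OF RF] der(2)[OF z0(3)] by simp
  obtain W \<delta> where W: "open W" "x0 \<in> W" "\<delta> > 0"
    "\<forall>y\<in>W. \<forall>t. 0 < t \<longrightarrow> t < \<delta> \<longrightarrow> \<bar>(f \<circ> \<theta>) (\<psi> t y) - (f \<circ> \<theta>) y - t * d\<bar> \<le> d / 4 * t"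
    using R\<theta>[unfolded linear_growth_def, rule_format, of "d / 4"] d by auto
  obtain W' \<delta>' where W': "open W'" "y0 \<in> W'" "\<delta>' > 0"
    "\<forall>y\<in>W'. \<forall>t. 0 < t \<longrightarrow> t < \<delta>' \<longrightarrow> \<bar>(f \<circ> F) (\<psi> t y) - (f \<circ> F) y - t * d'\<bar> \<le> d / 4 * t"
    using RF[unfolded linear_growth_def, rule_format, of "d / 4"] d by auto
  \<comment> \<open>With tolerance \<open>d / 4\<close> on both sides, \<open>f\<close> is at least
    \<open>3 * d / 4 * t\<close> at the first point and at most \<open>d / 4 * t\<close> at the
    second, since \<open>f x \<ge> 0\<close>, \<open>f (F y) \<le> 0\<close> and
    \<open>d' \<le> 0\<close>.\<close>
  have key: "\<theta> (\<psi> t x) \<noteq> F (\<psi> t y)" if "x \<in> X\<^sub>0" "y \<in> X\<^sub>0" "x \<in> W" "y \<in> W'" "0 < t" "t < min \<delta> \<delta>'" for x y t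
  proof
    assume eq: "\<theta> (\<psi> t x) = F (\<psi> t y)"
    have 1: "\<bar>f (\<theta> (\<psi> t x)) - f x - t * d\<bar> \<le> d / 4 * t" using W(4) that \<theta>(2) by auto
    have 2: "\<bar>f (F (\<psi> t y)) - f (F y) - t * d'\<bar> \<le> d / 4 * t" using W'(4) that by auto
    have "t * d' \<le> 0" using d' that by (simp add: mult_nonneg_nonpos)
    moreover have "t * d > 0" using d that by simp
    moreover have "d / 4 * t = t * d / 4" by simp
    ultimately show False
      using abs_le_D2[OF 1[unfolded eq]] abs_le_D1[OF 2] sgn(1)[OF that(1)] sgn(2)[OF that(2)] by linarith
  qed
  have ev1: "\<forall>\<^sub>F z in nhds z0. fst z \<in> W \<and> snd z \<in> W'"
    using eventually_nhds_in_open[of "W \<times> W'" z0] W W' by (simp add: open_Times z0 mem_Times_iff)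
  have ev2: "\<forall>\<^sub>F t in at_right 0. 0 < t \<and> t < min \<delta> \<delta>'"
    using W(3) W'(3) by (auto simp: eventually_at_right[of 0 1] intro!: exI[of _ "min \<delta> \<delta>'"])
  show "\<forall>\<^sub>F z in nhds z0 \<times>\<^sub>F at_right 0. fst z \<in> X\<^sub>0 \<times> X\<^sub>0 \<longrightarrow> \<theta> (\<psi> (snd z) (fst (fst z))) \<noteq> F (\<psi> (snd z) (snd (fst z)))"
    using eventually_prodI[OF ev1 ev2] by eventually_elim (use key in auto)
qed

end

theorem lemma14:
  fixes \<A> :: "('m::{t2_space, second_countable_topology}, 'e::euclidean_space) chart set"
    and \<omega> :: "'m \<Rightarrow> ('m, 'e) tvec \<Rightarrow> ('m, 'e) tvec \<Rightarrow> real"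
    and \<phi> :: "complex \<Rightarrow> 'm \<Rightarrow> 'm"
    and X\<^sub>0 X :: "'m set"
    and z\<^sub>0 :: complex
    and \<psi> :: "real \<Rightarrow> 'm \<Rightarrow> 'm"
  assumes "symplectic_manifold \<A> \<omega>"
    and "hamiltonian_circle_action \<A> \<omega> \<phi>"
    and "compact X\<^sub>0"
    and "X = (\<Union>z\<in>sphere 0 1. \<phi> z ` X\<^sub>0)"
    and "z\<^sub>0 \<in> sphere 0 1"
    and "smooth_map_family \<A> {0..1} \<psi>"
    and "\<psi> 0 = id"
    and "\<exists>f. smooth_fun \<A> f \<and>
           rigidifying \<A> \<omega> X\<^sub>0 (differential_fun \<A> f) \<and>
           f ` X\<^sub>0 \<subseteq> {0..} \<and>
           (f \<circ> \<phi> z\<^sub>0) ` X\<^sub>0 \<subseteq> {..0} \<and>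
           (\<forall>x\<in>X\<^sub>0. vector_derivative (\<lambda>t. f (\<psi> t x)) (at 0 within {0..1}) > 0 \<and>
                    vector_derivative (\<lambda>t. f (\<phi> z\<^sub>0 (\<psi> t x))) (at 0 within {0..1}) \<le> 0)"
  shows "rel_hofer_norm \<A> \<omega> X (restrict (\<phi> (cnj z\<^sub>0)) X)
           \<ge> Limsup (at_right 0) (\<lambda>t. displacement_energy \<A> \<omega> (\<psi> t ` X\<^sub>0))"
proof -
  interpret symplectic \<A> \<omega>
    using assms(1) by unfold_locales (auto simp: symplectic_manifold_def)
  obtain f where f: "smooth_fun \<A> f" "rigidifying \<A> \<omega> X\<^sub>0 (differential_fun \<A> f)"
    "\<And>x. x \<in> X\<^sub>0 \<Longrightarrow> f x \<ge> 0" "\<And>x. x \<in> X\<^sub>0 \<Longrightarrow> f (\<phi> z\<^sub>0 x) \<le> 0"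
    "\<And>x. x \<in> X\<^sub>0 \<Longrightarrow> vector_derivative (\<lambda>t. f (\<psi> t x)) (at 0 within {0..1}) > 0"
    "\<And>x. x \<in> X\<^sub>0 \<Longrightarrow> vector_derivative (\<lambda>t. f (\<phi> z\<^sub>0 (\<psi> t x))) (at 0 within {0..1}) \<le> 0"
    using assms(8) by (auto simp: image_subset_iff)
  have act: "\<phi> 1 = id" "\<And>z w. z \<in> sphere 0 1 \<Longrightarrow> w \<in> sphere 0 1 \<Longrightarrow> \<phi> (z * w) = \<phi> z \<circ> \<phi> w"
    "\<And>z. z \<in> sphere 0 1 \<Longrightarrow> symplectomorphism \<A> \<omega> (\<phi> z)"
    using assms(2) unfolding hamiltonian_circle_action_def by blast+
  have cz: "cnj z\<^sub>0 \<in> sphere 0 1" using assms(5) by simp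
  have zc: "z\<^sub>0 * cnj z\<^sub>0 = 1" using assms(5) by (simp add: complex_norm_square[symmetric])
  have inv1: "\<phi> z\<^sub>0 \<circ> \<phi> (cnj z\<^sub>0) = id" using act(2)[OF assms(5) cz] act(1) zc by simp
  have inv2: "\<phi> (cnj z\<^sub>0) \<circ> \<phi> z\<^sub>0 = id" using act(2)[OF cz assms(5)] act(1) zc by (simp add: mult.commute)
  have inv\<phi>: "inv (\<phi> z\<^sub>0) = \<phi> (cnj z\<^sub>0)" by (rule inv_unique_comp[OF inv1 inv2])
  have bij\<phi>: "bij (\<phi> z\<^sub>0)" using act(3)[OF assms(5)] by (simp add: symplectomorphism_def)
  have L: "locally_symplectic (\<phi> z\<^sub>0)" "locally_symplectic (\<phi> (cnj z\<^sub>0))"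
    using symplectomorphismD act(3) assms(5) cz by blast+
  \<comment> \<open>Every Hamiltonian whose time-one map has the prescribed restriction to
    \<open>X\<close> eventually competes in the displacement energy.\<close>
  have main: "Limsup (at_right 0) (\<lambda>t. displacement_energy \<A> \<omega> (\<psi> t ` X\<^sub>0)) \<le> osc_norm UNIV H"
    if H: "H \<in> ham_functions \<A> \<omega> UNIV" and ext: "restrict (ham_flow \<A> \<omega> H 1) X = restrict (\<phi> (cnj z\<^sub>0)) X" for H
  proof -
    interpret ham_isotopy \<A> \<omega> H using H by unfold_locales
    define \<theta> where "\<theta> = \<phi> z\<^sub>0 \<circ> \<Phi> 1"
    have \<Phi>: "bij (\<Phi> 1)" by (rule flow_bij) simp
    have comp: "locally_symplectic (G \<circ> F)" if "locally_symplectic F" "locally_symplectic G" for F G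
      using that symplectic_at_compose by (simp add: locally_symplectic_def)
    have "inv \<theta> = inv (\<Phi> 1) \<circ> \<phi> (cnj z\<^sub>0)"
      unfolding \<theta>_def o_inv_distrib[OF bij\<phi> \<Phi>] inv\<phi> ..
    then have \<theta>: "symplectomorphism \<A> \<omega> \<theta>"
      using comp flow_locally_symplectic L \<Phi> bij\<phi> by (intro symplectomorphismI) (auto simp: \<theta>_def intro: bij_comp)
    have fixX: "\<theta> x = x" if "x \<in> X\<^sub>0" for x
    proof -
      have "x \<in> X" using that act(1) assms(4) by (auto intro!: bexI[of _ 1])
      then have "\<Phi> 1 x = \<phi> (cnj z\<^sub>0) x" using fun_cong[OF ext, of x] by simp
      then show ?thesis using fun_cong[OF inv1, of x] by (simp add: \<theta>_def)
    qed
    have "\<forall>\<^sub>F t in at_right 0. \<forall>z\<in>X\<^sub>0 \<times> X\<^sub>0. \<theta> (\<psi> t (fst z)) \<noteq> \<phi> z\<^sub>0 (\<psi> t (snd z))"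
      by (rule eventually_disjoint[OF assms(6,7,3) f(1,2) L(1) \<theta> fixX f(3-6)])
    then have "\<forall>\<^sub>F t in at_right 0. displacement_energy \<A> \<omega> (\<psi> t ` X\<^sub>0) \<le> osc_norm UNIV H"
    proof eventually_elim
      case (elim t)
      \<comment> \<open>If \<open>\<Phi> 1\<close> mapped a point of the set back into the set,
        applying \<open>\<phi> z\<^sub>0\<close> would contradict the separation just
        obtained.\<close>
      have "\<Phi> 1 ` (\<psi> t ` X\<^sub>0) \<inter> \<psi> t ` X\<^sub>0 = {}"
        using elim by (force simp: \<theta>_def)
      then show ?case unfolding displacement_energy_def by (intro INF_lower) (use H in simp)
    qed
    then show ?thesis by (rule Limsup_bounded)
  qed
  \<comment> \<open>The relative norm is a double infimum, over extensions of the given map and over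
    Hamiltonians generating them; an empty infimum is infinite, so a lower bound for each competitor
    suffices.\<close>
  show ?thesis
    unfolding rel_hofer_norm_def hofer_norm_def
    by (intro INF_greatest) (use main in auto)
qed

end
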